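(* Let $X$ and $Y$ be proper extended metric spaces. Then any strongly continuous $*$-homomorphism $\phi\colon C^*_{\rm cp}(X)\to C^*_{\rm cp}(Y)$ is approximately controlled, i.e. for every $r\ge0$ and $\varepsilon>0$ there is $R\ge0$ such that for every $t\in C^*_{\rm cp}(X)$ of propagation at most $r$ there is an operator $s$ of propagation at most $R$ with $\|\phi(t)-s\|\le\varepsilon\|t\|$.
   Context: An extended metric space is a set with a metric allowed to take the value $+\infty$; it is proper if all closed balls of finite radius are compact. A subset $D\subseteq X$ is coarsely dense if there is $R<\infty$ such that every point of $X$ is within distance $R$ of $D$. An $X$-module is a Hilbert space $\mathcal H_X$ with a unital Boolean algebra $\mathfrak A$ of subsets of $X$ (the measurable sets) and a map $A\mapsto 1_A$ from $\mathfrak A$ to projections in $\mathcal B(\mathcal H_X)$ with $1_{A\cap A'}=1_A1_{A'}$, $1_{A\sqcup A'}=1_A+1_{A'}$ for disjoint $A,A'$, $1_X=\mathrm{id}$, and such that for some $r\geq 0$ the subspaces $1_A(\mathcal H_X)$, with $A$ measurable of diameter $\le r$, span a dense subspace. It is discrete if there are $r\ge0$ and a partition $X=\bigsqcup_i A_i$ into measurable sets of diameter $\le r$ with $\sum_i 1_{A_i}=1$ strongly and such that $C\subseteq X$ is measurable whenever every $C\cap A_i$ is. It is ample if for some $r\ge 0$ the union of the measurable sets $A$ of diameter $\le r$ with $1_A$ of infinite rank is coarsely dense in $X$. An operator $t\in\mathcal B(\mathcal H_X)$ has propagation at most $r$ if $1_{A'}t1_A=0$ for all measurable $A,A'$ with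 $d(a',a)>r$ for all $a\in A$, $a'\in A'$. $C^*_{\rm cp}(X)\subseteq\mathcal B(\mathcal H_X)$ denotes the norm closure of the operators of finite propagation, for a choice of ample discrete $X$-module $\mathcal H_X$ (and similarly for $Y$). Strongly continuous means continuous for the strong operator topologies of $\mathcal B(\mathcal H_X)$ and $\mathcal B(\mathcal H_Y)$. *)

theory Defs
  imports "HOL-Analysis.Analysis"
begin

section \<open>Complex Hilbert spaces and bounded operators\<close>

text \<open>
  The inner product is linear in the first argument. The norm axiom includes positive
  definiteness. Completeness comes from the class \<^class>\<open>banach\<close>.
\<close>

class complex_hilbert = banach +
  fixes scaleC :: "complex \<Rightarrow> 'a \<Rightarrow> 'a" (infixr \<open>*\<^sub>C\<close> 75)
    and cinner :: "'a \<Rightarrow> 'a \<Rightarrow> complex"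
  assumes scaleC_add_right: "c *\<^sub>C (x + y) = c *\<^sub>C x + c *\<^sub>C y"
    and scaleC_add_left: "(c + c') *\<^sub>C x = c *\<^sub>C x + c' *\<^sub>C x"
    and scaleC_scaleC: "c *\<^sub>C (c' *\<^sub>C x) = (c * c') *\<^sub>C x"
    and scaleC_of_real: "of_real r *\<^sub>C x = r *\<^sub>R x"
    and cinner_commute: "cinner x y = cnj (cinner y x)"
    and cinner_add_left: "cinner (x + y) z = cinner x z + cinner y z"
    and cinner_scaleC_left: "cinner (c *\<^sub>C x) y = c * cinner x y"
    and cinner_self: "cinner x x = of_real ((norm x)\<^sup>2)"
lemma scaleC_one: "1 *\<^sub>C x = (x :: 'a::complex_hilbert)"
  using scaleC_of_real[of 1 x] by simp

lemma norm_scaleC: "norm (c *\<^sub>C x) = norm c * norm (x :: 'a::complex_hilbert)"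
proof -
  have "cinner (c *\<^sub>C x) (c *\<^sub>C x) = c * cnj c * cinner x x"
    by (metis cinner_commute cinner_scaleC_left complex_cnj_mult mult.assoc)
  then have "complex_of_real ((norm (c *\<^sub>C x))\<^sup>2) = of_real ((norm c * norm x)\<^sup>2)"
    by (simp only: cinner_self complex_norm_square[symmetric] power_mult_distrib of_real_mult of_real_power)
  then have "(norm (c *\<^sub>C x))\<^sup>2 = (norm c * norm x)\<^sup>2"
    by (metis of_real_eq_iff)
  then show ?thesis
    by (simp add: power2_eq_iff_nonneg)
qed

global_interpretation complex_vector:
  vector_space "scaleC :: complex \<Rightarrow> 'a \<Rightarrow> 'a::complex_hilbert"
  by unfold_locales (simp_all add: scaleC_add_right scaleC_add_left scaleC_scaleC scaleC_one)

text \<open>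
  \<open>'h \<Rightarrow>\<^sub>L 'h\<close> consists of the bounded real-linear operators; the bounded
  operators of a complex Hilbert space are the complex-linear ones among them. Their operator
  norm is the norm of \<open>'h \<Rightarrow>\<^sub>L 'h\<close>.
\<close>

definition bounded_operators :: "('h::complex_hilbert \<Rightarrow>\<^sub>L 'h) set" where
  "bounded_operators = {t. \<forall>c v. blinfun_apply t (c *\<^sub>C v) = c *\<^sub>C blinfun_apply t v}"

lift_definition scaleC_operator ::
    "complex \<Rightarrow> ('h::complex_hilbert \<Rightarrow>\<^sub>L 'h) \<Rightarrow> ('h \<Rightarrow>\<^sub>L 'h)"
  is "\<lambda>c t v. c *\<^sub>C t v"
proof -
  fix c :: complex and t :: "'h \<Rightarrow> 'h"
  assume "bounded_linear t"
  moreover have "bounded_linear (\<lambda>v::'h. c *\<^sub>C v)"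
  proof (rule bounded_linear_intro)
    fix r :: real and v :: 'h
    show "c *\<^sub>C r *\<^sub>R v = r *\<^sub>R c *\<^sub>C v"
      by (metis scaleC_of_real scaleC_scaleC mult.commute)
    show "norm (c *\<^sub>C v) \<le> norm v * norm c"
      by (simp add: norm_scaleC mult.commute)
  qed (rule scaleC_add_right)
  ultimately show "bounded_linear (\<lambda>v. c *\<^sub>C t v)"
    by (rule bounded_linear_compose[rotated])
qed

definition is_adjoint ::
    "('h::complex_hilbert \<Rightarrow>\<^sub>L 'h) \<Rightarrow> ('h \<Rightarrow>\<^sub>L 'h) \<Rightarrow> bool" where
  "is_adjoint t s \<longleftrightarrow>
     (\<forall>v w. cinner (blinfun_apply t v) w = cinner v (blinfun_apply s w))"

definition is_projection :: "('h::complex_hilbert \<Rightarrow>\<^sub>L 'h) \<Rightarrow> bool" where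
  "is_projection p \<longleftrightarrow> p \<in> bounded_operators \<and> p o\<^sub>L p = p \<and> is_adjoint p p"

definition infinite_rank :: "('h::complex_hilbert \<Rightarrow>\<^sub>L 'h) \<Rightarrow> bool" where
  "infinite_rank t \<longleftrightarrow>
     \<not> (\<exists>B. finite B \<and> range (blinfun_apply t) \<subseteq> complex_vector.span B)"

text \<open>
  Preservation of adjoints is stated for pairs: whenever \<open>s\<close> is the adjoint of
  \<open>t\<close>, \<open>\<phi> s\<close> is the adjoint of \<open>\<phi> t\<close>.
\<close>

definition star_homomorphism ::
    "('h::complex_hilbert \<Rightarrow>\<^sub>L 'h) set \<Rightarrow> ('k::complex_hilbert \<Rightarrow>\<^sub>L 'k) set \<Rightarrow>
     (('h \<Rightarrow>\<^sub>L 'h) \<Rightarrow> ('k \<Rightarrow>\<^sub>L 'k)) \<Rightarrow> bool" where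
  "star_homomorphism S T \<phi> \<longleftrightarrow>
     (\<forall>t\<in>S. \<phi> t \<in> T) \<and>
     (\<forall>s\<in>S. \<forall>t\<in>S. \<phi> (s + t) = \<phi> s + \<phi> t) \<and>
     (\<forall>c. \<forall>t\<in>S. \<phi> (scaleC_operator c t) = scaleC_operator c (\<phi> t)) \<and>
     (\<forall>s\<in>S. \<forall>t\<in>S. \<phi> (s o\<^sub>L t) = \<phi> s o\<^sub>L \<phi> t) \<and>
     (\<forall>s\<in>S. \<forall>t\<in>S. is_adjoint t s \<longrightarrow> is_adjoint (\<phi> t) (\<phi> s))"

definition strongly_continuous ::
    "('h::complex_hilbert \<Rightarrow>\<^sub>L 'h) set \<Rightarrow> ('k::complex_hilbert \<Rightarrow>\<^sub>L 'k) set \<Rightarrow>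
     (('h \<Rightarrow>\<^sub>L 'h) \<Rightarrow> ('k \<Rightarrow>\<^sub>L 'k)) \<Rightarrow> bool" where
  "strongly_continuous S T \<phi> \<longleftrightarrow>
     continuous_map (subtopology strong_operator_topology S)
                    (subtopology strong_operator_topology T) \<phi>"


section \<open>Extended metric spaces\<close>

locale extended_metric_space =
  fixes X :: "'x set" and d :: "'x \<Rightarrow> 'x \<Rightarrow> ennreal"
  assumes edist_zero: "\<lbrakk>x \<in> X; y \<in> X\<rbrakk> \<Longrightarrow> d x y = 0 \<longleftrightarrow> x = y"
    and edist_commute: "\<lbrakk>x \<in> X; y \<in> X\<rbrakk> \<Longrightarrow> d x y = d y x"
    and edist_triangle: "\<lbrakk>x \<in> X; y \<in> X; z \<in> X\<rbrakk> \<Longrightarrow> d x z \<le> d x y + d y z"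

definition emetric_topology :: "'x set \<Rightarrow> ('x \<Rightarrow> 'x \<Rightarrow> ennreal) \<Rightarrow> 'x topology" where
  "emetric_topology X d =
     topology (\<lambda>U. U \<subseteq> X \<and> (\<forall>x\<in>U. \<exists>\<epsilon>>0. {y\<in>X. d x y < \<epsilon>} \<subseteq> U))"

lemma openin_emetric_topology:
  "openin (emetric_topology X d) U \<longleftrightarrow>
     U \<subseteq> X \<and> (\<forall>x\<in>U. \<exists>\<epsilon>>0. {y\<in>X. d x y < \<epsilon>} \<subseteq> U)"
proof -
  let ?P = "\<lambda>U. U \<subseteq> X \<and> (\<forall>x\<in>U. \<exists>\<epsilon>>0. {y\<in>X. d x y < \<epsilon>} \<subseteq> U)"
  have "?P (S \<inter> T)" if "?P S" "?P T" for S T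
  proof (intro conjI ballI)
    show "S \<inter> T \<subseteq> X" using that by blast
    fix x assume "x \<in> S \<inter> T"
    then obtain e e' where "e > 0" "{y\<in>X. d x y < e} \<subseteq> S" "e' > 0" "{y\<in>X. d x y < e'} \<subseteq> T"
      using \<open>?P S\<close> \<open>?P T\<close> by (meson IntD1 IntD2)
    then have "min e e' > 0 \<and> {y\<in>X. d x y < min e e'} \<subseteq> S \<inter> T" by auto
    then show "\<exists>\<epsilon>>0. {y\<in>X. d x y < \<epsilon>} \<subseteq> S \<inter> T" by blast
  qed
  moreover have "?P (\<Union>K)" if K: "\<forall>S\<in>K. ?P S" for K
  proof (intro conjI ballI)
    show "\<Union>K \<subseteq> X" using K by blast
    fix x assume "x \<in> \<Union>K"
    then obtain S where S: "S \<in> K" "x \<in> S" by blast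
    with K obtain e where "e > 0" "{y\<in>X. d x y < e} \<subseteq> S" by blast
    with S show "\<exists>\<epsilon>>0. {y\<in>X. d x y < \<epsilon>} \<subseteq> \<Union>K" by blast
  qed
  ultimately have "istopology ?P"
    unfolding istopology_def by blast
  then show ?thesis
    by (simp add: emetric_topology_def topology_inverse')
qed

locale proper_extended_metric_space = extended_metric_space +
  assumes compact_closed_balls:
    "x \<in> X \<Longrightarrow> compactin (emetric_topology X d) {y\<in>X. d x y \<le> ennreal r}"

definition diameter_le :: "('x \<Rightarrow> 'x \<Rightarrow> ennreal) \<Rightarrow> 'x set \<Rightarrow> real \<Rightarrow> bool" where
  "diameter_le d A r \<longleftrightarrow> (\<forall>a\<in>A. \<forall>a'\<in>A. d a a' \<le> ennreal r)"

definition coarsely_dense :: "'x set \<Rightarrow> ('x \<Rightarrow> 'x \<Rightarrow> ennreal) \<Rightarrow> 'x set \<Rightarrow> bool" where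
  "coarsely_dense X d D \<longleftrightarrow>
     D \<subseteq> X \<and> (\<exists>R\<ge>0. \<forall>x\<in>X. \<exists>y\<in>D. d x y \<le> ennreal R)"


section \<open>Modules and operators of controlled propagation\<close>

text \<open>
  \<open>\<AA>\<close> is the Boolean algebra of measurable sets and \<open>E A\<close> is the
  projection written \<open>1\<close> with index \<open>A\<close>. Only the values of \<open>E\<close>
  on \<open>\<AA>\<close> are relevant.
\<close>

locale geometric_module = extended_metric_space X d + algebra X \<AA>
  for X :: "'x set" and d :: "'x \<Rightarrow> 'x \<Rightarrow> ennreal" and \<AA> :: "'x set set" +
  fixes E :: "'x set \<Rightarrow> ('h::complex_hilbert \<Rightarrow>\<^sub>L 'h)"
  assumes E_projection: "A \<in> \<AA> \<Longrightarrow> is_projection (E A)"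
    and E_Int: "\<lbrakk>A \<in> \<AA>; A' \<in> \<AA>\<rbrakk> \<Longrightarrow> E (A \<inter> A') = E A o\<^sub>L E A'"
    and E_disjoint_Un:
      "\<lbrakk>A \<in> \<AA>; A' \<in> \<AA>; A \<inter> A' = {}\<rbrakk> \<Longrightarrow> E (A \<union> A') = E A + E A'"
    and E_space: "E X = id_blinfun"
    and E_dense: "\<exists>r\<ge>0. closure (complex_vector.span
        (\<Union>A\<in>{A\<in>\<AA>. diameter_le d A r}. range (blinfun_apply (E A)))) = UNIV"

definition discrete_module ::
    "'x set \<Rightarrow> ('x \<Rightarrow> 'x \<Rightarrow> ennreal) \<Rightarrow> 'x set set \<Rightarrow>
     ('x set \<Rightarrow> ('h::complex_hilbert \<Rightarrow>\<^sub>L 'h)) \<Rightarrow> bool" where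
  "discrete_module X d \<AA> E \<longleftrightarrow>
     (\<exists>r\<ge>0. \<exists>P. partition_on X P \<and> (\<forall>A\<in>P. A \<in> \<AA> \<and> diameter_le d A r) \<and>
        (\<forall>v. ((\<lambda>A. blinfun_apply (E A) v) has_sum v) P) \<and>
        (\<forall>C\<subseteq>X. (\<forall>A\<in>P. C \<inter> A \<in> \<AA>) \<longrightarrow> C \<in> \<AA>))"

definition ample_module ::
    "'x set \<Rightarrow> ('x \<Rightarrow> 'x \<Rightarrow> ennreal) \<Rightarrow> 'x set set \<Rightarrow>
     ('x set \<Rightarrow> ('h::complex_hilbert \<Rightarrow>\<^sub>L 'h)) \<Rightarrow> bool" where
  "ample_module X d \<AA> E \<longleftrightarrow>
     (\<exists>r\<ge>0. coarsely_dense X d (\<Union>{A\<in>\<AA>. diameter_le d A r \<and> infinite_rank (E A)}))"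

definition propagation_le ::
    "('x \<Rightarrow> 'x \<Rightarrow> ennreal) \<Rightarrow> 'x set set \<Rightarrow>
     ('x set \<Rightarrow> ('h::complex_hilbert \<Rightarrow>\<^sub>L 'h)) \<Rightarrow> ('h \<Rightarrow>\<^sub>L 'h) \<Rightarrow> real \<Rightarrow> bool" where
  "propagation_le d \<AA> E t r \<longleftrightarrow>
     (\<forall>A\<in>\<AA>. \<forall>A'\<in>\<AA>. (\<forall>a\<in>A. \<forall>a'\<in>A'. d a' a > ennreal r) \<longrightarrow> E A' o\<^sub>L t o\<^sub>L E A = 0)"

definition Cstar_cp ::
    "('x \<Rightarrow> 'x \<Rightarrow> ennreal) \<Rightarrow> 'x set set \<Rightarrow>
     ('x set \<Rightarrow> ('h::complex_hilbert \<Rightarrow>\<^sub>L 'h)) \<Rightarrow> ('h \<Rightarrow>\<^sub>L 'h) set" where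
  "Cstar_cp d \<AA> E = closure {t \<in> bounded_operators. \<exists>r\<ge>0. propagation_le d \<AA> E t r}"

definition approximately_controlled ::
    "('x \<Rightarrow> 'x \<Rightarrow> ennreal) \<Rightarrow> 'x set set \<Rightarrow> ('x set \<Rightarrow> ('h::complex_hilbert \<Rightarrow>\<^sub>L 'h)) \<Rightarrow>
     ('y \<Rightarrow> 'y \<Rightarrow> ennreal) \<Rightarrow> 'y set set \<Rightarrow> ('y set \<Rightarrow> ('k::complex_hilbert \<Rightarrow>\<^sub>L 'k)) \<Rightarrow>
     (('h \<Rightarrow>\<^sub>L 'h) \<Rightarrow> ('k \<Rightarrow>\<^sub>L 'k)) \<Rightarrow> bool" where
  "approximately_controlled dX \<AA> E dY \<BB> F \<phi> \<longleftrightarrow>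
     (\<forall>r\<ge>0. \<forall>\<epsilon>>0. \<exists>R\<ge>0. \<forall>t\<in>Cstar_cp dX \<AA> E. propagation_le dX \<AA> E t r \<longrightarrow>
        (\<exists>s\<in>bounded_operators. propagation_le dY \<BB> F s R \<and> norm (\<phi> t - s) \<le> \<epsilon> * norm t))"

end

theory Submission
  imports Defs
begin

text \<open>
  Controlled contractions are split into a part living on finitely many bounded pieces of \<open>X\<close>
  and a part far out. If the images of the far-out parts were not uniformly approximable, one would
  find controlled operators \<open>t\<^sub>n\<close> with orthogonal supports and orthogonal ranges such that
  \<open>\<phi> t\<^sub>n\<close> is \<open>\<epsilon>\<close>-far from propagation \<open>n\<close>. All subseries of \<open>\<Sum>\<^sub>n t\<^sub>n\<close> converge strongly in
  \<open>C\<^sup>*\<^sub>c\<^sub>p(X)\<close>, and since being \<open>\<epsilon>\<close>-close to propagation \<open>R\<close> is preserved by bounded strong limits, a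
  gliding hump produces a subseries whose image is not in \<open>C\<^sup>*\<^sub>c\<^sub>p(Y)\<close>. On a bounded piece \<open>A\<close> the
  same argument, with finite-rank projections in place of projections to bounded sets, leaves only
  operators of the form \<open>g t\<close> or \<open>t f\<close> with \<open>f, g\<close> of finite rank. Ampleness makes the range of
  \<open>1\<^sub>A\<close> infinite-dimensional after enlarging \<open>A\<close>; then a partial isometry of bounded support
  moves \<open>f\<close> and \<open>g\<close> off themselves, which reduces these operators to the part already treated.
\<close>

section \<open>Complex Hilbert spaces\<close>

text \<open>A single \<open>\<phi> t\<close> is approximable by the very definition of the target
  algebra; only uniformity in \<open>t\<close> is at stake. The gliding hump trades failure of
  uniformity for failure at one operator, so that operator must lie in the domain of
  \<open>\<phi>\<close>. This is why the corner argument is run in classes whose strongly convergent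
  series stay of finite propagation: operators of propagation at most \<open>r\<close>, and
  operators supported on one bounded set. The second class needs its own round because cutting by
  projections to bounded sets does nothing inside a bounded set. There the leftovers
  \<open>q t\<close> and \<open>t p\<close>, with \<open>p\<close> and \<open>q\<close> of finite
  rank, still range over infinite-dimensional families, so a finite net of operators does not help.
  Instead \<open>q t = y (1 - q) x t\<close> with \<open>y x = q\<close> and \<open>y q = 0\<close>:
  the factor \<open>y\<close> is one fixed operator, and \<open>(1 - q) x t\<close> is already cut
  on the left. A mirror factorisation treats \<open>t p\<close>. Such \<open>x\<close> with
  \<open>q x = 0\<close> needs room orthogonal to the range of \<open>q\<close>, which infinite rank
  provides.\<close>

lemma cinner_scaleC_right: "cinner x (c *\<^sub>C y) = cnj c * cinner (x::'a::complex_hilbert) y"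
  by (metis cinner_commute cinner_scaleC_left complex_cnj_mult)

lemma cinner_add_right: "cinner x (y + z) = cinner x y + cinner x (z::'a::complex_hilbert)"
  by (metis cinner_add_left cinner_commute complex_cnj_add)

lemma cinner_zero_left: "cinner 0 (y::'a::complex_hilbert) = 0"
  using cinner_scaleC_left[of 0 0 y] scaleC_of_real[of 0 "0::'a"] by simp

lemma cinner_cauchy_schwarz: "norm (cinner x y) \<le> norm x * norm (y::'a::complex_hilbert)"
proof (cases "y = 0")
  case True
  then show ?thesis
    using cinner_commute[of x y] cinner_zero_left[of x] by simp
next
  case False
  define c where "c = cinner x y / of_real ((norm y)\<^sup>2)"
  have ny: "norm y > 0" using False by simp
  have m: "x - c *\<^sub>C y = x + (-c) *\<^sub>C y"
    by (simp add: complex_vector.scale_minus_left)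
  have "cinner (x - c *\<^sub>C y) (x - c *\<^sub>C y) =
      cinner x x - cnj c * cinner x y - c * cnj (cinner x y) + c * cnj c * cinner y y"
    unfolding m
    unfolding cinner_add_left cinner_add_right cinner_scaleC_left cinner_scaleC_right
      cinner_commute[of y x] by (simp add: algebra_simps)
  also have "\<dots> = of_real ((norm x)\<^sup>2 - (norm (cinner x y))\<^sup>2 / (norm y)\<^sup>2)"
  proof -
    have "cnj c * cinner x y = of_real ((norm (cinner x y))\<^sup>2 / (norm y)\<^sup>2)"
      and "c * cnj (cinner x y) = of_real ((norm (cinner x y))\<^sup>2 / (norm y)\<^sup>2)"
      and "c * cnj c * cinner y y = of_real ((norm (cinner x y))\<^sup>2 / (norm y)\<^sup>2)"
      using ny complex_norm_square[of "cinner x y"]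
      by (simp_all add: c_def cinner_self power2_eq_square mult.commute)
    then show ?thesis by (simp only: cinner_self) simp
  qed
  finally have "(norm (x - c *\<^sub>C y))\<^sup>2 = (norm x)\<^sup>2 - (norm (cinner x y))\<^sup>2 / (norm y)\<^sup>2"
    by (metis cinner_self of_real_eq_iff)
  then have "(norm (cinner x y))\<^sup>2 / (norm y)\<^sup>2 \<le> (norm x)\<^sup>2"
    by (metis diff_ge_0_iff_ge zero_le_power2)
  then have "(norm (cinner x y))\<^sup>2 \<le> (norm x * norm y)\<^sup>2"
    using ny by (simp add: divide_le_eq power_mult_distrib)
  then show ?thesis by (rule power2_le_imp_le) simp
qed

lemma bounded_bilinear_cinner:
  "bounded_bilinear (cinner :: 'a::complex_hilbert \<Rightarrow> 'a \<Rightarrow> complex)"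
proof
  fix a b c :: 'a and r :: real
  show "cinner (a + b) c = cinner a c + cinner b c" by (rule cinner_add_left)
  show "cinner a (b + c) = cinner a b + cinner a c"
    by (rule cinner_add_right)
  show "cinner (r *\<^sub>R a) b = r *\<^sub>R cinner a b"
    by (metis cinner_scaleC_left scaleC_of_real scaleR_conv_of_real)
  show "cinner a (r *\<^sub>R b) = r *\<^sub>R cinner a b"
    by (metis cinner_scaleC_right scaleC_of_real scaleR_conv_of_real complex_cnj_complex_of_real)
  show "\<exists>K. \<forall>a b. norm (cinner a (b::'a)) \<le> norm a * norm b * K"
    by (intro exI[of _ 1]) (simp add: cinner_cauchy_schwarz)
qed

interpretation cinner: bounded_bilinear "cinner :: 'a::complex_hilbert \<Rightarrow> 'a \<Rightarrow> complex"
  by (rule bounded_bilinear_cinner)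

lemma Re_cinner_self: "Re (cinner x (x::'a::complex_hilbert)) = (norm x)\<^sup>2"
  by (simp add: cinner_self)

lemma Re_cinner_commute: "Re (cinner x (y::'a::complex_hilbert)) = Re (cinner y x)"
  using cinner_commute[of x y] by simp

lemma norm_add_square:
  "(norm (x + y))\<^sup>2 = (norm x)\<^sup>2 + (norm (y::'a::complex_hilbert))\<^sup>2 + 2 * Re (cinner x y)"
  using Re_cinner_commute[of y x]
  by (simp add: Re_cinner_self[symmetric] cinner.add_left cinner.add_right)

lemma norm_add_square_orthogonal:
  "cinner x y = 0 \<Longrightarrow> (norm (x + y))\<^sup>2 = (norm x)\<^sup>2 + (norm (y::'a::complex_hilbert))\<^sup>2"
  by (simp add: norm_add_square)

lemma norm_sum_square_orthogonal:
  fixes f :: "'i \<Rightarrow> 'a::complex_hilbert"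
  assumes "finite I" and "\<And>i j. \<lbrakk>i \<in> I; j \<in> I; i \<noteq> j\<rbrakk> \<Longrightarrow> cinner (f i) (f j) = 0"
  shows "(norm (\<Sum>i\<in>I. f i))\<^sup>2 = (\<Sum>i\<in>I. (norm (f i))\<^sup>2)"
  using assms
proof (induction rule: finite_induct)
  case (insert i I)
  have "cinner (f i) (\<Sum>j\<in>I. f j) = 0"
    using insert by (auto simp: cinner.sum_right intro!: sum.neutral)
  then show ?case using insert by (simp add: norm_add_square_orthogonal)
qed simp

lemma parallelogram_law:
  "(norm (x - y))\<^sup>2 + (norm (x + y))\<^sup>2 = 2 * (norm x)\<^sup>2 + 2 * (norm (y::'a::complex_hilbert))\<^sup>2"
  using norm_add_square[of x y] norm_add_square[of x "-y"]
  by (simp add: cinner.minus_right)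

text \<open>First-order condition at a minimum, without derivatives: for small \<open>s\<close> of
  the right sign a nonzero linear term beats the quadratic one.\<close>

lemma linear_dominated_by_square:
  fixes a b :: real
  assumes "\<And>s. 0 \<le> s\<^sup>2 * a + 2 * s * b"
  shows "b = 0"
proof (rule ccontr)
  assume b: "b \<noteq> 0"
  \<comment> \<open>\<open>k\<close> exceeds both \<open>0\<close> and \<open>a\<close>, so
    \<open>s = - b / k\<close> makes sense whatever the sign of \<open>a\<close>.\<close>
  define k where "k = \<bar>a\<bar> + 1"
  have k: "k > 0" "a < k" by (auto simp: k_def)
  define s where "s = - b / k"
  have "s\<^sup>2 * a < s\<^sup>2 * k" using b k by (simp add: s_def)
  also have "s\<^sup>2 * k = b\<^sup>2 / k" using k by (simp add: s_def power2_eq_square)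
  finally have "s\<^sup>2 * a + 2 * s * b < - (b\<^sup>2 / k)" by (simp add: s_def power2_eq_square)
  moreover have "b\<^sup>2 / k \<ge> 0" using k by simp
  ultimately have "s\<^sup>2 * a + 2 * s * b < 0" by linarith
  then show False using assms[of s] by simp
qed

text \<open>The representing vector minimises \<open>\<parallel>x\<parallel>\<^sup>2 - 2 Re (f x)\<close>.\<close>

theorem riesz_representation:
  fixes f :: "'a::complex_hilbert \<Rightarrow> complex"
  assumes add: "\<And>x y. f (x + y) = f x + f y"
    and scale: "\<And>c x. f (c *\<^sub>C x) = c * f x"
    and bound: "\<And>x. norm (f x) \<le> M * norm x"
  shows "\<exists>w. \<forall>x. f x = cinner x w"
proof -
  have sR: "f (r *\<^sub>R x) = of_real r * f x" for r x
    by (metis scale scaleC_of_real)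
  have bl: "bounded_linear f"
    using add sR bound by (intro bounded_linear_intro[of f M]) (auto simp: scaleR_conv_of_real mult.commute)
  define g where "g x = (norm x)\<^sup>2 - 2 * Re (f x)" for x
  have lower: "- M\<^sup>2 \<le> g x" for x
  proof -
    have "Re (f x) \<le> M * norm x" using bound[of x] complex_Re_le_cmod order_trans by blast
    moreover have "0 \<le> (norm x - M)\<^sup>2" by simp
    ultimately show ?thesis by (simp add: g_def power2_diff algebra_simps)
  qed
  define m where "m = Inf (range g)"
  have bdd: "bdd_below (range g)" using lower by (intro bdd_belowI2)
  have m_le: "m \<le> g x" for x unfolding m_def by (rule cInf_lower[OF _ bdd]) simp
  have "\<exists>x. g x < m + 1 / real (Suc n)" for n
    using cInf_lessD[of "range g" "m + 1 / real (Suc n)"] by (auto simp: m_def)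
  then obtain X where X: "\<And>n. g (X n) < m + 1 / real (Suc n)" by metis
  \<comment> \<open>Parallelogram law at the midpoint, where \<open>g\<close> is still at least
    \<open>m\<close>: two near-minimisers are near each other, so every minimising sequence is
    Cauchy.\<close>
  have close: "(norm (x - y))\<^sup>2 \<le> 2 * (g x + g y) - 4 * m" for x y
  proof -
    have "m \<le> g ((1/2) *\<^sub>R (x + y))" by (rule m_le)
    also have "\<dots> = (norm (x + y))\<^sup>2 / 4 - Re (f x) - Re (f y)"
    proof -
      have "norm ((1/2) *\<^sub>R (x + y)) = norm (x + y) / 2" by simp
      then show ?thesis by (simp only: g_def sR add) (simp add: power_divide field_simps)
    qed
    finally have "4 * m \<le> (norm (x + y))\<^sup>2 - 4 * Re (f x) - 4 * Re (f y)" by simp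
    then show ?thesis
      using parallelogram_law[of x y] by (simp add: g_def)
  qed
  have "Cauchy X"
  proof (rule metric_CauchyI)
    fix e :: real assume e: "e > 0"
    obtain N where N: "4 / real (Suc N) < e\<^sup>2"
    proof -
      obtain N where "inverse (real (Suc N)) < e\<^sup>2 / 4"
        using reals_Archimedean[of "e\<^sup>2/4"] e by auto
      then show ?thesis using that[of N] by (simp add: inverse_eq_divide field_simps)
    qed
    have "dist (X i) (X j) < e" if "i \<ge> N" "j \<ge> N" for i j
    proof -
      have "1 / real (Suc i) \<le> 1 / real (Suc N)" "1 / real (Suc j) \<le> 1 / real (Suc N)"
        using that by (simp_all add: frac_le)
      moreover have "4 / real (Suc N) = 4 * (1 / real (Suc N))" by simp
      ultimately have "(norm (X i - X j))\<^sup>2 < e\<^sup>2"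
        using close[of "X i" "X j"] X[of i] X[of j] N by argo
      then show ?thesis
        using e by (simp add: dist_norm power2_less_imp_less)
    qed
    then show "\<exists>N. \<forall>i\<ge>N. \<forall>j\<ge>N. dist (X i) (X j) < e" by blast
  qed
  then obtain w where w: "X \<longlonglongrightarrow> w"
    by (auto simp: Cauchy_convergent_iff convergent_def)
  have "(\<lambda>n. g (X n)) \<longlonglongrightarrow> g w"
    unfolding g_def by (intro tendsto_intros w bounded_linear.tendsto[OF bl])
  moreover have "(\<lambda>n. m + 1 / real (Suc n)) \<longlonglongrightarrow> m + 0"
    by (intro tendsto_add tendsto_const LIMSEQ_Suc lim_1_over_n)
  ultimately have "g w \<le> m"
    using LIMSEQ_le[of "\<lambda>n. g (X n)" "g w" "\<lambda>n. m + 1 / real (Suc n)" "m + 0"] X less_imp_le by auto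
  then have min: "g w \<le> g x" for x using m_le[of x] by simp
  \<comment> \<open>First variation of \<open>g\<close> at the minimiser \<open>w\<close> in
    direction \<open>v\<close>.\<close>
  have Re_eq: "Re (f v) = Re (cinner v w)" for v
  proof -
    have "0 \<le> s\<^sup>2 * (norm v)\<^sup>2 + 2 * s * (Re (cinner v w) - Re (f v))" for s
      using min[of "w + s *\<^sub>R v"] Re_cinner_commute[of w v]
      by (simp add: g_def norm_add_square add sR cinner.scaleR_right power_mult_distrib algebra_simps)
    then show ?thesis using linear_dominated_by_square by fastforce
  qed
  \<comment> \<open>The identity of real parts at \<open>\<i> *\<^sub>C v\<close> is the identity of
    imaginary parts at \<open>v\<close>.\<close>
  have "f v = cinner v w" for v
    using Re_eq[of v] Re_eq[of "\<i> *\<^sub>C v"]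
    by (simp add: complex_eq_iff scale cinner_scaleC_left)
  then show ?thesis by blast
qed

lemma cinner_eqI: "(\<And>w. cinner x w = cinner y w) \<Longrightarrow> x = (y::'a::complex_hilbert)"
proof -
  assume "\<And>w. cinner x w = cinner y w"
  then have "cinner (x - y) (x - y) = 0" by (simp add: cinner.diff_left)
  then show "x = y" by (simp add: cinner_self)
qed

text \<open>For fixed \<open>v\<close> the conjugate of \<open>B v\<close> is linear, so Riesz
  represents it by a vector \<open>S v\<close>; uniqueness of that vector makes \<open>S\<close>
  linear. This turns limits of matrix coefficients back into operators.\<close>

lemma bounded_sesquilinear_form_operator:
  fixes B :: "'a::complex_hilbert \<Rightarrow> 'a \<Rightarrow> complex"
  assumes add1: "\<And>x y z. B (x + y) z = B x z + B y z"
    and add2: "\<And>x y z. B z (x + y) = B z x + B z y"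
    and scale1: "\<And>c x y. B (c *\<^sub>C x) y = c * B x y"
    and scale2: "\<And>c x y. B x (c *\<^sub>C y) = cnj c * B x y"
    and bound: "\<And>x y. norm (B x y) \<le> M * norm x * norm y"
  shows "\<exists>s\<in>bounded_operators. \<forall>v w. cinner (blinfun_apply s v) w = B v w"
proof -
  have "\<exists>u. \<forall>w. cnj (B v w) = cinner w u" for v
    by (rule riesz_representation[where M = "M * norm v"])
       (simp_all add: add2 scale2 bound)
  then obtain S where S: "\<And>v w. cnj (B v w) = cinner w (S v)" by metis
  have S': "cinner (S v) w = B v w" for v w
    by (metis S cinner_commute complex_cnj_cnj)
  have Sadd: "S (x + y) = S x + S y" for x y
    by (rule cinner_eqI) (simp add: S' add1 cinner.add_left)
  have Sscale: "S (c *\<^sub>C x) = c *\<^sub>C S x" for c x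
    by (rule cinner_eqI) (simp add: S' scale1 cinner_scaleC_left)
  \<comment> \<open>No sign is assumed for \<open>M\<close>, so the case \<open>S x = 0\<close> has
    content: it asks for \<open>norm x * M\<close> to be nonnegative, which follows from
    \<open>bound\<close>.\<close>
  have Sbound: "norm (S x) \<le> norm x * M" for x
  proof (cases "norm (S x) = 0")
    case True
    then show ?thesis
      using bound[of x x] order_trans[OF norm_ge_zero] zero_le_mult_iff[of "M * norm x" "norm x"]
      by (metis mult.commute mult_zero_left norm_ge_zero order.refl order_antisym_conv linorder_linear zero_le_mult_iff)
  next
    case False
    have "(norm (S x))\<^sup>2 = norm (B x (S x))" by (simp add: S'[symmetric] cinner_self norm_power)
    also have "\<dots> \<le> M * norm x * norm (S x)" by (rule bound)
    finally show ?thesis using False by (simp add: power2_eq_square mult_ac)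
  qed
  have "bounded_linear S"
  proof (rule bounded_linear_intro[OF Sadd _ Sbound])
    show "S (r *\<^sub>R x) = r *\<^sub>R S x" for r x
      by (metis Sscale scaleC_of_real)
  qed
  then have "blinfun_apply (Blinfun S) = S" by (simp add: bounded_linear_Blinfun_apply)
  then show ?thesis
    using S' Sscale by (intro bexI[of _ "Blinfun S"]) (auto simp: bounded_operators_def)
qed


section \<open>Bounded operators and projections\<close>

lemma bounded_operatorsD: "t \<in> bounded_operators \<Longrightarrow> blinfun_apply t (c *\<^sub>C v) = c *\<^sub>C blinfun_apply t v"
  by (simp add: bounded_operators_def)

lemma bounded_operators_zero: "0 \<in> bounded_operators"
  by (simp add: bounded_operators_def)

lemma bounded_operators_id: "id_blinfun \<in> bounded_operators"
  by (simp add: bounded_operators_def)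

lemma bounded_operators_add: "\<lbrakk>s \<in> bounded_operators; t \<in> bounded_operators\<rbrakk> \<Longrightarrow> s + t \<in> bounded_operators"
  by (simp add: bounded_operators_def blinfun.add_left scaleC_add_right)

lemma bounded_operators_diff: "\<lbrakk>s \<in> bounded_operators; t \<in> bounded_operators\<rbrakk> \<Longrightarrow> s - t \<in> bounded_operators"
  by (simp add: bounded_operators_def blinfun.diff_left complex_vector.scale_right_diff_distrib)

lemma bounded_operators_scaleR: "t \<in> bounded_operators \<Longrightarrow> r *\<^sub>R t \<in> bounded_operators"
  by (simp add: bounded_operators_def blinfun.scaleR_left scaleC_of_real[symmetric] scaleC_scaleC mult.commute)

lemma bounded_operators_compose: "\<lbrakk>s \<in> bounded_operators; t \<in> bounded_operators\<rbrakk> \<Longrightarrow> s o\<^sub>L t \<in> bounded_operators"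
  by (simp add: bounded_operators_def)

lemma continuous_on_scaleC: "continuous_on UNIV (\<lambda>v. c *\<^sub>C (v::'a::complex_hilbert))"
proof -
  have "dist (c *\<^sub>C u) (c *\<^sub>C v) = norm c * dist u v" for u v :: 'a
    unfolding dist_norm complex_vector.scale_right_diff_distrib[symmetric] by (rule norm_scaleC)
  then have "(cmod c)-lipschitz_on UNIV (\<lambda>v::'a. c *\<^sub>C v)"
    by (intro lipschitz_onI) simp_all
  then show ?thesis by (rule lipschitz_on_continuous_on)
qed

text \<open>The type of operators records only real linearity, so complex linearity has to be
  carried through limits; it survives because scaling by \<open>c\<close> is continuous.\<close>

lemma bounded_operators_strong_limit:
  assumes "F \<noteq> bot" and "\<forall>\<^sub>F i in F. a i \<in> bounded_operators"
    and lim: "\<And>v. ((\<lambda>i. blinfun_apply (a i) v) \<longlongrightarrow> blinfun_apply t v) F"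
  shows "t \<in> bounded_operators"
  unfolding bounded_operators_def
proof (intro CollectI allI)
  fix c v
  have "((\<lambda>i. c *\<^sub>C blinfun_apply (a i) v) \<longlongrightarrow> c *\<^sub>C blinfun_apply t v) F"
    by (rule continuous_on_tendsto_compose[OF continuous_on_scaleC lim]) auto
  moreover have "((\<lambda>i. c *\<^sub>C blinfun_apply (a i) v) \<longlongrightarrow> blinfun_apply t (c *\<^sub>C v)) F"
    by (rule Lim_transform_eventually[OF lim]) (use assms(2) in \<open>eventually_elim, simp add: bounded_operatorsD\<close>)
  ultimately show "blinfun_apply t (c *\<^sub>C v) = c *\<^sub>C blinfun_apply t v"
    using tendsto_unique[OF assms(1)] by blast
qed

lemma is_projection_bounded: "is_projection p \<Longrightarrow> p \<in> bounded_operators"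
  by (simp add: is_projection_def)

lemma is_projection_idem: "is_projection p \<Longrightarrow> blinfun_apply p (blinfun_apply p v) = blinfun_apply p v"
  unfolding is_projection_def by (metis blinfun_apply_blinfun_compose)

lemma is_projection_cinner:
  "is_projection p \<Longrightarrow> cinner (blinfun_apply p v) w = cinner v (blinfun_apply p w)"
  by (simp add: is_projection_def is_adjoint_def)

lemma is_projectionI:
  assumes "p \<in> bounded_operators" "\<And>v. blinfun_apply p (blinfun_apply p v) = blinfun_apply p v"
    "\<And>v w. cinner (blinfun_apply p v) w = cinner v (blinfun_apply p w)"
  shows "is_projection p"
  using assms by (auto simp: is_projection_def is_adjoint_def intro!: blinfun_eqI)

lemma projection_norm_apply_square:
  assumes "is_projection p"
  shows "(norm (blinfun_apply p v))\<^sup>2 = Re (cinner v (blinfun_apply p v))"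
  using assms by (metis Re_cinner_self is_projection_cinner is_projection_idem)

lemma projection_norm_apply_le:
  assumes "is_projection p"
  shows "norm (blinfun_apply p v) \<le> norm v"
proof -
  have "(norm (blinfun_apply p v))\<^sup>2 \<le> norm v * norm (blinfun_apply p v)"
    unfolding projection_norm_apply_square[OF assms]
    using complex_Re_le_cmod cinner_cauchy_schwarz order_trans by blast
  then show ?thesis
    by (cases "norm (blinfun_apply p v) = 0") (auto simp: power2_eq_square)
qed

lemma projection_norm_le: "is_projection p \<Longrightarrow> norm p \<le> 1"
  by (rule norm_blinfun_bound) (auto simp: projection_norm_apply_le)

lemma projection_diff:
  assumes p: "is_projection p" and q: "is_projection q"
    and pq: "p o\<^sub>L q = p" and qp: "q o\<^sub>L p = p"
  shows "is_projection (q - p)"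
proof (rule is_projectionI)
  show "q - p \<in> bounded_operators"
    using p q by (intro bounded_operators_diff is_projection_bounded)
  have "blinfun_apply p (blinfun_apply q v) = blinfun_apply p v"
    "blinfun_apply q (blinfun_apply p v) = blinfun_apply p v" for v
    using pq qp by (metis blinfun_apply_blinfun_compose)+
  then show "blinfun_apply (q - p) (blinfun_apply (q - p) v) = blinfun_apply (q - p) v" for v
    using p q by (simp add: blinfun.diff_left blinfun.diff_right is_projection_idem)
  show "cinner (blinfun_apply (q - p) v) w = cinner v (blinfun_apply (q - p) w)" for v w
    using p q by (simp add: blinfun.diff_left cinner.diff_left cinner.diff_right is_projection_cinner)
qed

lemma projection_id: "is_projection id_blinfun"
  by (rule is_projectionI) (auto simp: bounded_operators_id)

lemma projection_compl: "is_projection p \<Longrightarrow> is_projection (id_blinfun - p)"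
  by (rule projection_diff) (auto simp: projection_id blinfun_eqI)

lemma norm_compose_le_one:
  "\<lbrakk>norm s \<le> 1; norm t \<le> 1\<rbrakk> \<Longrightarrow> norm (s o\<^sub>L t) \<le> 1"
  using norm_blinfun_compose[of s t] mult_mono[of "norm s" 1 "norm t" 1] by simp


section \<open>Modules\<close>

context geometric_module
begin

lemma E_bounded: "A \<in> \<AA> \<Longrightarrow> E A \<in> bounded_operators"
  by (simp add: E_projection is_projection_bounded)

lemma E_apply_Int:
  "\<lbrakk>A \<in> \<AA>; B \<in> \<AA>\<rbrakk> \<Longrightarrow> blinfun_apply (E A) (blinfun_apply (E B) v) = blinfun_apply (E (A \<inter> B)) v"
  by (simp add: E_Int)

lemma E_empty: "E {} = 0"
  using E_disjoint_Un[of "{}" "{}"] by simp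

lemma E_compl: "A \<in> \<AA> \<Longrightarrow> E (X - A) = id_blinfun - E A"
  using E_disjoint_Un[of A "X - A"] E_space sets_into_space[of A] compl_sets[of A] by (auto simp: Un_absorb1 algebra_simps)

lemma propagation_leD:
  assumes "propagation_le d \<AA> E t R" "A \<in> \<AA>" "A' \<in> \<AA>"
    "\<And>a a'. \<lbrakk>a \<in> A; a' \<in> A'\<rbrakk> \<Longrightarrow> ennreal R < d a' a"
  shows "blinfun_apply (E A') (blinfun_apply t (blinfun_apply (E A) v)) = 0"
proof -
  have "E A' o\<^sub>L t o\<^sub>L E A = 0" using assms unfolding propagation_le_def by blast
  then show ?thesis by (metis blinfun_apply_blinfun_compose zero_blinfun.rep_eq)
qed

lemma propagation_leI:
  assumes "\<And>A A' v. \<lbrakk>A \<in> \<AA>; A' \<in> \<AA>; \<And>a a'. \<lbrakk>a \<in> A; a' \<in> A'\<rbrakk> \<Longrightarrow> ennreal R < d a' a\<rbrakk>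
    \<Longrightarrow> blinfun_apply (E A') (blinfun_apply t (blinfun_apply (E A) v)) = 0"
  shows "propagation_le d \<AA> E t R"
  unfolding propagation_le_def using assms by (auto intro!: blinfun_eqI)

lemma propagation_le_mono:
  "\<lbrakk>propagation_le d \<AA> E t R; R \<le> R'\<rbrakk> \<Longrightarrow> propagation_le d \<AA> E t R'"
  unfolding propagation_le_def by (meson ennreal_leI order_le_less_trans)

lemma propagation_le_zero: "propagation_le d \<AA> E 0 R"
  by (rule propagation_leI) simp

lemma propagation_le_add:
  "\<lbrakk>propagation_le d \<AA> E s R; propagation_le d \<AA> E t R'\<rbrakk>
    \<Longrightarrow> propagation_le d \<AA> E (s + t) (max R R')"
  using propagation_leD[OF propagation_le_mono[OF _ max.cobounded1[of R R']], of s]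
    propagation_leD[OF propagation_le_mono[OF _ max.cobounded2[of R' R]], of t]
  by (intro propagation_leI) (simp add: blinfun.add_left blinfun.add_right)

lemma propagation_le_scaleR:
  "propagation_le d \<AA> E s R \<Longrightarrow> propagation_le d \<AA> E (c *\<^sub>R s) R"
  by (rule propagation_leI) (simp add: blinfun.scaleR_left blinfun.scaleR_right propagation_leD)

lemma propagation_le_diff:
  "\<lbrakk>propagation_le d \<AA> E s R; propagation_le d \<AA> E t R'\<rbrakk>
    \<Longrightarrow> propagation_le d \<AA> E (s - t) (max R R')"
  using propagation_le_add[of s R "-1 *\<^sub>R t" R'] propagation_le_scaleR[of t R' "-1"] by simp

lemma propagation_le_cut:
  assumes t: "propagation_le d \<AA> E t R" and C: "C \<in> \<AA>" "D \<in> \<AA>"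
  shows "propagation_le d \<AA> E (E C o\<^sub>L t o\<^sub>L E D) R"
proof (rule propagation_leI)
  fix A A' v assume A: "A \<in> \<AA>" "A' \<in> \<AA>" "\<And>a a'. \<lbrakk>a \<in> A; a' \<in> A'\<rbrakk> \<Longrightarrow> ennreal R < d a' a"
  have "blinfun_apply (E (A' \<inter> C)) (blinfun_apply t (blinfun_apply (E (D \<inter> A)) v)) = 0"
    by (rule propagation_leD[OF t]) (use A C in auto)
  then show "blinfun_apply (E A') (blinfun_apply (E C o\<^sub>L t o\<^sub>L E D) (blinfun_apply (E A) v)) = 0"
    using A C by (simp add: E_apply_Int)
qed

text \<open>A metric neighbourhood need not be measurable. The union of all cells of the partition
  that meet it is: it intersects each cell in the whole cell or not at all, and discreteness makes
  such sets measurable. The price is the cell diameter \<open>c\<close>, which depends on the module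
  alone.\<close>

lemma discrete_neighbourhoods:
  assumes "discrete_module X d \<AA> E"
  obtains c where "c \<ge> 0" and "\<And>A R. \<lbrakk>A \<subseteq> X; R \<ge> 0\<rbrakk> \<Longrightarrow>
    \<exists>N\<in>\<AA>. (\<forall>a\<in>A. \<forall>x\<in>X. d a x \<le> ennreal R \<longrightarrow> x \<in> N) \<and> (\<forall>x\<in>N. \<exists>a\<in>A. d a x \<le> ennreal (R + c))"
proof -
  obtain c P where c: "c \<ge> 0" and P: "partition_on X P" "\<And>A. A \<in> P \<Longrightarrow> A \<in> \<AA> \<and> diameter_le d A c"
    and meas: "\<And>C. \<lbrakk>C \<subseteq> X; \<forall>A\<in>P. C \<inter> A \<in> \<AA>\<rbrakk> \<Longrightarrow> C \<in> \<AA>"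
    using assms unfolding discrete_module_def by blast
  have X: "\<Union>P = X" and dj: "\<And>A B. \<lbrakk>A \<in> P; B \<in> P; A \<noteq> B\<rbrakk> \<Longrightarrow> A \<inter> B = {}"
    using P(1) by (auto simp: partition_on_def disjoint_def)
  have "\<exists>N\<in>\<AA>. (\<forall>a\<in>A. \<forall>x\<in>X. d a x \<le> ennreal R \<longrightarrow> x \<in> N) \<and> (\<forall>x\<in>N. \<exists>a\<in>A. d a x \<le> ennreal (R + c))"
    if A: "A \<subseteq> X" and R: "R \<ge> 0" for A R
  proof -
    define N where "N = \<Union>{B\<in>P. \<exists>x\<in>B. \<exists>a\<in>A. d a x \<le> ennreal R}"
    show ?thesis
    proof (intro bexI[of _ N] conjI ballI impI)
      show "N \<in> \<AA>"
      proof (rule meas)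
        show "N \<subseteq> X" using X by (auto simp: N_def)
        show "\<forall>B\<in>P. N \<inter> B \<in> \<AA>"
        proof
          fix B assume B: "B \<in> P"
          have "N \<inter> B = B \<or> N \<inter> B = {}" using dj[OF B] by (auto simp: N_def)
          then show "N \<inter> B \<in> \<AA>" using P(2)[OF B] by auto
        qed
      qed
    next
      fix a x assume "a \<in> A" "x \<in> X" "d a x \<le> ennreal R"
      then show "x \<in> N" using X unfolding N_def by blast
    next
      fix x assume "x \<in> N"
      then obtain B y a where B: "B \<in> P" "x \<in> B" "y \<in> B" "a \<in> A" "d a y \<le> ennreal R"
        by (auto simp: N_def)
      then have "d y x \<le> ennreal c" using P(2) by (auto simp: diameter_le_def)
      moreover have "d a x \<le> d a y + d y x" using B A X by (intro edist_triangle) auto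
      ultimately have "d a x \<le> ennreal R + ennreal c" using B(5) by (meson add_mono order_trans)
      then show "\<exists>a\<in>A. d a x \<le> ennreal (R + c)" using B(4) R c by auto
    qed
  qed
  then show ?thesis using that c by blast
qed

text \<open>All of \<open>X - N\<close> is farther than \<open>R\<close> from \<open>A\<close>, so
  the blocks of \<open>t\<close> between these two sets vanish in both directions.\<close>

lemma propagation_le_neighbourhood:
  assumes t: "propagation_le d \<AA> E t R" and A: "A \<in> \<AA>" and N: "N \<in> \<AA>"
    and AN: "\<forall>a\<in>A. \<forall>x\<in>X. d a x \<le> ennreal R \<longrightarrow> x \<in> N"
  shows "E N o\<^sub>L t o\<^sub>L E A = t o\<^sub>L E A" and "E A o\<^sub>L t o\<^sub>L E N = E A o\<^sub>L t"
proof -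
  have far: "d a x > ennreal R" "d x a > ennreal R" if "a \<in> A" "x \<in> X - N" for a x
    using AN that edist_commute[of a x] sets_into_space[OF A] by (auto simp: not_le[symmetric])
  show "E N o\<^sub>L t o\<^sub>L E A = t o\<^sub>L E A"
  proof (rule blinfun_eqI)
    fix v
    have "blinfun_apply (E (X - N)) (blinfun_apply t (blinfun_apply (E A) v)) = 0"
      by (rule propagation_leD[OF t A]) (use N far in auto)
    then show "blinfun_apply (E N o\<^sub>L t o\<^sub>L E A) v = blinfun_apply (t o\<^sub>L E A) v"
      using N by (simp add: E_compl blinfun.diff_left)
  qed
  show "E A o\<^sub>L t o\<^sub>L E N = E A o\<^sub>L t"
  proof (rule blinfun_eqI)
    fix v
    have "blinfun_apply (E A) (blinfun_apply t (blinfun_apply (E (X - N)) v)) = 0"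
      by (rule propagation_leD[OF t _ A]) (use N far in auto)
    then show "blinfun_apply (E A o\<^sub>L t o\<^sub>L E N) v = blinfun_apply (E A o\<^sub>L t) v"
      using N by (simp add: E_compl blinfun.diff_left blinfun.diff_right)
  qed
qed

text \<open>The operator \<open>t\<close> sends the range of \<open>E A\<close> into that of
  \<open>E N\<close> for a measurable neighbourhood \<open>N\<close> of \<open>A\<close>, and
  \<open>s\<close> is then applied on \<open>N\<close>. The constant \<open>c\<close> is the excess
  of such neighbourhoods, hence common to all operators.\<close>

lemma propagation_le_compose:
  assumes "discrete_module X d \<AA> E"
  obtains c where "c \<ge> 0" and "\<And>s t R R'. \<lbrakk>R \<ge> 0; R' \<ge> 0; propagation_le d \<AA> E s R; propagation_le d \<AA> E t R'\<rbrakk>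
    \<Longrightarrow> propagation_le d \<AA> E (s o\<^sub>L t) (R + R' + c)"
proof -
  obtain c where c: "c \<ge> 0" and nb: "\<And>A R. \<lbrakk>A \<subseteq> X; R \<ge> 0\<rbrakk> \<Longrightarrow>
    \<exists>N\<in>\<AA>. (\<forall>a\<in>A. \<forall>x\<in>X. d a x \<le> ennreal R \<longrightarrow> x \<in> N) \<and> (\<forall>x\<in>N. \<exists>a\<in>A. d a x \<le> ennreal (R + c))"
    using discrete_neighbourhoods[OF assms] by blast
  have "propagation_le d \<AA> E (s o\<^sub>L t) (R + R' + c)"
    if R: "R \<ge> 0" "R' \<ge> 0" and s: "propagation_le d \<AA> E s R" and t: "propagation_le d \<AA> E t R'" for s t R R'
  proof (rule propagation_leI)
    fix A A' v assume A: "A \<in> \<AA>" "A' \<in> \<AA>"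
      and far: "\<And>a a'. \<lbrakk>a \<in> A; a' \<in> A'\<rbrakk> \<Longrightarrow> ennreal (R + R' + c) < d a' a"
    obtain N where N: "N \<in> \<AA>" "\<forall>a\<in>A. \<forall>x\<in>X. d a x \<le> ennreal R' \<longrightarrow> x \<in> N"
      and N': "\<forall>x\<in>N. \<exists>a\<in>A. d a x \<le> ennreal (R' + c)"
      using nb[OF sets_into_space[OF A(1)] R(2)] by (elim bexE conjE)
    have "blinfun_apply (E A') (blinfun_apply s (blinfun_apply (E N) (blinfun_apply t (blinfun_apply (E A) v)))) = 0"
    proof (rule propagation_leD[OF s N(1) A(2)])
      fix x a' assume x: "x \<in> N" "a' \<in> A'"
      then obtain a where a: "a \<in> A" "d a x \<le> ennreal (R' + c)" using N' by blast
      have "ennreal (R + R' + c) < d a' a" using far a x by blast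
      also have "\<dots> \<le> d a' x + d x a"
        using a x A N by (intro edist_triangle) (auto dest: sets_into_space)
      also have "d x a = d a x" using a x A N by (intro edist_commute) (auto dest: sets_into_space)
      also have "d a' x + d a x \<le> d a' x + ennreal (R' + c)" using a by (simp add: add_left_mono)
      finally have "ennreal R + ennreal (R' + c) < d a' x + ennreal (R' + c)"
        using R c by (simp add: ennreal_plus[symmetric] add.assoc del: ennreal_plus)
      \<comment> \<open>Cancellation by contraposing monotonicity, so that \<open>d a' x\<close> may
        be infinite.\<close>
      then show "ennreal R < d a' x"
        by (meson add_right_mono leD leI)
    qed
    moreover have "blinfun_apply (E N) (blinfun_apply t (blinfun_apply (E A) v)) = blinfun_apply t (blinfun_apply (E A) v)"
      using propagation_le_neighbourhood(1)[OF t A(1) N] by (metis blinfun_apply_blinfun_compose)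
    ultimately show "blinfun_apply (E A') (blinfun_apply (s o\<^sub>L t) (blinfun_apply (E A) v)) = 0" by simp
  qed
  then show ?thesis using that c by blast
qed

end


section \<open>Strong limits and uniform boundedness\<close>

lemma limitin_strong_operator_topology:
  "limitin strong_operator_topology a t F \<longleftrightarrow> (\<forall>v. ((\<lambda>i. blinfun_apply (a i) v) \<longlongrightarrow> blinfun_apply t v) F)"
proof -
  have "limitin strong_operator_topology a t F \<longleftrightarrow>
      limitin euclidean (\<lambda>i. blinfun_apply (a i)) (blinfun_apply t) F"
    unfolding limitin_def strong_operator_topology_def openin_pullback_topology
    by (auto simp: topspace_pullback_topology)
  also have "\<dots> \<longleftrightarrow> (\<forall>v. ((\<lambda>i. blinfun_apply (a i) v) \<longlongrightarrow> blinfun_apply t v) F)"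
    unfolding euclidean_product_topology[symmetric] limitin_componentwise by simp
  finally show ?thesis .
qed

lemma strongly_continuous_limit:
  assumes "strongly_continuous S T \<phi>" and "\<forall>\<^sub>F i in F. a i \<in> S" and "t \<in> S"
    and "\<And>v. ((\<lambda>i. blinfun_apply (a i) v) \<longlongrightarrow> blinfun_apply t v) F"
  shows "((\<lambda>i. blinfun_apply (\<phi> (a i)) w) \<longlongrightarrow> blinfun_apply (\<phi> t) w) F"
proof -
  have "limitin (subtopology strong_operator_topology S) a t F"
    using assms by (simp add: limitin_subtopology limitin_strong_operator_topology)
  then have "limitin (subtopology strong_operator_topology T) (\<phi> \<circ> a) (\<phi> t) F"
    using assms(1) unfolding strongly_continuous_def by (rule continuous_map_limit[rotated])
  then show ?thesis
    by (simp add: limitin_subtopology limitin_strong_operator_topology)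
qed

text \<open>Baire category: if the open set where the family exceeds \<open>n\<close> misses a ball,
  linearity spreads the bound on that ball to the operator norms; otherwise all these sets are
  dense, and a common point contradicts pointwise boundedness.\<close>

theorem banach_steinhaus:
  fixes S :: "('a::banach \<Rightarrow>\<^sub>L 'b::real_normed_vector) set"
  assumes pointwise: "\<And>v. \<exists>C. \<forall>t\<in>S. norm (blinfun_apply t v) \<le> C"
  shows "\<exists>M. \<forall>t\<in>S. norm t \<le> M"
proof (rule ccontr)
  assume unbounded: "\<nexists>M. \<forall>t\<in>S. norm t \<le> M"
  define U where "U n = {v. \<exists>t\<in>S. norm (blinfun_apply t v) > real n}" for n :: nat
  have op: "open (U n)" for n
  proof -
    have "U n = (\<Union>t\<in>S. {v. norm (blinfun_apply t v) > real n})" by (auto simp: U_def)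
    moreover have "open {v. norm (blinfun_apply t v) > real n}" for t :: "'a \<Rightarrow>\<^sub>L 'b"
      by (intro open_Collect_less continuous_intros)
    ultimately show ?thesis by auto
  qed
  have dense: "closure (U n) = UNIV" for n
  proof (rule ccontr)
    assume "closure (U n) \<noteq> UNIV"
    then obtain v where "v \<in> - closure (U n)" by blast
    then obtain e where e: "e > 0" "ball v e \<subseteq> - closure (U n)"
      by (meson open_Compl closed_closure openE)
    have small: "norm (blinfun_apply t u) \<le> real n" if "t \<in> S" "u \<in> ball v e" for t u
      using e(2) that closure_subset[of "U n"] unfolding U_def by force
    \<comment> \<open>With \<open>r = e / (2 * norm u)\<close> both \<open>v\<close> and
      \<open>v + r *\<^sub>R u\<close> are in the ball, so
      \<open>r * norm (t u) \<le> 2 * n\<close>; this is where \<open>4 * n / e\<close> comes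
      from.\<close>
    have "norm t \<le> 4 * real n / e" if t: "t \<in> S" for t
    proof (rule norm_blinfun_bound)
      show "0 \<le> 4 * real n / e" using e by simp
      fix u
      show "norm (blinfun_apply t u) \<le> 4 * real n / e * norm u"
      proof (cases "u = 0")
        case False
        define r where "r = e / (2 * norm u)"
        have r: "r > 0" using e False by (simp add: r_def)
        have "norm (r *\<^sub>R u) < e" using e False by (simp add: r_def)
        then have "v + r *\<^sub>R u \<in> ball v e" by (simp add: dist_norm)
        then have "norm (blinfun_apply t (v + r *\<^sub>R u)) \<le> real n" "norm (blinfun_apply t v) \<le> real n"
          using small[OF t] e by auto
        then have "norm (blinfun_apply t (v + r *\<^sub>R u) - blinfun_apply t v) \<le> 2 * real n"
          by norm
        then have "r * norm (blinfun_apply t u) \<le> 2 * real n"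
          using r by (simp add: blinfun.add_right blinfun.scaleR_right)
        then show ?thesis using e False by (simp add: r_def field_simps)
      qed simp
    qed
    then show False using unbounded by blast
  qed
  have "euclidean closure_of \<Inter>(range U) = (UNIV :: 'a set)"
    by (rule Met_TC.metric_Baire_category[simplified mtopology_is_euclidean])
       (use op dense in \<open>auto simp: complete_UNIV\<close>)
  then obtain v where "v \<in> \<Inter>(range U)"
    by (metis UNIV_I closure_empty closure_of_eq euclidean_closure_of all_not_in_conv empty_iff)
  moreover obtain C where "\<And>t. t \<in> S \<Longrightarrow> norm (blinfun_apply t v) \<le> C" using pointwise by blast
  moreover obtain n where "C < real n" using reals_Archimedean2 by blast
  moreover obtain t where "t \<in> S" "norm (blinfun_apply t v) > real n"
    using calculation(1) unfolding U_def by blast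
  ultimately show False by force
qed


section \<open>Orthogonal series of operators\<close>

lemma bessel_projections:
  fixes p :: "'i \<Rightarrow> ('h::complex_hilbert \<Rightarrow>\<^sub>L 'h)"
  assumes proj: "\<And>i. is_projection (p i)" and orth: "\<And>i j. i \<noteq> j \<Longrightarrow> p i o\<^sub>L p j = 0"
    and I: "finite I"
  shows "(\<Sum>i\<in>I. (norm (p i v))\<^sup>2) \<le> (norm v)\<^sup>2"
proof -
  define w where "w = (\<Sum>i\<in>I. p i v)"
  have "cinner (p i v) (p j v) = 0" if "i \<noteq> j" for i j
    using orth[OF that] by (metis blinfun_apply_blinfun_compose cinner.zero_right is_projection_cinner[OF proj] zero_blinfun.rep_eq)
  then have sq: "(norm w)\<^sup>2 = (\<Sum>i\<in>I. (norm (p i v))\<^sup>2)"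
    unfolding w_def by (intro norm_sum_square_orthogonal I)
  also have "\<dots> = Re (cinner v w)"
    by (simp add: projection_norm_apply_square[OF proj] w_def cinner.sum_right)
  also have "\<dots> \<le> norm v * norm w"
    using complex_Re_le_cmod cinner_cauchy_schwarz order_trans by blast
  finally have "norm w \<le> norm v"
    by (cases "norm w = 0") (auto simp: power2_eq_square)
  then show ?thesis unfolding sq[symmetric] by (simp add: power_mono)
qed

text \<open>Orthogonal ranges make squared norms of partial sums additive; orthogonal supports bound
  the \<open>n\<close>-th term by \<open>norm (p n v)\<close>, and Bessel sums these squares. The
  dominating series does not involve \<open>S\<close>, so all subseries converge with uniform tails,
  which also gives the decay of \<open>T (U n)\<close> when \<open>U n\<close> moves to
  infinity.\<close>

lemma orthogonal_series_operators:
  fixes p q t :: "nat \<Rightarrow> ('h::complex_hilbert \<Rightarrow>\<^sub>L 'h)"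
  assumes p: "\<And>n. is_projection (p n)" "\<And>m n. m \<noteq> n \<Longrightarrow> p m o\<^sub>L p n = 0"
    and q: "\<And>n. is_projection (q n)" "\<And>m n. m \<noteq> n \<Longrightarrow> q m o\<^sub>L q n = 0"
    and t: "\<And>n. t n \<in> bounded_operators" "\<And>n. norm (t n) \<le> 1" "\<And>n. q n o\<^sub>L t n o\<^sub>L p n = t n"
  shows "\<exists>T. (\<forall>S. T S \<in> bounded_operators \<and> norm (T S) \<le> 1 \<and>
      (\<forall>v. (\<lambda>n. if n \<in> S then blinfun_apply (t n) v else 0) sums blinfun_apply (T S) v)) \<and>
    (\<forall>U v. (\<forall>n::nat. U n \<subseteq> {n..}) \<longrightarrow> (\<lambda>n. blinfun_apply (T (U n)) v) \<longlonglongrightarrow> 0)"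
proof -
  define f :: "nat set \<Rightarrow> 'h \<Rightarrow> nat \<Rightarrow> 'h" where "f S v n = (if n \<in> S then t n v else 0)" for S v n
  have tqp: "t n v = q n (t n (p n v))" for n v
    using t(3) by (metis blinfun_apply_blinfun_compose)
  have orth: "cinner (f S v m) (f S v n) = 0" if "m \<noteq> n" for S v m n
  proof -
    have "cinner (q m x) (q n y) = 0" for x y
      using q(2)[OF that] by (metis blinfun_apply_blinfun_compose cinner.zero_right is_projection_cinner[OF q(1)] zero_blinfun.rep_eq)
    then show ?thesis unfolding f_def by (metis tqp cinner.zero_left cinner.zero_right)
  qed
  have norm_f: "(norm (f S v n))\<^sup>2 \<le> (norm (p n v))\<^sup>2" for S v n
  proof -
    have "norm (t n v) \<le> norm (t n (p n v))"
      by (subst tqp) (rule projection_norm_apply_le[OF q(1)])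
    also have "\<dots> \<le> norm (p n v)"
      using norm_blinfun[of "t n" "p n v"] mult_right_mono[OF t(2) norm_ge_zero, of n "p n v"] by simp
    finally show ?thesis by (auto simp: f_def intro: power_mono)
  qed
  have partial: "(norm (\<Sum>n\<in>I. f S v n))\<^sup>2 \<le> (\<Sum>n\<in>I. (norm (p n v))\<^sup>2)" if "finite I" for I S v
  proof -
    have "(norm (\<Sum>n\<in>I. f S v n))\<^sup>2 = (\<Sum>n\<in>I. (norm (f S v n))\<^sup>2)"
      using orth that by (intro norm_sum_square_orthogonal)
    also have "\<dots> \<le> (\<Sum>n\<in>I. (norm (p n v))\<^sup>2)" by (intro sum_mono norm_f)
    finally show ?thesis .
  qed
  have partial_norm: "norm (\<Sum>n\<in>I. f S v n) \<le> norm v" if "finite I" for I S v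
    using partial[OF that, of S v] bessel_projections[where p = p and v = v, OF p that]
    by (meson order_trans power2_le_imp_le norm_ge_zero)
  have summable_p: "summable (\<lambda>n. (norm (p n v))\<^sup>2)" for v
    by (rule summableI_nonneg_bounded[where x = "(norm v)\<^sup>2"]) (auto intro!: bessel_projections p)
  have tail: "\<exists>N. \<forall>S. \<forall>m\<ge>N. \<forall>n. norm (\<Sum>k\<in>{m..<n}. f S v k) < e" if e: "e > 0" for v e
  proof -
    obtain N where N: "\<And>m n. m \<ge> N \<Longrightarrow> norm (\<Sum>k\<in>{m..<n}. (norm (p k v))\<^sup>2) < e\<^sup>2"
      using summable_p[of v] e unfolding summable_Cauchy by (meson zero_less_power)
    have "norm (\<Sum>k\<in>{m..<n}. f S v k) < e" if "m \<ge> N" for S m n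
    proof (rule power2_less_imp_less)
      have "(norm (\<Sum>k\<in>{m..<n}. f S v k))\<^sup>2 \<le> (\<Sum>k\<in>{m..<n}. (norm (p k v))\<^sup>2)"
        by (rule partial) simp
      also have "\<dots> < e\<^sup>2" using N[OF that, of n] by simp
      finally show "(norm (\<Sum>k\<in>{m..<n}. f S v k))\<^sup>2 < e\<^sup>2" .
    qed (use e in simp)
    then show ?thesis by blast
  qed
  have summable_f: "summable (f S v)" for S v
    unfolding summable_Cauchy using tail by blast
  define T where "T S = Blinfun (\<lambda>v. suminf (f S v))" for S
  have suminf_norm: "norm (suminf (f S v)) \<le> norm v" for S v
    by (rule LIMSEQ_le_const2[OF tendsto_norm[OF summable_LIMSEQ[OF summable_f]]])
       (auto intro: partial_norm)
  have "bounded_linear (\<lambda>v. suminf (f S v))" for S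
  proof (rule bounded_linear_intro[where K = 1])
    show "suminf (f S (x + y)) = suminf (f S x) + suminf (f S y)" for x y
      unfolding suminf_add[OF summable_f summable_f]
      by (rule arg_cong[where f = suminf]) (auto simp: f_def blinfun.add_right)
    show "suminf (f S (r *\<^sub>R x)) = r *\<^sub>R suminf (f S x)" for r x
    proof -
      have "f S (r *\<^sub>R x) = (\<lambda>n. r *\<^sub>R f S x n)" by (auto simp: f_def blinfun.scaleR_right)
      then show ?thesis using summable_f[of S x] by (simp add: suminf_scaleR_right)
    qed
  qed (simp add: suminf_norm)
  then have T: "blinfun_apply (T S) v = suminf (f S v)" for S v
    by (simp add: T_def bounded_linear_Blinfun_apply)
  have sums: "f S v sums T S v" for S v
    unfolding T by (rule summable_sums[OF summable_f])
  show ?thesis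
  proof (intro exI[of _ T] conjI allI impI)
    fix S
    show "norm (T S) \<le> 1"
      by (rule norm_blinfun_bound) (simp_all add: T suminf_norm)
    have "(\<Sum>k<n. if k \<in> S then t k else 0) \<in> bounded_operators" for n
      by (induction n) (auto intro!: bounded_operators_add bounded_operators_zero t)
    moreover have "(\<lambda>n. blinfun_apply (\<Sum>k<n. if k \<in> S then t k else 0) v) \<longlonglongrightarrow> T S v" for v
    proof -
      have "blinfun_apply (\<Sum>k<n. if k \<in> S then t k else 0) v = (\<Sum>k<n. f S v k)" for n
        unfolding blinfun.sum_left f_def by (rule sum.cong) auto
      then show ?thesis using sums[of S v] by (simp add: sums_def)
    qed
    ultimately show "T S \<in> bounded_operators"
      by (intro bounded_operators_strong_limit[where F = sequentially
            and a = "\<lambda>n. \<Sum>k<n. if k \<in> S then t k else 0"]) auto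
  next
    show "(\<lambda>n. if n \<in> S then t n v else 0) sums T S v" for S v
      using sums[of S v] by (simp add: f_def[abs_def])
  next
    fix U :: "nat \<Rightarrow> nat set" and v
    assume U: "\<forall>n. U n \<subseteq> {n..}"
    show "(\<lambda>n. T (U n) v) \<longlonglongrightarrow> 0"
    proof (rule LIMSEQ_I)
      fix e :: real assume e: "e > 0"
      obtain N where N: "\<And>S m n. m \<ge> N \<Longrightarrow> norm (\<Sum>k\<in>{m..<n}. f S v k) < e / 2"
        using tail[of "e/2" v] e by auto
      have "norm (T (U m) v - 0) < e" if m: "m \<ge> N" for m
      proof -
        have "norm (\<Sum>k<n. f (U m) v k) \<le> e / 2" for n
        proof -
          have "(\<Sum>k<n. f (U m) v k) = (\<Sum>k\<in>{m..<n}. f (U m) v k)"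
            using U[rule_format, of m] by (intro sum.mono_neutral_right) (auto simp: f_def)
          then show ?thesis using N[OF m, of "U m" n] by simp
        qed
        then have "norm (T (U m) v) \<le> e / 2"
          unfolding T by (intro LIMSEQ_le_const2[OF tendsto_norm[OF summable_LIMSEQ[OF summable_f]]]) auto
        then show ?thesis using e by simp
      qed
      then show "\<exists>no. \<forall>n\<ge>no. norm (T (U n) v - 0) < e" by blast
    qed
  qed
qed


section \<open>Approximation by operators of controlled propagation\<close>

context geometric_module
begin

text \<open>The error is absolute, which makes sums, products and limits easy to track; the relative
  error of \<open>approximately_controlled\<close> comes back by scaling.\<close>

definition approximable :: "('h \<Rightarrow>\<^sub>L 'h) \<Rightarrow> real \<Rightarrow> real \<Rightarrow> bool" where
  "approximable a \<epsilon> R \<longleftrightarrow> (\<exists>s\<in>bounded_operators. propagation_le d \<AA> E s R \<and> norm (a - s) \<le> \<epsilon>)"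

lemma approximable_mono: "\<lbrakk>approximable a \<epsilon> R; \<epsilon> \<le> \<epsilon>'; R \<le> R'\<rbrakk> \<Longrightarrow> approximable a \<epsilon>' R'"
  unfolding approximable_def by (meson order_trans propagation_le_mono)

lemma approximable_zero: "\<epsilon> \<ge> 0 \<Longrightarrow> approximable 0 \<epsilon> R"
  unfolding approximable_def using bounded_operators_zero propagation_le_zero by force

lemma approximable_add:
  assumes "approximable a \<epsilon> R" "approximable b \<epsilon>' R'"
  shows "approximable (a + b) (\<epsilon> + \<epsilon>') (max R R')"
proof -
  obtain s s' where s: "s \<in> bounded_operators" "propagation_le d \<AA> E s R" "norm (a - s) \<le> \<epsilon>"
    "s' \<in> bounded_operators" "propagation_le d \<AA> E s' R'" "norm (b - s') \<le> \<epsilon>'"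
    using assms by (auto simp: approximable_def)
  have "norm ((a + b) - (s + s')) \<le> \<epsilon> + \<epsilon>'" using s by norm
  then show ?thesis using s
    unfolding approximable_def by (meson bounded_operators_add propagation_le_add)
qed

lemma approximable_scaleR:
  assumes "approximable a \<epsilon> R"
  shows "approximable (c *\<^sub>R a) (\<bar>c\<bar> * \<epsilon>) R"
proof -
  obtain s where s: "s \<in> bounded_operators" "propagation_le d \<AA> E s R" "norm (a - s) \<le> \<epsilon>"
    using assms by (auto simp: approximable_def)
  have "norm (c *\<^sub>R a - c *\<^sub>R s) \<le> \<bar>c\<bar> * \<epsilon>"
    using s(3) by (simp add: mult_left_mono flip: scaleR_diff_right)
  then show ?thesis using s
    unfolding approximable_def by (meson bounded_operators_scaleR propagation_le_scaleR)
qed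

lemma approximable_diff:
  "\<lbrakk>approximable a \<epsilon> R; approximable b \<epsilon>' R'\<rbrakk> \<Longrightarrow> approximable (a - b) (\<epsilon> + \<epsilon>') (max R R')"
  using approximable_add[of a \<epsilon> R "-1 *\<^sub>R b" \<epsilon>' R'] approximable_scaleR[of b \<epsilon>' R' "-1"] by simp

text \<open>The error is that of \<open>a b - s s' = (a - s) b + s (b - s')\<close>, where only
  \<open>norm s \<le> M + \<delta>\<close> is known for the approximant \<open>s\<close>.\<close>

lemma approximable_compose:
  assumes "discrete_module X d \<AA> E"
  obtains c where "c \<ge> 0" and "\<And>a b \<epsilon> \<delta> R R' M. \<lbrakk>approximable a \<delta> R; approximable b \<epsilon> R'; norm a \<le> M; norm b \<le> M;
      R \<ge> 0; R' \<ge> 0\<rbrakk> \<Longrightarrow> approximable (a o\<^sub>L b) (\<delta> * M + (M + \<delta>) * \<epsilon>) (R + R' + c)"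
proof -
  obtain c where c: "c \<ge> 0" "\<And>s t R R'. \<lbrakk>R \<ge> 0; R' \<ge> 0; propagation_le d \<AA> E s R; propagation_le d \<AA> E t R'\<rbrakk>
    \<Longrightarrow> propagation_le d \<AA> E (s o\<^sub>L t) (R + R' + c)"
    using propagation_le_compose[OF assms] by blast
  have "approximable (a o\<^sub>L b) (\<delta> * M + (M + \<delta>) * \<epsilon>) (R + R' + c)"
    if a: "approximable a \<delta> R" and b: "approximable b \<epsilon> R'" and M: "norm a \<le> M" "norm b \<le> M"
      and R: "R \<ge> 0" "R' \<ge> 0" for a b \<epsilon> \<delta> R R' M
  proof -
    obtain s s' where s: "s \<in> bounded_operators" "propagation_le d \<AA> E s R" "norm (a - s) \<le> \<delta>"
      "s' \<in> bounded_operators" "propagation_le d \<AA> E s' R'" "norm (b - s') \<le> \<epsilon>"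
      using a b by (auto simp: approximable_def)
    have "norm s \<le> M + \<delta>" using s(3) M(1) norm_triangle_ineq2[of s a] by (simp add: norm_minus_commute)
    have "(a o\<^sub>L b) - (s o\<^sub>L s') = ((a - s) o\<^sub>L b) + (s o\<^sub>L (b - s'))"
      by (rule blinfun_eqI) (simp add: blinfun.diff_left blinfun.diff_right blinfun.add_left)
    then have "norm ((a o\<^sub>L b) - (s o\<^sub>L s')) \<le> norm ((a - s) o\<^sub>L b) + norm (s o\<^sub>L (b - s'))"
      using norm_triangle_ineq by metis
    also have "\<dots> \<le> norm (a - s) * norm b + norm s * norm (b - s')"
      by (intro add_mono norm_blinfun_compose)
    also have "\<dots> \<le> \<delta> * M + (M + \<delta>) * \<epsilon>"
      using s M \<open>norm s \<le> M + \<delta>\<close> norm_ge_zero order_trans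
      by (intro add_mono mult_mono) (auto intro: order_trans[OF norm_ge_zero])
    finally show ?thesis unfolding approximable_def
      using s R by (intro bexI[of _ "s o\<^sub>L s'"]) (auto intro: c bounded_operators_compose)
  qed
  then show ?thesis using that c(1) by blast
qed

lemma approximable_Cstar_cp:
  assumes "a \<in> Cstar_cp d \<AA> E" "\<epsilon> > 0"
  shows "\<exists>R\<ge>0. approximable a \<epsilon> R"
proof -
  obtain s r where "s \<in> bounded_operators" "r \<ge> 0" "propagation_le d \<AA> E s r" "dist s a < \<epsilon>"
    using assms unfolding Cstar_cp_def closure_approachable by blast
  then show ?thesis
    unfolding approximable_def by (metis dist_commute dist_norm less_imp_le)
qed

text \<open>The matrix coefficients of the approximants live in a compact product of discs; a cluster
  point of them is a bounded sesquilinear form, hence the coefficients of an approximant of the limit.\<close>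

theorem approximable_strong_limit:
  assumes F: "F \<noteq> bot"
    and lim: "\<And>v. ((\<lambda>i. blinfun_apply (a i) v) \<longlongrightarrow> blinfun_apply t v) F"
    and bound: "\<forall>\<^sub>F i in F. norm (a i) \<le> M"
    and approx: "\<forall>\<^sub>F i in F. approximable (a i) \<epsilon> R"
  shows "approximable t \<epsilon> R"
proof -
  have "\<forall>i. \<exists>s. approximable (a i) \<epsilon> R \<longrightarrow>
      s \<in> bounded_operators \<and> propagation_le d \<AA> E s R \<and> norm (a i - s) \<le> \<epsilon>"
    unfolding approximable_def by blast
  then obtain s where s: "\<And>i. approximable (a i) \<epsilon> R \<Longrightarrow>
      s i \<in> bounded_operators \<and> propagation_le d \<AA> E (s i) R \<and> norm (a i - s i) \<le> \<epsilon>"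
    by metis
  define form where "form i = (\<lambda>(v, w). cinner (s i v) w)" for i
  \<comment> \<open>The radius is the bound on coefficients coming from
    \<open>norm (s i) \<le> M + \<epsilon>\<close>; Tychonoff makes \<open>K\<close>
    compact.\<close>
  define K where "K = (\<Pi>\<^sub>E (v, w)\<in>(UNIV :: ('h \<times> 'h) set). cball (0::complex) ((M + \<epsilon>) * norm v * norm w))"
  have "compactin (product_topology (\<lambda>_. euclidean) UNIV) K"
    unfolding K_def compactin_PiE by auto
  then have "compact K"
    by (simp add: euclidean_product_topology)
  have "\<forall>\<^sub>F i in F. form i \<in> K"
    using bound approx
  proof eventually_elim
    case (elim i)
    have "norm (s i) \<le> M + \<epsilon>"
      using s[OF elim(2)] elim(1) norm_triangle_ineq2[of "s i" "a i"] by (simp add: norm_minus_commute)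
    then have "norm (cinner (s i v) w) \<le> (M + \<epsilon>) * norm v * norm w" for v w
      using cinner_cauchy_schwarz[of "s i v" w] norm_blinfun[of "s i" v]
      by (meson mult_right_mono norm_ge_zero order_trans)
    then show ?case by (auto simp: K_def form_def)
  qed
  then have "eventually (\<lambda>x. x \<in> K) (filtermap form F)" by (simp add: eventually_filtermap)
  moreover have "filtermap form F \<noteq> bot" using F by (simp add: filtermap_bot_iff)
  ultimately obtain b where b: "inf (nhds b) (filtermap form F) \<noteq> bot"
    using \<open>compact K\<close> unfolding compact_filter by blast
  \<comment> \<open>\<open>G\<close> refines \<open>F\<close> so that the coefficients converge to
    \<open>b\<close> along it. It is proper exactly because \<open>b\<close> is a cluster
    point.\<close>
  define G where "G = inf F (filtercomap form (nhds b))"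
  have G: "G \<noteq> bot"
  proof
    assume "G = bot"
    then have "eventually (\<lambda>_. False) G" by simp
    then obtain P Q where PQ: "eventually P F" "eventually Q (nhds b)" "\<And>i. P i \<Longrightarrow> Q (form i) \<Longrightarrow> False"
      unfolding G_def eventually_inf eventually_filtercomap by blast
    have "eventually (\<lambda>x. \<not> Q x) (filtermap form F)"
      unfolding eventually_filtermap using PQ(1) by eventually_elim (use PQ(3) in blast)
    then have "eventually (\<lambda>_. False) (inf (nhds b) (filtermap form F))"
      unfolding eventually_inf using PQ(2) by blast
    then show False using b by (simp add: trivial_limit_def)
  qed
  have "G \<le> F" by (simp add: G_def)
  have form_lim: "(form \<longlongrightarrow> b) G"
    unfolding G_def filterlim_iff_le_filtercomap by simp
  have coeff: "((\<lambda>i. cinner (s i v) w) \<longlongrightarrow> b (v, w)) G" for v w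
    using continuous_on_tendsto_compose[OF continuous_on_product_coordinates form_lim, of "(v, w)"]
    by (simp add: form_def)
  have alim: "((\<lambda>i. cinner (a i v) w) \<longlongrightarrow> cinner (t v) w) G" for v w
    by (intro tendsto_intros cinner.tendsto tendsto_mono[OF \<open>G \<le> F\<close> lim])
  have evG: "\<forall>\<^sub>F i in G. approximable (a i) \<epsilon> R"
    using approx \<open>G \<le> F\<close> by (rule filter_leD[rotated])
  \<comment> \<open>Identities valid for the coefficients of every approximant pass to the limit.
    The guard is there because \<open>s i\<close> is unspecified where \<open>a i\<close> is not
    approximable.\<close>
  have eq: "x = y" if "(f \<longlongrightarrow> x) G" "(g \<longlongrightarrow> y) G" "\<And>i. approximable (a i) \<epsilon> R \<Longrightarrow> f i = g i"
    for f g and x y :: complex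
    using tendsto_unique[OF G that(1)] Lim_transform_eventually[OF that(2), of f]
      eventually_mono[OF evG, of "\<lambda>i. g i = f i"] that(3) by force
  have near: "norm (b (v, w) - cinner (t v) w) \<le> \<epsilon> * norm v * norm w" for v w
  proof (rule tendsto_upperbound[OF tendsto_norm[OF tendsto_diff[OF coeff alim]] _ G])
    show "\<forall>\<^sub>F i in G. norm (cinner (s i v) w - cinner (a i v) w) \<le> \<epsilon> * norm v * norm w"
      using evG
    proof eventually_elim
      case (elim i)
      have "norm (cinner ((s i - a i) v) w) \<le> norm ((s i - a i) v) * norm w"
        by (rule cinner_cauchy_schwarz)
      also have "\<dots> \<le> (norm (s i - a i) * norm v) * norm w"
        by (intro mult_right_mono norm_blinfun) simp
      also have "\<dots> \<le> (\<epsilon> * norm v) * norm w"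
        using s[OF elim] by (intro mult_right_mono) (auto simp: norm_minus_commute)
      finally show ?case by (simp add: blinfun.diff_left cinner.diff_left)
    qed
  qed
  have "\<exists>u\<in>bounded_operators. \<forall>v w. cinner (blinfun_apply u v) w = b (v, w)"
  proof (rule bounded_sesquilinear_form_operator[of "\<lambda>v w. b (v, w)" "\<epsilon> + norm t"])
    fix x y z :: 'h and c :: complex
    show "b (x + y, z) = b (x, z) + b (y, z)"
      by (rule eq[OF coeff tendsto_add[OF coeff coeff]]) (simp add: blinfun.add_right cinner.add_left)
    show "b (z, x + y) = b (z, x) + b (z, y)"
      by (rule eq[OF coeff tendsto_add[OF coeff coeff]]) (simp add: cinner.add_right)
    show "b (c *\<^sub>C x, y) = c * b (x, y)"
      by (rule eq[OF coeff tendsto_mult[OF tendsto_const coeff]])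
         (use s in \<open>simp add: bounded_operatorsD cinner_scaleC_left\<close>)
    show "b (x, c *\<^sub>C y) = cnj c * b (x, y)"
      by (rule eq[OF coeff tendsto_mult[OF tendsto_const coeff]]) (simp add: cinner_scaleC_right)
    have "norm (b (x, y)) \<le> \<epsilon> * norm x * norm y + norm (cinner (t x) y)"
      using near[of x y] norm_triangle_ineq2[of "b (x, y)" "cinner (t x) y"] by linarith
    also have "norm (cinner (t x) y) \<le> (norm t * norm x) * norm y"
      using cinner_cauchy_schwarz[of "t x" y] norm_blinfun[of t x]
      by (meson mult_right_mono norm_ge_zero order_trans)
    finally show "norm (b (x, y)) \<le> (\<epsilon> + norm t) * norm x * norm y" by (simp add: algebra_simps)
  qed
  then obtain u where u: "u \<in> bounded_operators" "\<And>v w. cinner (u v) w = b (v, w)" by blast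
  \<comment> \<open>The sign of \<open>\<epsilon>\<close> is not a hypothesis; it follows because
    some \<open>a i\<close> does have an approximant.\<close>
  have eps: "\<epsilon> \<ge> 0"
  proof -
    obtain i where "approximable (a i) \<epsilon> R" using eventually_happens'[OF F approx] by blast
    then show ?thesis using s[of i] norm_ge_zero order_trans by blast
  qed
  have "norm (t - u) \<le> \<epsilon>"
  proof (rule norm_blinfun_bound[OF eps])
    fix v
    define z where "z = (t - u) v"
    have "(norm z)\<^sup>2 = norm (cinner (t v) z - cinner (u v) z)"
      by (simp add: z_def blinfun.diff_left cinner.diff_left[symmetric] cinner_self norm_power)
    also have "\<dots> = norm (b (v, z) - cinner (t v) z)" by (simp add: u norm_minus_commute)
    also have "\<dots> \<le> \<epsilon> * norm v * norm z" by (rule near)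
    finally have "norm z * norm z \<le> (\<epsilon> * norm v) * norm z" by (simp add: power2_eq_square)
    then show "norm ((t - u) v) \<le> \<epsilon> * norm v"
      using eps by (cases "norm z = 0") (auto simp: z_def)
  qed
  moreover have "propagation_le d \<AA> E u R"
  proof (rule propagation_leI)
    fix A A' v assume A: "A \<in> \<AA>" "A' \<in> \<AA>" "\<And>x x'. \<lbrakk>x \<in> A; x' \<in> A'\<rbrakk> \<Longrightarrow> ennreal R < d x' x"
    show "E A' (u (E A v)) = 0"
    proof (rule cinner_eqI)
      fix w
      \<comment> \<open>Since \<open>E A'\<close> is self-adjoint, bounded propagation is the
        vanishing of certain matrix coefficients, hence closed under coefficientwise limits.\<close>
      have "b (E A v, E A' w) = 0"
      proof (rule eq[OF coeff tendsto_const])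
        fix i assume "approximable (a i) \<epsilon> R"
        then have "E A' (s i (E A v)) = 0" using s A by (intro propagation_leD) blast+
        then show "cinner (s i (E A v)) (E A' w) = 0"
          by (metis A(2) E_projection is_projection_cinner cinner.zero_left)
      qed
      then show "cinner (E A' (u (E A v))) w = cinner 0 w"
        using A(2) by (simp add: u is_projection_cinner[OF E_projection] cinner.zero_left)
    qed
  qed
  ultimately show ?thesis using u(1) by (auto simp: approximable_def)
qed

end


section \<open>Uniform approximability\<close>

context geometric_module
begin

text \<open>On the domain side \<open>\<phi>\<close> is only evaluated on this set, not on its
  closure: the sums, cuts and strong series below all stay inside it.\<close>

definition finite_propagation :: "('h \<Rightarrow>\<^sub>L 'h) set" where
  "finite_propagation = {t \<in> bounded_operators. \<exists>r\<ge>0. propagation_le d \<AA> E t r}"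

lemma finite_propagation_subset_Cstar_cp: "finite_propagation \<subseteq> Cstar_cp d \<AA> E"
  unfolding finite_propagation_def Cstar_cp_def by (rule closure_subset)

lemma finite_propagationI:
  "\<lbrakk>t \<in> bounded_operators; r \<ge> 0; propagation_le d \<AA> E t r\<rbrakk> \<Longrightarrow> t \<in> finite_propagation"
  by (auto simp: finite_propagation_def)

lemma finite_propagation_zero: "0 \<in> finite_propagation"
  by (rule finite_propagationI[of _ 0]) (auto simp: bounded_operators_zero propagation_le_zero)

lemma finite_propagation_add:
  assumes "s \<in> finite_propagation" "t \<in> finite_propagation"
  shows "s + t \<in> finite_propagation"
proof -
  obtain r r' where "r \<ge> 0" "propagation_le d \<AA> E s r" "propagation_le d \<AA> E t r'"
    using assms by (auto simp: finite_propagation_def)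
  then show ?thesis
    using assms by (intro finite_propagationI[of _ "max r r'"] propagation_le_add bounded_operators_add)
      (auto simp: finite_propagation_def)
qed

lemma finite_propagation_scaleR: "s \<in> finite_propagation \<Longrightarrow> c *\<^sub>R s \<in> finite_propagation"
  unfolding finite_propagation_def using bounded_operators_scaleR propagation_le_scaleR by blast

lemma finite_propagation_diff:
  "\<lbrakk>s \<in> finite_propagation; t \<in> finite_propagation\<rbrakk> \<Longrightarrow> s - t \<in> finite_propagation"
  using finite_propagation_add[of s "-1 *\<^sub>R t"] finite_propagation_scaleR[of t "-1"] by simp

text \<open>The closure is taken among real-linear operators, so complex linearity of its elements
  has to be checked; norm limits are strong limits.\<close>

lemma Cstar_cp_bounded: "Cstar_cp d \<AA> E \<subseteq> bounded_operators"
proof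
  fix t assume "t \<in> Cstar_cp d \<AA> E"
  then obtain a where a: "\<And>n. a n \<in> bounded_operators" "a \<longlonglongrightarrow> t"
    unfolding Cstar_cp_def closure_sequential by blast
  show "t \<in> bounded_operators"
    by (rule bounded_operators_strong_limit[where F = sequentially and a = a])
       (use a in \<open>auto intro: tendsto_intros blinfun.tendsto\<close>)
qed

end

section \<open>Strongly continuous homomorphisms: boundedness and the gliding hump\<close>

locale strongly_continuous_homomorphism =
  dom: geometric_module X dX \<AA> E + cod: geometric_module Y dY \<BB> F
  for X :: "'x set" and dX \<AA> and E :: "'x set \<Rightarrow> ('h::complex_hilbert \<Rightarrow>\<^sub>L 'h)"
    and Y :: "'y set" and dY \<BB> and F :: "'y set \<Rightarrow> ('k::complex_hilbert \<Rightarrow>\<^sub>L 'k)" +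
  fixes \<phi> :: "('h \<Rightarrow>\<^sub>L 'h) \<Rightarrow> ('k \<Rightarrow>\<^sub>L 'k)"
  assumes hom: "star_homomorphism (Cstar_cp dX \<AA> E) (Cstar_cp dY \<BB> F) \<phi>"
    and cont: "strongly_continuous (Cstar_cp dX \<AA> E) (Cstar_cp dY \<BB> F) \<phi>"
begin

lemma phi_Cstar_cp: "t \<in> dom.finite_propagation \<Longrightarrow> \<phi> t \<in> Cstar_cp dY \<BB> F"
  using hom dom.finite_propagation_subset_Cstar_cp unfolding star_homomorphism_def by blast

lemma phi_add: "\<lbrakk>s \<in> dom.finite_propagation; t \<in> dom.finite_propagation\<rbrakk> \<Longrightarrow> \<phi> (s + t) = \<phi> s + \<phi> t"
  using hom dom.finite_propagation_subset_Cstar_cp unfolding star_homomorphism_def by blast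

lemma phi_compose:
  "\<lbrakk>s \<in> dom.finite_propagation; t \<in> dom.finite_propagation\<rbrakk> \<Longrightarrow> \<phi> (s o\<^sub>L t) = \<phi> s o\<^sub>L \<phi> t"
  using hom dom.finite_propagation_subset_Cstar_cp unfolding star_homomorphism_def by blast

lemma phi_scaleR: "t \<in> dom.finite_propagation \<Longrightarrow> \<phi> (r *\<^sub>R t) = r *\<^sub>R \<phi> t"
proof -
  assume t: "t \<in> dom.finite_propagation"
  have real: "scaleC_operator (of_real r) s = r *\<^sub>R s" for s :: "'a::complex_hilbert \<Rightarrow>\<^sub>L 'a"
    by (rule blinfun_eqI) (simp add: scaleC_operator.rep_eq scaleC_of_real blinfun.scaleR_left)
  have "\<phi> (scaleC_operator (of_real r) t) = scaleC_operator (of_real r) (\<phi> t)"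
    using t hom dom.finite_propagation_subset_Cstar_cp unfolding star_homomorphism_def by blast
  then show ?thesis by (simp add: real)
qed

lemma phi_zero: "\<phi> 0 = 0"
  using phi_scaleR[OF dom.finite_propagation_zero, of 0] by simp

lemma phi_strong_limit:
  assumes "\<forall>\<^sub>F i in G. a i \<in> dom.finite_propagation" "t \<in> dom.finite_propagation"
    and "\<And>v. ((\<lambda>i. blinfun_apply (a i) v) \<longlongrightarrow> blinfun_apply t v) G"
  shows "((\<lambda>i. blinfun_apply (\<phi> (a i)) w) \<longlongrightarrow> blinfun_apply (\<phi> t) w) G"
  using assms dom.finite_propagation_subset_Cstar_cp
  by (intro strongly_continuous_limit[OF cont]) (auto elim: eventually_mono)

text \<open>Strong continuity suffices: if \<open>\<phi> (t n) v\<close> had norm above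
  \<open>n + 1\<close> with \<open>t n\<close> in the unit ball, then \<open>t n / (n + 1)\<close>
  would tend to \<open>0\<close> while its image at \<open>v\<close> keeps norm above
  \<open>1\<close>. So the image of the unit ball is pointwise bounded, and uniform boundedness
  applies.\<close>

lemma phi_bounded: "\<exists>M\<ge>0. \<forall>t\<in>dom.finite_propagation. norm (\<phi> t) \<le> M * norm t"
proof -
  let ?S = "{t \<in> dom.finite_propagation. norm t \<le> 1}"
  have pointwise: "\<exists>C. \<forall>s\<in>\<phi> ` ?S. norm (blinfun_apply s v) \<le> C" for v
  proof (rule ccontr)
    assume *: "\<nexists>C. \<forall>s\<in>\<phi> ` ?S. norm (blinfun_apply s v) \<le> C"
    have "\<forall>n. \<exists>t\<in>?S. real (Suc n) < norm (blinfun_apply (\<phi> t) v)"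
    proof
      fix n
      obtain s where "s \<in> \<phi> ` ?S" and s: "real (Suc n) < norm (blinfun_apply s v)"
        using * by (meson not_le)
      then obtain t where "t \<in> ?S" "s = \<phi> t" by blast
      then show "\<exists>t\<in>?S. real (Suc n) < norm (blinfun_apply (\<phi> t) v)" using s by blast
    qed
    then obtain t where t: "\<And>n. t n \<in> dom.finite_propagation" "\<And>n. norm (t n) \<le> 1"
      and large: "\<And>n. real (Suc n) < norm (blinfun_apply (\<phi> (t n)) v)" by (simp add: Bex_def) metis
    define a where "a n = (1 / real (Suc n)) *\<^sub>R t n" for n
    have afp: "a n \<in> dom.finite_propagation" for n
      unfolding a_def by (intro dom.finite_propagation_scaleR t)
    have "norm (a n) \<le> 1 / real (Suc n)" for n
      using t(2)[of n] by (simp add: a_def divide_right_mono)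
    then have "a \<longlonglongrightarrow> 0"
      by (intro Lim_null_comparison[OF _ LIMSEQ_Suc[OF lim_1_over_n]] always_eventually allI)
    then have "(\<lambda>n. blinfun_apply (\<phi> (a n)) v) \<longlonglongrightarrow> blinfun_apply (\<phi> 0) v"
      using afp dom.finite_propagation_zero
      by (intro phi_strong_limit blinfun.tendsto tendsto_const) auto
    then have "(\<lambda>n. blinfun_apply (\<phi> (a n)) v) \<longlonglongrightarrow> 0" by (simp add: phi_zero)
    then obtain n where "norm (blinfun_apply (\<phi> (a n)) v) < 1"
      using LIMSEQ_D[of "\<lambda>n. blinfun_apply (\<phi> (a n)) v" 0 1] by auto
    moreover have "norm (blinfun_apply (\<phi> (a n)) v) = norm (blinfun_apply (\<phi> (t n)) v) / real (Suc n)"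
      unfolding a_def phi_scaleR[OF t(1)] by (simp add: blinfun.scaleR_left)
    ultimately show False using large[of n] by (simp add: divide_less_eq)
  qed
  obtain M where M: "\<And>t. t \<in> ?S \<Longrightarrow> norm (\<phi> t) \<le> M"
    using banach_steinhaus[OF pointwise] by auto
  show ?thesis
  proof (intro exI[of _ "\<bar>M\<bar>"] conjI ballI)
    fix t assume t: "t \<in> dom.finite_propagation"
    show "norm (\<phi> t) \<le> \<bar>M\<bar> * norm t"
    proof (cases "t = 0")
      case False
      define u where "u = (1 / norm t) *\<^sub>R t"
      have "norm (\<phi> u) \<le> M"
        using t False by (intro M) (simp add: u_def dom.finite_propagation_scaleR)
      moreover have "norm (\<phi> u) = norm (\<phi> t) / norm t"
        unfolding u_def phi_scaleR[OF t] by simp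
      ultimately show ?thesis using False
        by (simp add: divide_le_eq) (meson abs_ge_self mult_right_mono norm_ge_zero order_trans)
    qed (simp add: phi_zero)
  qed simp
qed

lemma approximable_phi:
  "\<lbrakk>t \<in> dom.finite_propagation; \<epsilon> > 0\<rbrakk> \<Longrightarrow> \<exists>R\<ge>0. cod.approximable (\<phi> t) \<epsilon> R"
  by (rule cod.approximable_Cstar_cp[OF phi_Cstar_cp])

text \<open>Applied in contrapositive form: if \<open>\<phi> t\<close> is bad for
  \<open>\<epsilon>\<close> and \<open>R\<close>, so is the image of some member of any bounded net
  tending strongly to \<open>t\<close>. Boundedness of \<open>\<phi>\<close> supplies the norm bound
  that the compactness argument needs.\<close>

lemma approximable_phi_strong_limit:
  assumes G: "G \<noteq> bot" and a: "\<forall>\<^sub>F i in G. a i \<in> dom.finite_propagation" and t: "t \<in> dom.finite_propagation"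
    and bound: "\<forall>\<^sub>F i in G. norm (a i) \<le> K"
    and lim: "\<And>v. ((\<lambda>i. blinfun_apply (a i) v) \<longlongrightarrow> blinfun_apply t v) G"
    and approx: "\<forall>\<^sub>F i in G. cod.approximable (\<phi> (a i)) \<epsilon> R"
  shows "cod.approximable (\<phi> t) \<epsilon> R"
proof -
  obtain M where M: "M \<ge> 0" "\<And>t. t \<in> dom.finite_propagation \<Longrightarrow> norm (\<phi> t) \<le> M * norm t"
    using phi_bounded by blast
  have "\<forall>\<^sub>F i in G. norm (\<phi> (a i)) \<le> M * K"
    using a bound by eventually_elim (meson M mult_left_mono order_trans)
  then show ?thesis
    by (intro cod.approximable_strong_limit[OF G phi_strong_limit[OF a t lim] _ approx])
qed

text \<open>Gliding hump: if every \<open>\<phi> (T {n})\<close> were far from propagation \<open>n\<close>, one could choose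
  finite sets \<open>A\<^sub>0 \<subseteq> A\<^sub>1 \<subseteq> \<dots>\<close> so that for all \<open>k\<close>, whatever is added to \<open>A\<^sub>k\<close> far out,
  the image of \<open>T\<close> stays far from propagation \<open>k\<close>. Then \<open>\<phi> (T (\<Union>k. A\<^sub>k))\<close> is not approximable.\<close>

lemma approximable_in_sequence:
  fixes T :: "nat set \<Rightarrow> ('h \<Rightarrow>\<^sub>L 'h)"
  assumes fp: "\<And>S. T S \<in> dom.finite_propagation"
    and add: "\<And>S S'. S \<inter> S' = {} \<Longrightarrow> T (S \<union> S') = T S + T S'"
    and bound: "\<And>S. norm (T S) \<le> 1"
    and vanish: "\<And>U v. (\<And>n::nat. U n \<subseteq> {n..}) \<Longrightarrow> (\<lambda>n. blinfun_apply (T (U n)) v) \<longlonglongrightarrow> 0"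
    and \<epsilon>: "\<epsilon> > 0"
  shows "\<exists>n. cod.approximable (\<phi> (T {n})) \<epsilon> (real n)"
proof (rule ccontr)
  assume not_approx: "\<nexists>n. cod.approximable (\<phi> (T {n})) \<epsilon> (real n)"
  \<comment> \<open>Badness of \<open>A\<close> that no later choice beyond \<open>N\<close> can
    repair. The error drops to \<open>\<epsilon>/3\<close> because badness is transferred through a
    difference of two approximable operators.\<close>
  define far where "far k A N \<longleftrightarrow>
    A \<subseteq> {..<N} \<and> (\<forall>S\<subseteq>{N..}. \<not> cod.approximable (\<phi> (T (A \<union> S))) (\<epsilon>/3) (real k))" for k A and N :: nat
  have step: "\<exists>A' N'. far k A' N' \<and> A \<subseteq> A' \<and> A' - A \<subseteq> {N..} \<and> N \<le> N'" if A: "A \<subseteq> {..<N}" for k A N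
  proof -
    obtain R where R: "cod.approximable (\<phi> (T A)) (\<epsilon>/3) R"
      using approximable_phi[OF fp, of "\<epsilon>/3"] \<epsilon> by auto
    obtain m where m: "R \<le> real m" using real_arch_simple by blast
    \<comment> \<open>\<open>n \<ge> N\<close> keeps the new index off \<open>A\<close>. With
      \<open>n \<ge> R\<close> and \<open>n \<ge> k\<close>, approximants for
      \<open>A \<union> {n}\<close> and for \<open>A\<close> would differ by one for
      \<open>{n}\<close> of propagation at most \<open>n\<close>, which does not exist.\<close>
    define n where "n = max m (max N k)"
    have n: "R \<le> real n" "N \<le> n" "k \<le> n" using m by (auto simp: n_def)
    have dj: "A \<inter> {n} = {}" using A n by auto
    have notA: "\<not> cod.approximable (\<phi> (T (A \<union> {n}))) (\<epsilon>/3) (real k)"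
    proof
      assume "cod.approximable (\<phi> (T (A \<union> {n}))) (\<epsilon>/3) (real k)"
      then have "cod.approximable (\<phi> (T (A \<union> {n})) - \<phi> (T A)) (\<epsilon>/3 + \<epsilon>/3) (max (real k) R)"
        by (rule cod.approximable_diff[OF _ R])
      moreover have "\<phi> (T (A \<union> {n})) - \<phi> (T A) = \<phi> (T {n})"
        by (simp only: add[OF dj] phi_add[OF fp fp]) simp
      ultimately have "cod.approximable (\<phi> (T {n})) \<epsilon> (real n)"
        using n \<epsilon> by (auto elim: cod.approximable_mono)
      then show False using not_approx by blast
    qed
    \<comment> \<open>Otherwise there are repairing sets \<open>U i\<close> moving to infinity.
      Adding them changes nothing in the strong limit, so \<open>A \<union> {n}\<close> itself would
      be approximable.\<close>
    have "\<exists>N'>n. \<forall>S\<subseteq>{N'..}. \<not> cod.approximable (\<phi> (T (A \<union> {n} \<union> S))) (\<epsilon>/3) (real k)"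
    proof (rule ccontr)
      assume "\<not> ?thesis"
      \<comment> \<open>Starting at \<open>Suc n\<close> keeps the sets disjoint from
        \<open>A \<union> {n}\<close>, which additivity of \<open>T\<close> requires.\<close>
      then have "\<forall>N'. \<exists>S\<subseteq>{max N' (Suc n)..}. cod.approximable (\<phi> (T (A \<union> {n} \<union> S))) (\<epsilon>/3) (real k)"
        by (meson Suc_le_lessD max.cobounded2)
      then obtain U where U: "\<And>i. U i \<subseteq> {max i (Suc n)..}"
        "\<And>i. cod.approximable (\<phi> (T (A \<union> {n} \<union> U i))) (\<epsilon>/3) (real k)" by metis
      have "(A \<union> {n}) \<inter> U i = {}" for i using U(1)[of i] A n by fastforce
      then have split: "T (A \<union> {n} \<union> U i) = T (A \<union> {n}) + T (U i)" for i by (rule add)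
      have lim: "(\<lambda>i. blinfun_apply (T (A \<union> {n} \<union> U i)) v) \<longlonglongrightarrow> blinfun_apply (T (A \<union> {n})) v" for v
      proof -
        have "(\<lambda>i. blinfun_apply (T (U i)) v) \<longlonglongrightarrow> 0"
          using U(1) by (intro vanish) (meson atLeast_subset_iff max.cobounded1 order_trans)
        then have "(\<lambda>i. blinfun_apply (T (A \<union> {n})) v + blinfun_apply (T (U i)) v)
            \<longlonglongrightarrow> blinfun_apply (T (A \<union> {n})) v + 0"
          by (intro tendsto_intros)
        then show ?thesis unfolding split by (simp add: blinfun.add_left)
      qed
      have "cod.approximable (\<phi> (T (A \<union> {n}))) (\<epsilon>/3) (real k)"
        by (rule approximable_phi_strong_limit[OF sequentially_bot _ fp _ lim, where K = 1])
           (simp_all add: fp bound U(2) del: Un_insert_right)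
      then show False using notA by blast
    qed
    then obtain N' where N': "N' > n" "\<forall>S\<subseteq>{N'..}. \<not> cod.approximable (\<phi> (T (A \<union> {n} \<union> S))) (\<epsilon>/3) (real k)"
      by blast
    have "far k (A \<union> {n}) N'" unfolding far_def using N' A n by auto
    then show ?thesis using N'(1) n by (intro exI[of _ "A \<union> {n}"] exI[of _ N']) auto
  qed
  have "\<exists>f. \<forall>k. far k (fst (f k)) (snd (f k)) \<and>
      (fst (f k) \<subseteq> fst (f (Suc k)) \<and> fst (f (Suc k)) - fst (f k) \<subseteq> {snd (f k)..} \<and> snd (f k) \<le> snd (f (Suc k)))"
  proof (rule dependent_nat_choice[where P = "\<lambda>k x. far k (fst x) (snd x)" and
        Q = "\<lambda>k x y. fst x \<subseteq> fst y \<and> fst y - fst x \<subseteq> {snd x..} \<and> snd x \<le> snd y"])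
    show "\<exists>x. far 0 (fst x) (snd x)" using step[of "{}" 0 0] by auto
    fix x :: "nat set \<times> nat" and k assume "far k (fst x) (snd x)"
    then have "fst x \<subseteq> {..<snd x}" by (simp add: far_def)
    from step[OF this, of "Suc k"] show "\<exists>y. far (Suc k) (fst y) (snd y) \<and>
        (fst x \<subseteq> fst y \<and> fst y - fst x \<subseteq> {snd x..} \<and> snd x \<le> snd y)" by auto
  qed
  then obtain f where f: "\<And>k. far k (fst (f k)) (snd (f k))"
    "\<And>k. fst (f k) \<subseteq> fst (f (Suc k))" "\<And>k. fst (f (Suc k)) - fst (f k) \<subseteq> {snd (f k)..}"
    "\<And>k. snd (f k) \<le> snd (f (Suc k))" by blast
  define A where "A = (\<Union>k. fst (f k))"
  have mono: "fst (f j) \<subseteq> fst (f k)" "snd (f j) \<le> snd (f k)" if "j \<le> k" for j k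
    using that f(2,4) lift_Suc_mono_le[of "\<lambda>k. fst (f k)"] lift_Suc_mono_le[of "\<lambda>k. snd (f k)"] by auto
  have tail: "fst (f (k + i)) - fst (f k) \<subseteq> {snd (f k)..}" for k i
  proof (induction i)
    case (Suc i)
    show ?case
    proof
      fix x assume x: "x \<in> fst (f (k + Suc i)) - fst (f k)"
      show "x \<in> {snd (f k)..}"
      proof (cases "x \<in> fst (f (k + i))")
        case True
        then show ?thesis using Suc x by blast
      next
        case False
        then have "snd (f (k + i)) \<le> x" using f(3)[of "k + i"] x by auto
        then show ?thesis using mono(2)[of k "k + i"] by simp
      qed
    qed
  qed simp
  \<comment> \<open>Whatever enters after stage \<open>k\<close> lies beyond
    \<open>snd (f k)\<close>, so \<open>A\<close> is an admissible enlargement of every stage at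
    once.\<close>
  have "\<not> cod.approximable (\<phi> (T A)) (\<epsilon>/3) (real k)" for k
  proof -
    have "A - fst (f k) \<subseteq> {snd (f k)..}"
    proof
      fix x assume x: "x \<in> A - fst (f k)"
      then obtain j where j: "x \<in> fst (f j)" by (auto simp: A_def)
      then have "x \<in> fst (f (k + j))" using mono(1)[of j "k + j"] by auto
      then show "x \<in> {snd (f k)..}" using tail[of k j] x by blast
    qed
    moreover have "A = fst (f k) \<union> (A - fst (f k))" by (auto simp: A_def)
    ultimately show ?thesis using f(1)[of k] unfolding far_def by metis
  qed
  moreover obtain R where "cod.approximable (\<phi> (T A)) (\<epsilon>/3) R"
    using approximable_phi[OF fp, of "\<epsilon>/3" A] \<epsilon> by auto
  moreover obtain k where "R \<le> real k" using real_arch_simple by blast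
  ultimately show False using cod.approximable_mono by blast
qed

end


section \<open>Increasing chains of projections and the corner argument\<close>

lemma projection_chain_orthogonal:
  fixes p :: "nat \<Rightarrow> ('h::complex_hilbert \<Rightarrow>\<^sub>L 'h)"
  assumes proj: "\<And>n. is_projection (p n)"
    and chain: "\<And>n. p n o\<^sub>L p (Suc n) = p n" "\<And>n. p (Suc n) o\<^sub>L p n = p n"
  shows "is_projection (p (Suc n) - p n)"
    and "m \<noteq> n \<Longrightarrow> (p (Suc m) - p m) o\<^sub>L (p (Suc n) - p n) = 0"
proof -
  show "is_projection (p (Suc n) - p n)" by (intro projection_diff proj chain)
  have le: "p m (p n v) = p m v \<and> p n (p m v) = p m v" if "m \<le> n" for m n v
    using that
  proof (induction n arbitrary: v rule: dec_induct)
    case base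
    then show ?case by (simp add: is_projection_idem[OF proj])
  next
    case (step n)
    have "p m (p (Suc n) v) = p m (p n (p (Suc n) v))" using step.IH by simp
    also have "\<dots> = p m (p n v)" using chain(1)[of n] by (metis blinfun_apply_blinfun_compose)
    finally have 1: "p m (p (Suc n) v) = p m v" using step.IH by simp
    have "p (Suc n) (p m v) = p (Suc n) (p n (p m v))" using step.IH by simp
    also have "\<dots> = p n (p m v)" using chain(2)[of n] by (metis blinfun_apply_blinfun_compose)
    finally show ?case using 1 step.IH by simp
  qed
  show "(p (Suc m) - p m) o\<^sub>L (p (Suc n) - p n) = 0" if mn: "m \<noteq> n"
  proof (rule blinfun_eqI)
    fix v
    consider "Suc m \<le> n" | "Suc n \<le> m" using mn by linarith
    then show "blinfun_apply ((p (Suc m) - p m) o\<^sub>L (p (Suc n) - p n)) v = blinfun_apply 0 v"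
    proof cases
      case 1
      then show ?thesis using le[of "Suc m" n] le[of m n] le[of "Suc m" "Suc n"] le[of m "Suc n"]
        by (simp add: blinfun.diff_left blinfun.diff_right)
    next
      case 2
      then show ?thesis using le[of "Suc n" m] le[of n m] le[of "Suc n" "Suc m"] le[of n "Suc m"]
        by (simp add: blinfun.diff_left blinfun.diff_right)
    qed
  qed
qed

context strongly_continuous_homomorphism
begin

text \<open>\<open>\<P>\<close> is a directed set of projections increasing strongly to the identity on the operators in
  \<open>\<T>\<close>. If no corner works, one finds operators in \<open>\<T>\<close> with pairwise orthogonal supports and
  ranges whose images are worse and worse approximable, contradicting the gliding hump.\<close>

lemma approximable_corner:
  assumes proj: "\<And>p. p \<in> \<P> \<Longrightarrow> is_projection p" and ne: "\<P> \<noteq> {}"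
    and above: "\<And>p0. p0 \<in> \<P> \<Longrightarrow> \<exists>G. G \<noteq> bot \<and>
      (\<forall>\<^sub>F p in G. p \<in> \<P> \<and> p0 o\<^sub>L p = p0 \<and> p o\<^sub>L p0 = p0) \<and>
      (\<forall>t\<in>\<T>. \<forall>v. ((\<lambda>p. blinfun_apply t (blinfun_apply p v)) \<longlongrightarrow> blinfun_apply t v) G)"
    and range: "\<And>t p q0. \<lbrakk>t \<in> \<T>; p \<in> \<P>; q0 \<in> \<P>\<rbrakk> \<Longrightarrow>
      \<exists>q\<in>\<P>. q0 o\<^sub>L q = q0 \<and> q o\<^sub>L q0 = q0 \<and> q o\<^sub>L t o\<^sub>L p = t o\<^sub>L p"
    and \<T>: "\<T> \<subseteq> dom.finite_propagation"
      "\<And>s t. \<lbrakk>s \<in> \<T>; t \<in> \<T>\<rbrakk> \<Longrightarrow> s - t \<in> \<T>"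
      "\<And>t p. \<lbrakk>t \<in> \<T>; p \<in> \<P>\<rbrakk> \<Longrightarrow> t o\<^sub>L p \<in> \<T>"
      "\<And>t p. \<lbrakk>t \<in> \<T>; p \<in> \<P>\<rbrakk> \<Longrightarrow> p o\<^sub>L t \<in> \<T>"
    and \<T>_sums: "\<And>a T. \<lbrakk>\<And>n::nat. a n \<in> \<T>; T \<in> bounded_operators;
      \<And>v. (\<lambda>n. blinfun_apply (a n) v) sums blinfun_apply T v\<rbrakk> \<Longrightarrow> T \<in> dom.finite_propagation"
    and \<epsilon>: "\<epsilon> > 0"
  shows "\<exists>p\<in>\<P>. \<exists>q\<in>\<P>. \<exists>R\<ge>0. \<forall>t\<in>\<T>. norm t \<le> 1 \<longrightarrow>
    cod.approximable (\<phi> ((id_blinfun - q) o\<^sub>L t o\<^sub>L (id_blinfun - p))) \<epsilon> R"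
proof (rule ccontr)
  assume none: "\<not> ?thesis"
  have left: "(id_blinfun - q) o\<^sub>L t \<in> \<T>" if "t \<in> \<T>" "q \<in> \<P>" for t q
  proof -
    have "(id_blinfun - q) o\<^sub>L t = t - (q o\<^sub>L t)" by (rule blinfun_eqI) (simp add: blinfun.diff_left)
    then show ?thesis using \<T>(2)[OF that(1) \<T>(4)[OF that]] by simp
  qed
  have right: "t o\<^sub>L (id_blinfun - q) \<in> \<T>" if "t \<in> \<T>" "q \<in> \<P>" for t q
  proof -
    have "t o\<^sub>L (id_blinfun - q) = t - (t o\<^sub>L q)"
      by (rule blinfun_eqI) (simp add: blinfun.diff_left blinfun.diff_right)
    then show ?thesis using \<T>(2)[OF that(1) \<T>(3)[OF that]] by simp
  qed
  have step: "\<exists>p'\<in>\<P>. \<exists>q'\<in>\<P>. \<exists>t\<in>\<T>. norm t \<le> 1 \<and> p o\<^sub>L p' = p \<and> p' o\<^sub>L p = p \<and> q o\<^sub>L q' = q \<and> q' o\<^sub>L q = q \<and>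
      q' o\<^sub>L t o\<^sub>L p' = t o\<^sub>L p' \<and>
      \<not> cod.approximable (\<phi> ((id_blinfun - q) o\<^sub>L t o\<^sub>L (id_blinfun - p) o\<^sub>L p')) \<epsilon> (real n)"
    if p: "p \<in> \<P>" and q: "q \<in> \<P>" for p q n
  proof -
    obtain t where t: "t \<in> \<T>" "norm t \<le> 1"
      and far: "\<not> cod.approximable (\<phi> ((id_blinfun - q) o\<^sub>L t o\<^sub>L (id_blinfun - p))) \<epsilon> (real n)"
      using none p q of_nat_0_le_iff by blast
    define u where "u = (id_blinfun - q) o\<^sub>L t o\<^sub>L (id_blinfun - p)"
    have u: "u \<in> \<T>" unfolding u_def by (intro left right t p q)
    obtain G where G: "G \<noteq> bot" "\<forall>\<^sub>F p' in G. p' \<in> \<P> \<and> p o\<^sub>L p' = p \<and> p' o\<^sub>L p = p"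
      "\<And>v. ((\<lambda>p. blinfun_apply u (blinfun_apply p v)) \<longlongrightarrow> blinfun_apply u v) G"
      using above[OF p] u by blast
    \<comment> \<open>The support is cut down first: some \<open>p'\<close> leaves
      \<open>u p'\<close> bad, by the strong limit argument. Only then is \<open>q'\<close> chosen,
      large enough to absorb the range of \<open>t p'\<close>.\<close>
    have "\<exists>p'. p' \<in> \<P> \<and> p o\<^sub>L p' = p \<and> p' o\<^sub>L p = p \<and> \<not> cod.approximable (\<phi> (u o\<^sub>L p')) \<epsilon> (real n)"
    proof (rule ccontr)
      assume contra: "\<not> ?thesis"
      have "cod.approximable (\<phi> u) \<epsilon> (real n)"
      proof (rule approximable_phi_strong_limit[where a = "\<lambda>p'. u o\<^sub>L p'", OF G(1)])
        show "\<forall>\<^sub>F p' in G. u o\<^sub>L p' \<in> dom.finite_propagation"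
          using G(2) by eventually_elim (use \<T>(1,3) u in blast)
        show "u \<in> dom.finite_propagation" using u \<T>(1) by blast
        show "\<forall>\<^sub>F p' in G. norm (u o\<^sub>L p') \<le> norm u"
          using G(2)
        proof eventually_elim
          case (elim p')
          then show ?case
            using norm_blinfun_compose[of u p'] mult_left_mono[OF projection_norm_le[OF proj], of p' "norm u"] by simp
        qed
        show "((\<lambda>p'. blinfun_apply (u o\<^sub>L p') v) \<longlongrightarrow> blinfun_apply u v) G" for v
          using G(3) by simp
        show "\<forall>\<^sub>F p' in G. cod.approximable (\<phi> (u o\<^sub>L p')) \<epsilon> (real n)"
          using G(2) by eventually_elim (use contra in blast)
      qed
      then show False using far u_def by simp
    qed
    then obtain p' where p': "p' \<in> \<P>" "p o\<^sub>L p' = p" "p' o\<^sub>L p = p" "\<not> cod.approximable (\<phi> (u o\<^sub>L p')) \<epsilon> (real n)"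
      by blast
    obtain q' where q': "q' \<in> \<P>" "q o\<^sub>L q' = q" "q' o\<^sub>L q = q" "q' o\<^sub>L t o\<^sub>L p' = t o\<^sub>L p'"
      using range[OF t(1) p'(1) q] by blast
    show ?thesis
      using p' q' t unfolding u_def by blast
  qed
  obtain p0 where p0: "p0 \<in> \<P>" using ne by blast
  \<comment> \<open>The recursion starts from a triple, so some element of \<open>\<T>\<close> is
    needed; \<open>rel\<close> ignores the third component of its first argument.\<close>
  obtain t0 where t0: "t0 \<in> \<T>" using step[OF p0 p0] by blast
  define rel where "rel n x y \<longleftrightarrow> (case (x, y) of ((p, q, _), (p', q', t)) \<Rightarrow>
      norm t \<le> 1 \<and> p o\<^sub>L p' = p \<and> p' o\<^sub>L p = p \<and> q o\<^sub>L q' = q \<and> q' o\<^sub>L q = q \<and>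
      q' o\<^sub>L t o\<^sub>L p' = t o\<^sub>L p' \<and>
      \<not> cod.approximable (\<phi> ((id_blinfun - q) o\<^sub>L t o\<^sub>L (id_blinfun - p) o\<^sub>L p')) \<epsilon> (real n))"
    for n :: nat and x y :: "('h \<Rightarrow>\<^sub>L 'h) \<times> ('h \<Rightarrow>\<^sub>L 'h) \<times> ('h \<Rightarrow>\<^sub>L 'h)"
  have "\<exists>f. \<forall>n. f n \<in> \<P> \<times> \<P> \<times> \<T> \<and> rel n (f n) (f (Suc n))"
  proof (rule dependent_nat_choice)
    show "\<exists>x. x \<in> \<P> \<times> \<P> \<times> \<T>" using p0 t0 by blast
    fix x n assume "x \<in> \<P> \<times> \<P> \<times> \<T>"
    then obtain p q t where "x = (p, q, t)" "p \<in> \<P>" "q \<in> \<P>" by auto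
    then show "\<exists>y. y \<in> \<P> \<times> \<P> \<times> \<T> \<and> rel n x y"
      using step[of p q n] unfolding rel_def by auto
  qed
  then obtain f where f: "\<And>n. f n \<in> \<P> \<times> \<P> \<times> \<T>" "\<And>n. rel n (f n) (f (Suc n))" by blast
  \<comment> \<open>The operator chosen in passing from stage \<open>n\<close> to stage
    \<open>n + 1\<close> is stored in the latter, hence the \<open>Suc n\<close> in
    \<open>t\<close>.\<close>
  define p q t where "p n = fst (f n)" and "q n = fst (snd (f n))" and "t n = snd (snd (f (Suc n)))" for n
  have mem: "p n \<in> \<P>" "q n \<in> \<P>" "t n \<in> \<T>" for n
    using f(1)[of n] f(1)[of "Suc n"] by (auto simp: p_def q_def t_def mem_Times_iff)
  have r: "norm (t n) \<le> 1" "p n o\<^sub>L p (Suc n) = p n" "p (Suc n) o\<^sub>L p n = p n"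
    "q n o\<^sub>L q (Suc n) = q n" "q (Suc n) o\<^sub>L q n = q n" "q (Suc n) o\<^sub>L t n o\<^sub>L p (Suc n) = t n o\<^sub>L p (Suc n)"
    "\<not> cod.approximable (\<phi> ((id_blinfun - q n) o\<^sub>L t n o\<^sub>L (id_blinfun - p n) o\<^sub>L p (Suc n))) \<epsilon> (real n)" for n
    using f(2)[of n] by (auto simp: rel_def p_def q_def t_def split: prod.splits)
  define a where "a n = (id_blinfun - q n) o\<^sub>L t n o\<^sub>L (id_blinfun - p n) o\<^sub>L p (Suc n)" for n
  \<comment> \<open>Since \<open>q (Suc n)\<close> absorbs the range of \<open>t n\<close> on
    \<open>p (Suc n)\<close>, the cut by \<open>id_blinfun - q n\<close> is already a cut by an
    increment. This yields orthogonal ranges besides orthogonal supports.\<close>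
  have a_eq: "a n = (q (Suc n) - q n) o\<^sub>L t n o\<^sub>L (p (Suc n) - p n)" for n
  proof (rule blinfun_eqI)
    fix v
    have pp: "p n (p (Suc n) v) = p n v" "p (Suc n) (p n v) = p n v" for v
      using r(2,3)[of n] by (metis blinfun_apply_blinfun_compose)+
    have qt: "q (Suc n) (t n (p (Suc n) v)) = t n (p (Suc n) v)" for v
      using r(6)[of n] by (metis blinfun_apply_blinfun_compose)
    have qt': "q (Suc n) (t n (p n v)) = t n (p n v)"
      using qt[of "p n v"] by (simp add: pp)
    show "blinfun_apply (a n) v = blinfun_apply ((q (Suc n) - q n) o\<^sub>L t n o\<^sub>L (p (Suc n) - p n)) v"
      by (simp add: a_def blinfun.diff_left blinfun.diff_right pp qt qt')
  qed
  have a_mem: "a n \<in> \<T>" for n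
    unfolding a_def by (intro \<T>(3) left right mem)
  have projp: "is_projection (p (Suc n) - p n)" "is_projection (q (Suc n) - q n)" for n
    by (intro projection_chain_orthogonal proj mem r)+
  have orth: "(p (Suc m) - p m) o\<^sub>L (p (Suc n) - p n) = 0" "(q (Suc m) - q m) o\<^sub>L (q (Suc n) - q n) = 0"
    if "m \<noteq> n" for m n
    using that by (intro projection_chain_orthogonal(2) proj mem r; assumption)+
  have a_bdd: "a n \<in> bounded_operators" for n
    using a_mem \<T>(1) by (auto simp: dom.finite_propagation_def)
  have a_norm: "norm (a n) \<le> 1" for n
    unfolding a_eq by (intro norm_compose_le_one projection_norm_le projp r)
  have a_cut: "(q (Suc n) - q n) o\<^sub>L a n o\<^sub>L (p (Suc n) - p n) = a n" for n
    unfolding a_eq by (rule blinfun_eqI) (simp add: is_projection_idem[OF projp(1)] is_projection_idem[OF projp(2)])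
  have series: "\<exists>T. (\<forall>S. T S \<in> bounded_operators \<and> norm (T S) \<le> 1 \<and>
      (\<forall>v. (\<lambda>n. if n \<in> S then blinfun_apply (a n) v else 0) sums blinfun_apply (T S) v)) \<and>
    (\<forall>U v. (\<forall>n::nat. U n \<subseteq> {n..}) \<longrightarrow> (\<lambda>n. blinfun_apply (T (U n)) v) \<longlonglongrightarrow> 0)"
    by (rule orthogonal_series_operators[where t = a, OF projp(1) orth(1) projp(2) orth(2) a_bdd a_norm a_cut])
  obtain T where T': "\<forall>S. T S \<in> bounded_operators \<and> norm (T S) \<le> 1 \<and>
      (\<forall>v. (\<lambda>n. if n \<in> S then blinfun_apply (a n) v else 0) sums blinfun_apply (T S) v)"
    "\<forall>U v. (\<forall>n::nat. U n \<subseteq> {n..}) \<longrightarrow> (\<lambda>n. blinfun_apply (T (U n)) v) \<longlonglongrightarrow> 0"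
    using series by (elim exE conjE)
  have T: "\<And>S. T S \<in> bounded_operators" "\<And>S. norm (T S) \<le> 1"
    "\<And>S v. (\<lambda>n. if n \<in> S then blinfun_apply (a n) v else 0) sums blinfun_apply (T S) v"
    "\<And>U v. (\<And>n::nat. U n \<subseteq> {n..}) \<Longrightarrow> (\<lambda>n. blinfun_apply (T (U n)) v) \<longlonglongrightarrow> 0"
    using T' by simp_all
  have "\<exists>n. cod.approximable (\<phi> (T {n})) \<epsilon> (real n)"
  proof (rule approximable_in_sequence[OF _ _ T(2) T(4) \<epsilon>])
    fix S
    have "0 \<in> \<T>" using \<T>(2)[OF t0 t0] by simp
    then show "T S \<in> dom.finite_propagation"
      by (intro \<T>_sums[of "\<lambda>n. if n \<in> S then a n else 0"] T(1))
         (use T(3)[of S] a_mem in \<open>auto simp: if_distrib[of blinfun_apply] if_distribR cong: if_cong\<close>)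
  next
    fix S S' :: "nat set" assume dj: "S \<inter> S' = {}"
    show "T (S \<union> S') = T S + T S'"
    proof (rule blinfun_eqI)
      fix v
      have "(\<lambda>n. (if n \<in> S then a n v else 0) + (if n \<in> S' then a n v else 0)) sums (T S v + T S' v)"
        by (intro sums_add T(3))
      moreover have "(if n \<in> S then a n v else 0) + (if n \<in> S' then a n v else 0)
          = (if n \<in> S \<union> S' then a n v else 0)" for n using dj by auto
      ultimately show "blinfun_apply (T (S \<union> S')) v = blinfun_apply (T S + T S') v"
        using sums_unique2[OF T(3)[of "S \<union> S'" v]] by (simp add: blinfun.add_left)
    qed
  qed
  then obtain n where n: "cod.approximable (\<phi> (T {n})) \<epsilon> (real n)" by blast
  have "T {n} = a n"
  proof (rule blinfun_eqI)
    fix v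
    have "(\<lambda>k. if k \<in> {n} then a k v else 0) sums a n v"
      using sums_single[of n "\<lambda>k. a k v"] by simp
    then show "blinfun_apply (T {n}) v = blinfun_apply (a n) v" using sums_unique2 T(3) by blast
  qed
  then show False using n r(7)[of n] by (simp add: a_def)
qed

end


section \<open>Finite orthonormal sets\<close>

definition orthonormal :: "'a::complex_hilbert set \<Rightarrow> bool" where
  "orthonormal B \<longleftrightarrow> (\<forall>e\<in>B. \<forall>f\<in>B. cinner e f = (if e = f then 1 else 0))"

text \<open>The sum of the rank-one operators sending \<open>e\<close> to \<open>\<sigma> e\<close>.
  One formula covers orthogonal projections (\<open>\<sigma>\<close> the identity), partial
  isometries (\<open>\<sigma>\<close> injective into an orthonormal set) and compressions
  \<open>t p\<close> (\<open>\<sigma> = t\<close>), so one composition rule serves all.\<close>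

definition basis_change :: "'a::complex_hilbert set \<Rightarrow> ('a \<Rightarrow> 'a) \<Rightarrow> ('a \<Rightarrow>\<^sub>L 'a)" where
  "basis_change B \<sigma> = Blinfun (\<lambda>v. \<Sum>e\<in>B. cinner v e *\<^sub>C \<sigma> e)"

abbreviation onproj :: "'a::complex_hilbert set \<Rightarrow> ('a \<Rightarrow>\<^sub>L 'a)" where
  "onproj B \<equiv> basis_change B (\<lambda>e. e)"

lemma basis_change_apply: "blinfun_apply (basis_change B \<sigma>) v = (\<Sum>e\<in>B. cinner v e *\<^sub>C \<sigma> e)"
proof -
  have "bounded_linear (\<lambda>v. cinner v e *\<^sub>C \<sigma> e)" for e
  proof (rule bounded_linear_intro[where K = "norm e * norm (\<sigma> e)"])
    show "cinner (x + y) e *\<^sub>C \<sigma> e = cinner x e *\<^sub>C \<sigma> e + cinner y e *\<^sub>C \<sigma> e" for x y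
      by (simp add: cinner.add_left scaleC_add_left)
    show "cinner (r *\<^sub>R x) e *\<^sub>C \<sigma> e = r *\<^sub>R cinner x e *\<^sub>C \<sigma> e" for r x
      by (simp only: cinner.scaleR_left scaleR_conv_of_real scaleC_scaleC[symmetric] scaleC_of_real)
    show "norm (cinner x e *\<^sub>C \<sigma> e) \<le> norm x * (norm e * norm (\<sigma> e))" for x
      using mult_right_mono[OF cinner_cauchy_schwarz[of x e] norm_ge_zero[of "\<sigma> e"]]
      by (simp add: norm_scaleC mult.assoc)
  qed
  then show ?thesis
    unfolding basis_change_def by (subst bounded_linear_Blinfun_apply) (auto intro: bounded_linear_sum)
qed

lemma basis_change_bounded: "basis_change B \<sigma> \<in> bounded_operators"
  by (simp add: bounded_operators_def basis_change_apply cinner_scaleC_left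
      complex_vector.scale_sum_right scaleC_scaleC)

lemma basis_change_basis:
  assumes "finite B" "orthonormal B" "e \<in> B"
  shows "blinfun_apply (basis_change B \<sigma>) e = \<sigma> e"
proof -
  have "(\<Sum>f\<in>B. cinner e f *\<^sub>C \<sigma> f) = (\<Sum>f\<in>B. if e = f then \<sigma> f else 0)"
    using assms by (intro sum.cong) (auto simp: orthonormal_def scaleC_one)
  then show ?thesis using assms by (simp add: basis_change_apply)
qed

lemma bounded_operators_sum_apply:
  "t \<in> bounded_operators \<Longrightarrow> blinfun_apply t (\<Sum>e\<in>B. c e *\<^sub>C u e) = (\<Sum>e\<in>B. c e *\<^sub>C blinfun_apply t (u e))"
  by (simp add: blinfun.sum_right bounded_operatorsD)

lemma compose_basis_change:
  assumes t: "t \<in> bounded_operators" and eq: "\<And>e. e \<in> B \<Longrightarrow> blinfun_apply t (\<sigma> e) = \<tau> e"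
  shows "t o\<^sub>L basis_change B \<sigma> = basis_change B \<tau>"
proof (rule blinfun_eqI)
  fix v
  show "blinfun_apply (t o\<^sub>L basis_change B \<sigma>) v = blinfun_apply (basis_change B \<tau>) v"
    by (simp add: basis_change_apply bounded_operators_sum_apply[OF t] eq)
qed

lemma basis_change_compose_projection:
  assumes p: "is_projection p" and eq: "\<And>e. e \<in> B \<Longrightarrow> blinfun_apply p e = e"
  shows "basis_change B \<sigma> o\<^sub>L p = basis_change B \<sigma>"
  by (rule blinfun_eqI) (simp add: basis_change_apply is_projection_cinner[OF p] eq cong: sum.cong)

lemma basis_change_zero: "basis_change B (\<lambda>_. 0) = 0"
  by (rule blinfun_eqI) (simp add: basis_change_apply)

lemma is_projection_onproj:
  assumes "finite B" "orthonormal B"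
  shows "is_projection (onproj B)"
proof (rule is_projectionI)
  show "onproj B \<in> bounded_operators" by (rule basis_change_bounded)
  have "onproj B o\<^sub>L onproj B = onproj B"
    by (rule compose_basis_change) (use assms in \<open>simp_all add: basis_change_bounded basis_change_basis\<close>)
  then show "onproj B (onproj B v) = onproj B v" for v
    by (metis blinfun_apply_blinfun_compose)
  show "cinner (onproj B v) w = cinner v (onproj B w)" for v w
    by (simp add: basis_change_apply cinner.sum_left cinner.sum_right cinner_scaleC_left
        cinner_scaleC_right cinner_commute[of _ w] mult.commute)
qed

lemma onproj_mono:
  assumes "finite B'" "orthonormal B'" "B \<subseteq> B'"
  shows "onproj B o\<^sub>L onproj B' = onproj B" "onproj B' o\<^sub>L onproj B = onproj B"
  using assms by (auto intro!: basis_change_compose_projection compose_basis_change is_projection_onproj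
      basis_change_bounded basis_change_basis)

lemma norm_basis_change_le:
  assumes B: "finite B" "orthonormal B" and \<sigma>: "inj_on \<sigma> B" "orthonormal (\<sigma> ` B)"
  shows "norm (basis_change B \<sigma>) \<le> 1"
proof (rule norm_blinfun_bound)
  fix v
  \<comment> \<open>The norm does not see which orthonormal family \<open>B\<close> is sent to, so
    the bound is inherited from the projection \<open>onproj B\<close>.\<close>
  have sq: "(norm (basis_change B \<tau> v))\<^sup>2 = (\<Sum>e\<in>B. (norm (cinner v e))\<^sup>2)"
    if \<tau>: "inj_on \<tau> B" "orthonormal (\<tau> ` B)" for \<tau>
  proof -
    have one: "norm (\<tau> e) = 1" if "e \<in> B" for e
    proof -
      have "cinner (\<tau> e) (\<tau> e) = 1" using \<tau> that by (auto simp: orthonormal_def)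
      then have "complex_of_real ((norm (\<tau> e))\<^sup>2) = of_real 1" by (simp only: cinner_self of_real_1)
      then have "(norm (\<tau> e))\<^sup>2 = 1" by (simp only: of_real_eq_iff)
      then show ?thesis by (simp add: abs_square_eq_1)
    qed
    have "(norm (\<Sum>e\<in>B. cinner v e *\<^sub>C \<tau> e))\<^sup>2 = (\<Sum>e\<in>B. (norm (cinner v e *\<^sub>C \<tau> e))\<^sup>2)"
    proof (rule norm_sum_square_orthogonal[OF B(1)])
      fix e f assume "e \<in> B" "f \<in> B" "e \<noteq> f"
      then have "cinner (\<tau> e) (\<tau> f) = 0"
        using \<tau> by (auto simp: orthonormal_def inj_on_def)
      then show "cinner (cinner v e *\<^sub>C \<tau> e) (cinner v f *\<^sub>C \<tau> f) = 0"
        by (simp add: cinner_scaleC_left cinner_scaleC_right)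
    qed
    then show ?thesis by (simp add: basis_change_apply norm_scaleC one)
  qed
  have "(norm (basis_change B \<sigma> v))\<^sup>2 = (norm (onproj B v))\<^sup>2"
    using sq[OF \<sigma>] sq[of "\<lambda>e. e"] B by simp
  then show "norm (basis_change B \<sigma> v) \<le> 1 * norm v"
    using projection_norm_apply_le[OF is_projection_onproj[OF B]] by (simp add: power2_eq_iff_nonneg)
qed simp

text \<open>One Gram-Schmidt step. The normalised residue of \<open>v\<close> stays in the fixed
  space of \<open>p\<close> because \<open>p\<close> fixes \<open>v\<close> and every element of
  \<open>B\<close>.\<close>

lemma orthonormal_extend_vector:
  assumes B: "finite B" "orthonormal B" and v: "onproj B v \<noteq> v"
    and p: "p \<in> bounded_operators" "\<And>e. e \<in> B \<Longrightarrow> blinfun_apply p e = e" "blinfun_apply p v = v"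
  shows "\<exists>e. e \<notin> B \<and> orthonormal (insert e B) \<and> blinfun_apply p e = e \<and> onproj (insert e B) v = v"
proof -
  define w where "w = v - onproj B v"
  define e where "e = (1 / norm w) *\<^sub>R w"
  have w0: "norm w \<noteq> 0" using v by (simp add: w_def)
  have pr: "is_projection (onproj B)" by (rule is_projection_onproj[OF B])
  have "cinner w f = 0" if "f \<in> B" for f
    using that by (simp add: w_def cinner.diff_left is_projection_cinner[OF pr] basis_change_basis[OF B])
  then have orth: "cinner e f = 0" "cinner f e = 0" if "f \<in> B" for f
    using that cinner_commute[of f e] by (simp_all add: e_def cinner.scaleR_left)
  have "norm e = 1" using w0 by (simp add: e_def)
  then have ee: "cinner e e = 1" by (simp add: cinner_self)
  have notin: "e \<notin> B" using orth(1)[of e] ee by auto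
  have on: "orthonormal (insert e B)"
    using B(2) orth ee notin by (auto simp: orthonormal_def)
  have "p (onproj B v) = onproj B v"
    using compose_basis_change[OF p(1), of B "\<lambda>e. e" "\<lambda>e. e"] p(2) by (metis blinfun_apply_blinfun_compose)
  then have "p e = e" by (simp add: e_def w_def blinfun.scaleR_right blinfun.diff_right p(3))
  moreover have "onproj (insert e B) v = v"
  proof -
    have fin: "finite (insert e B)" using B by simp
    have "onproj (insert e B) (onproj B v) = onproj B v"
      using onproj_mono(2)[OF fin on] by (metis blinfun_apply_blinfun_compose subset_insertI)
    moreover have "onproj (insert e B) e = e" by (rule basis_change_basis[OF fin on]) simp
    moreover have "v = norm w *\<^sub>R e + onproj B v" using w0 by (simp add: e_def w_def)
    ultimately show ?thesis by (metis blinfun.add_right blinfun.scaleR_right)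
  qed
  ultimately show ?thesis using notin on by blast
qed

lemma orthonormal_extend:
  assumes V: "finite V" and B: "finite B" "orthonormal B"
    and p: "p \<in> bounded_operators" "\<And>e. e \<in> B \<Longrightarrow> blinfun_apply p e = e" "\<And>v. v \<in> V \<Longrightarrow> blinfun_apply p v = v"
  shows "\<exists>B'. B \<subseteq> B' \<and> finite B' \<and> orthonormal B' \<and> (\<forall>e\<in>B'. blinfun_apply p e = e) \<and> (\<forall>v\<in>V. onproj B' v = v)"
  using V p(3)
proof (induction V rule: finite_induct)
  case empty
  show ?case using B p by blast
next
  case (insert v V)
  obtain B' where B': "B \<subseteq> B'" "finite B'" "orthonormal B'" "\<forall>e\<in>B'. p e = e" "\<forall>v\<in>V. onproj B' v = v"
    using insert.IH insert.prems by blast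
  show ?case
  proof (cases "onproj B' v = v")
    case True
    then show ?thesis using B' by (intro exI[of _ B']) auto
  next
    case False
    obtain e where e: "e \<notin> B'" "orthonormal (insert e B')" "p e = e" "onproj (insert e B') v = v"
      using orthonormal_extend_vector[OF B'(2,3) False p(1)] B'(4) insert.prems by auto
    have "onproj (insert e B') u = u" if "u \<in> V" for u
      using B'(2,5) that onproj_mono(2)[OF _ e(2), of B'] by (metis blinfun_apply_blinfun_compose finite_insert subset_insertI)
    then show ?thesis using B' e by (intro exI[of _ "insert e B'"]) auto
  qed
qed

text \<open>No finite span contains the range of \<open>p\<close>, so the Gram-Schmidt process
  inside that range never stops.\<close>

lemma orthonormal_extend_card:
  assumes p: "is_projection p" "infinite_rank p" and B: "finite B" "orthonormal B" "\<And>e. e \<in> B \<Longrightarrow> blinfun_apply p e = e"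
  shows "\<exists>B'. finite B' \<and> card B' = n \<and> B \<inter> B' = {} \<and> orthonormal (B \<union> B') \<and> (\<forall>e\<in>B'. blinfun_apply p e = e)"
proof (induction n)
  case 0
  show ?case using B by (intro exI[of _ "{}"]) auto
next
  case (Suc n)
  then obtain B' where B': "finite B'" "card B' = n" "B \<inter> B' = {}" "orthonormal (B \<union> B')" "\<forall>e\<in>B'. p e = e"
    by blast
  have fin: "finite (B \<union> B')" using B B' by simp
  obtain v where v: "onproj (B \<union> B') (p v) \<noteq> p v"
  proof (rule ccontr)
    assume "\<not> thesis"
    then have "p v = onproj (B \<union> B') (p v)" for v using that by metis
    then have "p v \<in> complex_vector.span (B \<union> B')" for v
      by (metis (no_types, lifting) basis_change_apply complex_vector.span_base complex_vector.span_scale complex_vector.span_sum)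
    then show False using p(2) fin unfolding infinite_rank_def by blast
  qed
  obtain e where "e \<notin> B \<union> B'" "orthonormal (insert e (B \<union> B'))" "p e = e"
    using orthonormal_extend_vector[OF fin B'(4) v is_projection_bounded[OF p(1)]] B(3) B'(5)
      is_projection_idem[OF p(1)] by blast
  then show ?case using B' by (intro exI[of _ "insert e B'"]) auto
qed

text \<open>A partial isometry \<open>x\<close> with adjoint \<open>y\<close> moving the span of \<open>B\<close> to a subspace orthogonal to it.\<close>

lemma finite_rank_shift:
  assumes p: "is_projection p" "infinite_rank p" and B: "finite B" "orthonormal B" "\<And>e. e \<in> B \<Longrightarrow> blinfun_apply p e = e"
  shows "\<exists>x\<in>bounded_operators. \<exists>y\<in>bounded_operators. norm x \<le> 1 \<and> norm y \<le> 1 \<and>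
    y o\<^sub>L x = onproj B \<and> onproj B o\<^sub>L x = 0 \<and> y o\<^sub>L onproj B = 0 \<and>
    p o\<^sub>L x = x \<and> x o\<^sub>L p = x \<and> p o\<^sub>L y = y \<and> y o\<^sub>L p = y"
proof -
  obtain B' where B': "finite B'" "card B' = card B" "B \<inter> B' = {}" "orthonormal (B \<union> B')" "\<forall>e\<in>B'. p e = e"
    using orthonormal_extend_card[OF p B] by blast
  have on': "orthonormal B'" using B'(4) by (simp add: orthonormal_def)
  obtain \<sigma> where \<sigma>: "bij_betw \<sigma> B B'"
    using finite_same_card_bij[OF B(1) B'(1)] B'(2) by auto
  define \<tau> where "\<tau> = the_inv_into B \<sigma>"
  have \<tau>: "bij_betw \<tau> B' B" "\<And>e. e \<in> B \<Longrightarrow> \<tau> (\<sigma> e) = e"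
    using \<sigma> bij_betw_the_inv_into[OF \<sigma>] by (auto simp: \<tau>_def bij_betw_def the_inv_into_f_f)
  have mem: "\<sigma> e \<in> B'" if "e \<in> B" for e using \<sigma> that by (auto simp: bij_betw_def)
  have mem': "\<tau> e \<in> B" if "e \<in> B'" for e using \<tau>(1) that by (auto simp: bij_betw_def)
  have cross: "cinner e f = 0" "cinner f e = 0" if "e \<in> B" "f \<in> B'" for e f
    using B'(3,4) that by (auto simp: orthonormal_def)
  have kill: "basis_change B \<rho> f = 0" if "f \<in> B'" for f \<rho>
    using that by (simp add: basis_change_apply cross)
  have kill': "basis_change B' \<rho> e = 0" if "e \<in> B" for e \<rho>
    using that by (simp add: basis_change_apply cross)
  have pb: "p \<in> bounded_operators" by (rule is_projection_bounded[OF p(1)])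
  show ?thesis
  proof (rule bexI[of _ "basis_change B \<sigma>"], rule bexI[of _ "basis_change B' \<tau>"], intro conjI)
    show "norm (basis_change B \<sigma>) \<le> 1" "norm (basis_change B' \<tau>) \<le> 1"
      using \<sigma> \<tau>(1) B B' on' by (auto intro!: norm_basis_change_le simp: bij_betw_def)
    show "basis_change B' \<tau> o\<^sub>L basis_change B \<sigma> = onproj B"
      by (rule compose_basis_change) (simp_all add: basis_change_bounded basis_change_basis[OF B'(1) on'] mem \<tau>(2))
    show "onproj B o\<^sub>L basis_change B \<sigma> = 0"
      unfolding basis_change_zero[of B, symmetric]
      by (rule compose_basis_change) (simp_all add: basis_change_bounded kill mem)
    show "basis_change B' \<tau> o\<^sub>L onproj B = 0"
      unfolding basis_change_zero[of B, symmetric]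
      by (rule compose_basis_change) (simp_all add: basis_change_bounded kill')
    show "p o\<^sub>L basis_change B \<sigma> = basis_change B \<sigma>" "p o\<^sub>L basis_change B' \<tau> = basis_change B' \<tau>"
      using B' B(3) mem mem' by (auto intro!: compose_basis_change pb)
    show "basis_change B \<sigma> o\<^sub>L p = basis_change B \<sigma>" "basis_change B' \<tau> o\<^sub>L p = basis_change B' \<tau>"
      using B' B(3) by (auto intro!: basis_change_compose_projection p(1))
  qed (rule basis_change_bounded)+
qed


section \<open>Operators supported on one bounded set\<close>

context geometric_module
begin

text \<open>Two sets farther apart than \<open>D\<close> cannot both meet \<open>A\<close>.\<close>

lemma propagation_le_diameter:
  assumes A: "A \<in> \<AA>" "diameter_le d A D" and t: "E A o\<^sub>L t o\<^sub>L E A = t"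
  shows "propagation_le d \<AA> E t D"
proof (rule propagation_leI)
  fix A1 A2 v assume m: "A1 \<in> \<AA>" "A2 \<in> \<AA>" and far: "\<And>a a'. \<lbrakk>a \<in> A1; a' \<in> A2\<rbrakk> \<Longrightarrow> ennreal D < d a' a"
  have "A1 \<inter> A = {} \<or> A2 \<inter> A = {}"
    using far A(2) unfolding diameter_le_def by (meson disjoint_iff leD)
  moreover have "E A2 (t (E A1 v)) = E (A2 \<inter> A) (t (E (A \<inter> A1) v))"
  proof -
    have "t u = E A (t (E A u))" for u using t by (metis blinfun_apply_blinfun_compose)
    then have "E A2 (t (E A1 v)) = E A2 (E A (t (E A (E A1 v))))" by metis
    then show ?thesis using A m by (simp add: E_apply_Int)
  qed
  ultimately show "E A2 (t (E A1 v)) = 0"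
    by (auto simp: E_empty Int_commute)
qed

end

context strongly_continuous_homomorphism
begin

text \<open>On a bounded set propagation is automatic, so strong limits of operators supported there
  are always in the domain of \<open>\<phi>\<close>. The corner argument thus works with finite-rank
  projections below \<open>E A\<close>, and the infinite rank of \<open>E A\<close> gives the room
  to shift what remains.\<close>

lemma approximable_bounded_infinite_rank:
  assumes A: "A \<in> \<AA>" "diameter_le dX A D" "D \<ge> 0" and rank: "infinite_rank (E A)"
    and disc: "discrete_module Y dY \<BB> F" and \<epsilon>: "\<epsilon> > 0"
  shows "\<exists>R\<ge>0. \<forall>t\<in>bounded_operators. E A o\<^sub>L t o\<^sub>L E A = t \<longrightarrow> norm t \<le> 1 \<longrightarrow>
    cod.approximable (\<phi> t) \<epsilon> R"
proof -
  define \<T> where "\<T> = {t \<in> bounded_operators. E A o\<^sub>L t = t \<and> t o\<^sub>L E A = t}"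
  define \<P> where "\<P> = {onproj B | B. finite B \<and> orthonormal B \<and> (\<forall>e\<in>B. E A e = e)}"
  have EA: "is_projection (E A)" "E A \<in> bounded_operators"
    using A by (auto intro: dom.E_projection dom.E_bounded)
  have assoc: "(r o\<^sub>L s) o\<^sub>L t = r o\<^sub>L (s o\<^sub>L t)" for r s t :: "'h \<Rightarrow>\<^sub>L 'h"
    by (rule blinfun_eqI) simp
  have EEA: "E A o\<^sub>L E A = E A" using EA(1) by (simp add: is_projection_def)
  have \<T>_iff: "t \<in> \<T>" if "t \<in> bounded_operators" "E A o\<^sub>L t o\<^sub>L E A = t" for t
  proof -
    have "E A o\<^sub>L t = t" "t o\<^sub>L E A = t"
      using that(2) EEA by (metis assoc)+
    then show ?thesis using that(1) by (simp add: \<T>_def)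
  qed
  have \<T>_fp: "t \<in> dom.finite_propagation" if "t \<in> \<T>" for t
    using that by (intro dom.finite_propagationI[of _ D] dom.propagation_le_diameter[OF A(1,2)] A(3))
      (auto simp: \<T>_def)
  have \<T>_compose: "s o\<^sub>L t \<in> \<T>" if "s \<in> \<T>" "t \<in> \<T>" for s t
    using that unfolding \<T>_def by (auto simp: bounded_operators_compose assoc[symmetric]) (simp add: assoc)
  have \<T>_diff: "s - t \<in> \<T>" if "s \<in> \<T>" "t \<in> \<T>" for s t
  proof -
    have "E A o\<^sub>L (s - t) = (E A o\<^sub>L s) - (E A o\<^sub>L t)" "(s - t) o\<^sub>L E A = (s o\<^sub>L E A) - (t o\<^sub>L E A)"
      by (rule blinfun_eqI, simp add: blinfun.diff_left blinfun.diff_right)+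
    then show ?thesis using that unfolding \<T>_def by (auto simp: bounded_operators_diff)
  qed
  have \<P>_proj: "is_projection p" if "p \<in> \<P>" for p
    using that by (auto simp: \<P>_def is_projection_onproj)
  have \<P>_\<T>: "p \<in> \<T>" if "p \<in> \<P>" for p
    using that EA unfolding \<P>_def \<T>_def
    by (auto intro!: basis_change_bounded compose_basis_change basis_change_compose_projection)
  have extend: "\<exists>B'. B \<subseteq> B' \<and> finite B' \<and> orthonormal B' \<and> (\<forall>e\<in>B'. E A e = e) \<and> (\<forall>v\<in>V. onproj B' v = v)"
    if "finite V" "finite B" "orthonormal B" "\<forall>e\<in>B. E A e = e" "\<forall>v\<in>V. E A v = v" for V B
    using that EA by (intro orthonormal_extend) auto
  have corner: "\<exists>p\<in>\<P>. \<exists>q\<in>\<P>. \<exists>R\<ge>0. \<forall>t\<in>\<T>. norm t \<le> 1 \<longrightarrow>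
    cod.approximable (\<phi> ((id_blinfun - q) o\<^sub>L t o\<^sub>L (id_blinfun - p))) \<delta> R" if \<delta>: "\<delta> > 0" for \<delta>
  proof (rule approximable_corner[OF \<P>_proj])
    have "onproj {} \<in> \<P>" unfolding \<P>_def by (intro CollectI exI[of _ "{}"]) (simp add: orthonormal_def)
    then show "\<P> \<noteq> {}" by blast
  next
    fix p0 assume "p0 \<in> \<P>"
    then obtain B where B: "p0 = onproj B" "finite B" "orthonormal B" "\<forall>e\<in>B. E A e = e"
      by (auto simp: \<P>_def)
    define good where "good V B' \<longleftrightarrow> B \<subseteq> B' \<and> finite B' \<and> orthonormal B' \<and> (\<forall>e\<in>B'. E A e = e) \<and>
        (\<forall>v\<in>E A ` V. onproj B' v = v)" for V B'
    \<comment> \<open>The choice need not be monotone in \<open>V\<close>: once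
      \<open>v \<in> V\<close>, the projection fixes \<open>E A v\<close>, and
      \<open>t (onproj (b V) v) = t v\<close> holds exactly.\<close>
    define b where "b V = (SOME B'. good V B')" for V
    have "\<exists>B'. good V B'" if "finite V" for V
      unfolding good_def using that is_projection_idem[OF EA(1)]
      by (intro extend[OF _ B(2,3,4)]) auto
    then have "good V (b V)" if "finite V" for V
      unfolding b_def using that by (metis someI_ex)
    then have b: "B \<subseteq> b V \<and> finite (b V) \<and> orthonormal (b V) \<and> (\<forall>e\<in>b V. E A e = e) \<and>
        (\<forall>v\<in>E A ` V. onproj (b V) v = v)" if "finite V" for V
      using that unfolding good_def by blast
    define G where "G = filtermap (\<lambda>V. onproj (b V)) (finite_subsets_at_top (UNIV :: 'h set))"
    have ev: "\<forall>\<^sub>F V in finite_subsets_at_top UNIV. finite V \<and> v \<in> V" for v :: 'h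
      unfolding eventually_finite_subsets_at_top by (intro exI[of _ "{v}"]) auto
    show "\<exists>G. G \<noteq> bot \<and> (\<forall>\<^sub>F p in G. p \<in> \<P> \<and> p0 o\<^sub>L p = p0 \<and> p o\<^sub>L p0 = p0) \<and>
        (\<forall>t\<in>\<T>. \<forall>v. ((\<lambda>p. blinfun_apply t (blinfun_apply p v)) \<longlongrightarrow> blinfun_apply t v) G)"
    proof (intro exI[of _ G] conjI ballI allI)
      show "G \<noteq> bot" by (simp add: G_def filtermap_bot_iff)
      show "\<forall>\<^sub>F p in G. p \<in> \<P> \<and> p0 o\<^sub>L p = p0 \<and> p o\<^sub>L p0 = p0"
        unfolding G_def eventually_filtermap using ev[of 0]
      proof eventually_elim
        case (elim V)
        then have "onproj (b V) \<in> \<P>" using b[of V] unfolding \<P>_def by blast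
        then show ?case using b[of V] elim unfolding B(1) by (auto intro!: onproj_mono)
      qed
      fix t v assume t: "t \<in> \<T>"
      show "((\<lambda>p. blinfun_apply t (blinfun_apply p v)) \<longlongrightarrow> blinfun_apply t v) G"
        unfolding G_def filterlim_filtermap
      proof (rule tendsto_eventually)
        show "\<forall>\<^sub>F V in finite_subsets_at_top UNIV. t (onproj (b V) v) = t v"
          using ev[of v]
        proof eventually_elim
          case (elim V)
          have "onproj (b V) (E A v) = E A v" using b[of V] elim by blast
          moreover have "onproj (b V) (E A v) = onproj (b V) v"
            using basis_change_compose_projection[OF EA(1), of "b V"] b[of V] elim
            by (metis blinfun_apply_blinfun_compose)
          moreover have "t (E A v) = t v" using t unfolding \<T>_def by (metis (mono_tags, lifting) blinfun_apply_blinfun_compose mem_Collect_eq)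
          ultimately show ?case by simp
        qed
      qed
    qed
  next
    fix t p q0 assume t: "t \<in> \<T>" and "p \<in> \<P>" "q0 \<in> \<P>"
    then obtain B B0 where B: "p = onproj B" "finite B" "orthonormal B" "\<forall>e\<in>B. E A e = e"
      and B0: "q0 = onproj B0" "finite B0" "orthonormal B0" "\<forall>e\<in>B0. E A e = e"
      by (auto simp: \<P>_def)
    have "E A (t v) = t v" for v
      using t unfolding \<T>_def by (metis (mono_tags, lifting) blinfun_apply_blinfun_compose mem_Collect_eq)
    then obtain B' where B': "B0 \<subseteq> B'" "finite B'" "orthonormal B'" "\<forall>e\<in>B'. E A e = e" "\<forall>v\<in>t ` B. onproj B' v = v"
      using extend[of "t ` B" B0] B(2) B0(2-4) by auto
    have tb: "t \<in> bounded_operators" using t by (simp add: \<T>_def)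
    have "t o\<^sub>L p = basis_change B t" unfolding B(1) by (rule compose_basis_change[OF tb]) simp
    moreover have "onproj B' o\<^sub>L basis_change B t = basis_change B t"
      using B'(5) by (intro compose_basis_change basis_change_bounded) auto
    ultimately have "onproj B' o\<^sub>L t o\<^sub>L p = t o\<^sub>L p" by (simp add: assoc)
    moreover have "onproj B' \<in> \<P>" unfolding \<P>_def using B' by blast
    ultimately show "\<exists>q\<in>\<P>. q0 o\<^sub>L q = q0 \<and> q o\<^sub>L q0 = q0 \<and> q o\<^sub>L t o\<^sub>L p = t o\<^sub>L p"
      using onproj_mono[OF B'(2,3,1)] B0(1) by (intro bexI[of _ "onproj B'"]) auto
  next
    fix a :: "nat \<Rightarrow> 'h \<Rightarrow>\<^sub>L 'h" and T :: "'h \<Rightarrow>\<^sub>L 'h"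
    assume a: "\<And>n. a n \<in> \<T>" and T: "T \<in> bounded_operators"
      and sums: "\<And>v. (\<lambda>n. a n v) sums T v"
    have ae: "E A (a n v) = a n v" "a n (E A v) = a n v" for n v
      using a[of n] unfolding \<T>_def by (metis (mono_tags, lifting) blinfun_apply_blinfun_compose mem_Collect_eq)+
    have "E A o\<^sub>L T o\<^sub>L E A = T"
    proof (rule blinfun_eqI)
      fix v
      have "(\<lambda>n. E A (a n (E A v))) sums E A (T (E A v))"
        by (rule bounded_linear.sums[OF blinfun.bounded_linear_right sums])
      then show "blinfun_apply (E A o\<^sub>L T o\<^sub>L E A) v = blinfun_apply T v"
        using sums[of v] sums_unique2 by (simp add: ae) blast
    qed
    then show "T \<in> dom.finite_propagation" using \<T>_fp \<T>_iff[OF T] by blast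
  qed (use \<delta> \<T>_fp \<T>_diff \<T>_compose \<P>_\<T> in auto)

  obtain M0 where M0: "\<And>t. t \<in> dom.finite_propagation \<Longrightarrow> norm (\<phi> t) \<le> M0 * norm t"
    using phi_bounded by blast
  define M where "M = max M0 1"
  have M: "M \<ge> 1" by (simp add: M_def)
  have phi_M: "norm (\<phi> t) \<le> M" if "t \<in> \<T>" "norm t \<le> 1" for t
  proof -
    have "norm (\<phi> t) \<le> M0 * norm t" using M0 \<T>_fp that by blast
    also have "\<dots> \<le> M * 1" using that M by (intro mult_mono) (auto simp: M_def)
    finally show ?thesis by simp
  qed
  obtain c where c: "c \<ge> 0" and comp: "\<And>a b \<epsilon> \<delta> R R'. \<lbrakk>cod.approximable a \<delta> R; cod.approximable b \<epsilon> R';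
      norm a \<le> M; norm b \<le> M; R \<ge> 0; R' \<ge> 0\<rbrakk> \<Longrightarrow>
      cod.approximable (a o\<^sub>L b) (\<delta> * M + (M + \<delta>) * \<epsilon>) (R + R' + c)"
    by (rule cod.approximable_compose[OF disc]) blast
  \<comment> \<open>Chosen so that the final error is at most \<open>\<delta> * C\<close>: there
    \<open>\<eta> \<le> \<delta> * (2 + 2 * M)\<close>, and the total is
    \<open>\<eta> * (1 + M) + \<delta> * M + \<eta> * \<delta>\<close> with
    \<open>\<delta> \<le> 1\<close>.\<close>
  define C where "C = (2 + 2 * M) * (1 + M) + 3 * M + 2"
  define \<delta> where "\<delta> = min 1 (\<epsilon> / C)"
  have C: "C > 0" using M by (simp add: C_def add_pos_nonneg)
  have \<delta>: "\<delta> > 0" "\<delta> \<le> 1" "\<delta> * C \<le> \<epsilon>"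
    using \<epsilon> C by (auto simp: \<delta>_def min_def field_simps)
  obtain p q R where pq: "p \<in> \<P>" "q \<in> \<P>" and R: "R \<ge> 0"
    and corner': "\<And>t. \<lbrakk>t \<in> \<T>; norm t \<le> 1\<rbrakk> \<Longrightarrow>
      cod.approximable (\<phi> ((id_blinfun - q) o\<^sub>L t o\<^sub>L (id_blinfun - p))) \<delta> R"
    using corner[OF \<delta>(1)] by blast
  have shift: "\<exists>x\<in>\<T>. \<exists>y\<in>\<T>. norm x \<le> 1 \<and> norm y \<le> 1 \<and> y o\<^sub>L x = p' \<and> p' o\<^sub>L x = 0 \<and> y o\<^sub>L p' = 0"
    if p': "p' \<in> \<P>" for p'
  proof -
    obtain B where B: "p' = onproj B" "finite B" "orthonormal B" "\<forall>e\<in>B. E A e = e"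
      using p' by (auto simp: \<P>_def)
    obtain x y where "x \<in> bounded_operators" "y \<in> bounded_operators" "norm x \<le> 1" "norm y \<le> 1"
      "y o\<^sub>L x = onproj B" "onproj B o\<^sub>L x = 0" "y o\<^sub>L onproj B = 0"
      "E A o\<^sub>L x = x" "x o\<^sub>L E A = x" "E A o\<^sub>L y = y" "y o\<^sub>L E A = y"
      using finite_rank_shift[OF EA(1) rank B(2,3)] B(4) by blast
    then show ?thesis unfolding B(1) \<T>_def by blast
  qed
  have cut: "(id_blinfun - q) o\<^sub>L t \<in> \<T>" "t o\<^sub>L (id_blinfun - p) \<in> \<T>"
    "norm ((id_blinfun - q) o\<^sub>L t) \<le> 1" "norm (t o\<^sub>L (id_blinfun - p)) \<le> 1"
    if "t \<in> \<T>" "norm t \<le> 1" for t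
  proof -
    have "(id_blinfun - q) o\<^sub>L t = t - (q o\<^sub>L t)" "t o\<^sub>L (id_blinfun - p) = t - (t o\<^sub>L p)"
      by (rule blinfun_eqI, simp add: blinfun.diff_left blinfun.diff_right)+
    then show "(id_blinfun - q) o\<^sub>L t \<in> \<T>" "t o\<^sub>L (id_blinfun - p) \<in> \<T>"
      using \<T>_diff \<T>_compose \<P>_\<T> pq that by simp_all
    show "norm ((id_blinfun - q) o\<^sub>L t) \<le> 1" "norm (t o\<^sub>L (id_blinfun - p)) \<le> 1"
      by (intro norm_compose_le_one that projection_norm_le projection_compl \<P>_proj pq)+
  qed
  obtain x y where xy: "x \<in> \<T>" "y \<in> \<T>" "norm x \<le> 1" "norm y \<le> 1" "y o\<^sub>L x = q" "q o\<^sub>L x = 0" "y o\<^sub>L q = 0"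
    using shift[OF pq(2)] by blast
  obtain x' y' where xy': "x' \<in> \<T>" "y' \<in> \<T>" "norm x' \<le> 1" "norm y' \<le> 1" "y' o\<^sub>L x' = p" "p o\<^sub>L x' = 0" "y' o\<^sub>L p = 0"
    using shift[OF pq(1)] by blast
  obtain R1 where R1: "R1 \<ge> 0" "cod.approximable (\<phi> y) \<delta> R1"
    using approximable_phi[OF \<T>_fp[OF xy(2)] \<delta>(1)] by blast
  obtain R2 where R2: "R2 \<ge> 0" "cod.approximable (\<phi> x') \<delta> R2"
    using approximable_phi[OF \<T>_fp[OF xy'(1)] \<delta>(1)] by blast
  \<comment> \<open>Error after removing the cut on the left: \<open>\<delta>\<close> for the corner
    plus the product error for \<open>\<phi> y\<close> and \<open>\<phi> u\<close>.\<close>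
  define \<eta> where "\<eta> = \<delta> + (\<delta> * M + (M + \<delta>) * \<delta>)"
  define R3 where "R3 = max R (R1 + R + c)"
  have R3: "R3 \<ge> 0" using R by (simp add: R3_def)
  \<comment> \<open>As \<open>y q = 0\<close> and \<open>y x = q\<close>, the missing part
    \<open>q t (1 - p)\<close> equals \<open>y u\<close>. Here \<open>u\<close> is a corner of
    \<open>x t\<close>, covered by \<open>corner'\<close>, while \<open>y\<close> is fixed.\<close>
  have right: "cod.approximable (\<phi> (t o\<^sub>L (id_blinfun - p))) \<eta> R3" if t: "t \<in> \<T>" "norm t \<le> 1" for t
  proof -
    define u where "u = (id_blinfun - q) o\<^sub>L (x o\<^sub>L t) o\<^sub>L (id_blinfun - p)"
    have xt: "x o\<^sub>L t \<in> \<T>" "norm (x o\<^sub>L t) \<le> 1"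
      using t xy by (auto intro: \<T>_compose norm_compose_le_one)
    have u: "u \<in> \<T>" "norm u \<le> 1" unfolding u_def by (intro cut xt)+
    define w where "w = (id_blinfun - q) o\<^sub>L t o\<^sub>L (id_blinfun - p)"
    have w: "w \<in> \<T>" unfolding w_def by (intro cut t)
    have yq: "y (q v) = 0" for v using xy(7) by (metis blinfun_apply_blinfun_compose zero_blinfun.rep_eq)
    have yx: "y (x v) = q v" for v using xy(5) by (metis blinfun_apply_blinfun_compose)
    have "t o\<^sub>L (id_blinfun - p) = w + (y o\<^sub>L u)"
      by (rule blinfun_eqI) (simp add: w_def u_def blinfun.diff_left blinfun.diff_right blinfun.add_left yq yx)
    then have eq: "\<phi> (t o\<^sub>L (id_blinfun - p)) = \<phi> w + (\<phi> y o\<^sub>L \<phi> u)"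
      using w u xy(2) \<T>_compose \<T>_fp by (simp add: phi_add phi_compose)
    have "cod.approximable (\<phi> y o\<^sub>L \<phi> u) (\<delta> * M + (M + \<delta>) * \<delta>) (R1 + R + c)"
      using corner'[OF xt] R1 R xy u by (intro comp phi_M) (auto simp: u_def)
    then show ?thesis unfolding eq \<eta>_def R3_def
      using corner'[OF t] by (intro cod.approximable_add) (auto simp: w_def)
  qed
  define R4 where "R4 = max R3 (R3 + R2 + c)"
  \<comment> \<open>Mirror image on the right: \<open>p x' = 0\<close> and \<open>y' x' = p\<close>
    give \<open>t p = u x'\<close>, where \<open>u\<close> is covered by \<open>right\<close>
    applied to \<open>t y'\<close>.\<close>
  have "cod.approximable (\<phi> t) \<epsilon> R4" if t: "t \<in> \<T>" "norm t \<le> 1" for t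
  proof -
    define u where "u = (t o\<^sub>L y') o\<^sub>L (id_blinfun - p)"
    have ty: "t o\<^sub>L y' \<in> \<T>" "norm (t o\<^sub>L y') \<le> 1"
      using t xy' by (auto intro: \<T>_compose norm_compose_le_one)
    have u: "u \<in> \<T>" "norm u \<le> 1" unfolding u_def by (intro cut ty)+
    have px: "p (x' v) = 0" for v using xy'(6) by (metis blinfun_apply_blinfun_compose zero_blinfun.rep_eq)
    have yx: "y' (x' v) = p v" for v using xy'(5) by (metis blinfun_apply_blinfun_compose)
    have "t = (t o\<^sub>L (id_blinfun - p)) + (u o\<^sub>L x')"
      by (rule blinfun_eqI) (simp add: u_def blinfun.diff_left blinfun.diff_right blinfun.add_left px yx)
    then have eq: "\<phi> t = \<phi> (t o\<^sub>L (id_blinfun - p)) + (\<phi> u o\<^sub>L \<phi> x')"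
      using cut(2)[OF t] u xy'(1) \<T>_compose \<T>_fp by (metis phi_add phi_compose)
    have "cod.approximable (\<phi> u o\<^sub>L \<phi> x') (\<eta> * M + (M + \<eta>) * \<delta>) (R3 + R2 + c)"
      using right[OF ty] R2 R3 xy' u by (intro comp phi_M) (auto simp: u_def)
    then have "cod.approximable (\<phi> t) (\<eta> + (\<eta> * M + (M + \<eta>) * \<delta>)) R4" unfolding eq R4_def
      using right[OF t] by (intro cod.approximable_add) auto
    moreover have "\<eta> + (\<eta> * M + (M + \<eta>) * \<delta>) \<le> \<epsilon>"
    proof -
      have \<eta>: "\<eta> = \<delta> * (1 + 2 * M + \<delta>)" by (simp add: \<eta>_def algebra_simps)
      also have "\<dots> \<le> \<delta> * (2 + 2 * M)" using \<delta> by (intro mult_left_mono) auto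
      finally have \<eta>_le: "\<eta> \<le> \<delta> * (2 + 2 * M)" .
      have "\<eta> \<ge> 0" using \<delta> M unfolding \<eta> by simp
      have "\<eta> + (\<eta> * M + (M + \<eta>) * \<delta>) = \<eta> * (1 + M) + \<delta> * M + \<eta> * \<delta>" by (simp add: algebra_simps)
      also have "\<dots> \<le> (\<delta> * (2 + 2 * M)) * (1 + M) + \<delta> * M + (\<delta> * (2 + 2 * M)) * 1"
        using \<eta>_le \<delta> M \<open>\<eta> \<ge> 0\<close> by (intro add_mono mult_mono) auto
      also have "\<dots> = \<delta> * C" by (simp add: C_def algebra_simps)
      finally show ?thesis using \<delta>(3) by simp
    qed
    ultimately show ?thesis by (auto elim: cod.approximable_mono)
  qed
  moreover have "R4 \<ge> 0" using R3 by (simp add: R4_def)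
  ultimately show ?thesis using \<T>_iff by blast
qed

end


section \<open>Finite unions of bounded sets\<close>

context geometric_module
begin

text \<open>With infinite distances allowed, a union of two bounded sets may be unbounded, so
  bounded sets are not directed; their finite unions are.\<close>

definition finitely_bounded :: "'x set set" where
  "finitely_bounded = {\<Union>\<C> | \<C>. finite \<C> \<and> (\<forall>A\<in>\<C>. A \<in> \<AA> \<and> (\<exists>D\<ge>0. diameter_le d A D))}"

lemma finitely_bounded_measurable: "C \<in> finitely_bounded \<Longrightarrow> C \<in> \<AA>"
  unfolding finitely_bounded_def by (auto intro: finite_Union)

lemma finitely_bounded_Un:
  assumes "C \<in> finitely_bounded" "C' \<in> finitely_bounded"
  shows "C \<union> C' \<in> finitely_bounded"
proof -
  obtain \<C> \<C>' where "C = \<Union>\<C>" "C' = \<Union>\<C>'" "finite \<C>" "finite \<C>'"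
    "\<forall>A\<in>\<C> \<union> \<C>'. A \<in> \<AA> \<and> (\<exists>D\<ge>0. diameter_le d A D)"
    using assms unfolding finitely_bounded_def by blast
  then show ?thesis unfolding finitely_bounded_def
    by (intro CollectI exI[of _ "\<C> \<union> \<C>'"]) auto
qed

lemma diameter_le_subset: "\<lbrakk>diameter_le d A D; B \<subseteq> A\<rbrakk> \<Longrightarrow> diameter_le d B D"
  by (auto simp: diameter_le_def)

lemma finitely_bounded_Diff:
  assumes "C \<in> finitely_bounded" "B \<in> \<AA>"
  shows "C - B \<in> finitely_bounded"
proof -
  obtain \<C> where \<C>: "C = \<Union>\<C>" "finite \<C>" "\<forall>A\<in>\<C>. A \<in> \<AA> \<and> (\<exists>D\<ge>0. diameter_le d A D)"
    using assms unfolding finitely_bounded_def by blast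
  have "C - B = \<Union>((\<lambda>A. A - B) ` \<C>)" using \<C> by blast
  moreover have "\<forall>A\<in>(\<lambda>A. A - B) ` \<C>. A \<in> \<AA> \<and> (\<exists>D\<ge>0. diameter_le d A D)"
    using \<C>(3) assms(2) diameter_le_subset by blast
  ultimately show ?thesis using \<C>(2) unfolding finitely_bounded_def
    by (intro CollectI exI[of _ "(\<lambda>A. A - B) ` \<C>"]) auto
qed

lemma finitely_bounded_singleton: "\<lbrakk>A \<in> \<AA>; diameter_le d A D; D \<ge> 0\<rbrakk> \<Longrightarrow> A \<in> finitely_bounded"
  unfolding finitely_bounded_def by (intro CollectI exI[of _ "{A}"]) auto

lemma diameter_le_neighbourhood:
  assumes A: "A \<subseteq> X" "diameter_le d A D" "D \<ge> 0" and N: "N \<subseteq> X" "\<forall>x\<in>N. \<exists>a\<in>A. d a x \<le> ennreal r" and r: "r \<ge> 0"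
  shows "diameter_le d N (r + D + r)"
  unfolding diameter_le_def
proof (intro ballI)
  fix x x' assume x: "x \<in> N" "x' \<in> N"
  obtain a a' where a: "a \<in> A" "d a x \<le> ennreal r" "a' \<in> A" "d a' x' \<le> ennreal r" using N x by meson
  have X: "x \<in> X" "x' \<in> X" "a \<in> X" "a' \<in> X" using x a A N by auto
  have "d x x' \<le> d x a + d a x'" by (intro edist_triangle X)
  also have "\<dots> \<le> d x a + (d a a' + d a' x')" by (intro add_left_mono edist_triangle X)
  also have "\<dots> \<le> ennreal r + (ennreal D + ennreal r)"
    using a A(2) edist_commute[OF X(1,3)] by (intro add_mono) (auto simp: diameter_le_def)
  also have "\<dots> = ennreal (r + D + r)" using A r by (simp add: ennreal_plus[symmetric] algebra_simps del: ennreal_plus)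
  finally show "d x x' \<le> ennreal (r + D + r)" .
qed

lemma diameter_le_Un:
  assumes A: "A \<subseteq> X" "diameter_le d A D" "D \<ge> 0" and B: "B \<subseteq> X" "diameter_le d B D'" "D' \<ge> 0"
    and ab: "a \<in> A" "b \<in> B" "d a b \<le> ennreal r" and r: "r \<ge> 0"
  shows "diameter_le d (A \<union> B) (D + r + D')"
proof -
  have cross: "d x y \<le> ennreal (D + r + D')" if "x \<in> A" "y \<in> B" for x y
  proof -
    have X: "x \<in> X" "y \<in> X" "a \<in> X" "b \<in> X" using that ab A B by auto
    have "d x y \<le> d x a + d a y" by (intro edist_triangle X)
    also have "\<dots> \<le> d x a + (d a b + d b y)" by (intro add_left_mono edist_triangle X)
    also have "\<dots> \<le> ennreal D + (ennreal r + ennreal D')"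
      using that ab A(2) B(2) by (intro add_mono) (auto simp: diameter_le_def)
    also have "\<dots> = ennreal (D + r + D')" using A B r by (simp add: add.assoc)
    finally show ?thesis .
  qed
  have "ennreal D \<le> ennreal (D + r + D')" "ennreal D' \<le> ennreal (D + r + D')"
    using A B r by (auto intro!: ennreal_leI)
  then show ?thesis
    using cross A(1,2) B(1,2) edist_commute unfolding diameter_le_def
    by (metis (no_types, lifting) Un_iff order_trans subsetD)
qed

lemma finitely_bounded_neighbourhood:
  assumes disc: "discrete_module X d \<AA> E" and C: "C \<in> finitely_bounded" and r: "r \<ge> 0"
  shows "\<exists>N\<in>finitely_bounded. \<forall>a\<in>C. \<forall>x\<in>X. d a x \<le> ennreal r \<longrightarrow> x \<in> N"
proof -
  obtain c where c: "c \<ge> 0" and nb: "\<And>A R. \<lbrakk>A \<subseteq> X; R \<ge> 0\<rbrakk> \<Longrightarrow>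
    \<exists>N\<in>\<AA>. (\<forall>a\<in>A. \<forall>x\<in>X. d a x \<le> ennreal R \<longrightarrow> x \<in> N) \<and> (\<forall>x\<in>N. \<exists>a\<in>A. d a x \<le> ennreal (R + c))"
    using discrete_neighbourhoods[OF disc] by blast
  obtain \<C> where \<C>: "C = \<Union>\<C>" "finite \<C>" "\<forall>A\<in>\<C>. A \<in> \<AA> \<and> (\<exists>D\<ge>0. diameter_le d A D)"
    using C unfolding finitely_bounded_def by blast
  define good where "good A N \<longleftrightarrow> N \<in> \<AA> \<and> (\<forall>a\<in>A. \<forall>x\<in>X. d a x \<le> ennreal r \<longrightarrow> x \<in> N) \<and>
      (\<forall>x\<in>N. \<exists>a\<in>A. d a x \<le> ennreal (r + c))" for A N
  have "\<forall>A\<in>\<C>. \<exists>N. good A N"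
  proof
    fix A assume "A \<in> \<C>"
    then have "A \<subseteq> X" using \<C>(3) sets_into_space by blast
    from nb[OF this r] show "\<exists>N. good A N" unfolding good_def by (elim bexE) (intro exI conjI, auto)
  qed
  then obtain n where n: "\<And>A. A \<in> \<C> \<Longrightarrow> good A (n A)" by metis
  have "n A \<in> \<AA> \<and> (\<exists>D\<ge>0. diameter_le d (n A) D)" if A: "A \<in> \<C>" for A
  proof -
    obtain D where D: "D \<ge> 0" "diameter_le d A D" using \<C>(3) A by blast
    have "diameter_le d (n A) ((r + c) + D + (r + c))"
    proof (rule diameter_le_neighbourhood[OF _ D(2,1)])
      show "A \<subseteq> X" using \<C>(3) A sets_into_space by blast
      show "n A \<subseteq> X" using n[OF A] sets_into_space by (simp add: good_def)
      show "\<forall>x\<in>n A. \<exists>a\<in>A. d a x \<le> ennreal (r + c)" using n[OF A] by (simp add: good_def)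
    qed (use c r in simp)
    then show ?thesis using n[OF A] c r D unfolding good_def
      by (intro conjI exI[of _ "(r + c) + D + (r + c)"]) auto
  qed
  then have "\<Union>(n ` \<C>) \<in> finitely_bounded"
    using \<C>(2) unfolding finitely_bounded_def by (intro CollectI exI[of _ "n ` \<C>"]) auto
  moreover have "\<forall>a\<in>C. \<forall>x\<in>X. d a x \<le> ennreal r \<longrightarrow> x \<in> \<Union>(n ` \<C>)"
    using n unfolding good_def \<C>(1) by blast
  ultimately show ?thesis by blast
qed

text \<open>Finite unions of cells exhaust the module by the strong sum in the definition of
  discreteness. Joining \<open>C0\<close> to each of them puts the whole net above
  \<open>C0\<close>.\<close>

lemma finitely_bounded_exhaustion:
  assumes disc: "discrete_module X d \<AA> E" and C0: "C0 \<in> finitely_bounded"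
  shows "\<exists>G. G \<noteq> bot \<and> (\<forall>\<^sub>F C in G. C \<in> finitely_bounded \<and> C0 \<subseteq> C) \<and>
    (\<forall>v. ((\<lambda>C. blinfun_apply (E C) v) \<longlongrightarrow> v) G)"
proof -
  obtain r P where r: "r \<ge> 0" and P: "partition_on X P" "\<And>A. A \<in> P \<Longrightarrow> A \<in> \<AA> \<and> diameter_le d A r"
    and sum: "\<And>v. ((\<lambda>A. blinfun_apply (E A) v) has_sum v) P"
    using disc unfolding discrete_module_def by blast
  have fb: "\<Union>I \<in> finitely_bounded" if "finite I" "I \<subseteq> P" for I
    using that P(2) r unfolding finitely_bounded_def by (intro CollectI exI[of _ I]) blast
  have E_sum: "E (\<Union>I) v = (\<Sum>A\<in>I. E A v)" if "finite I" "I \<subseteq> P" for I v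
    using that
  proof (induction I rule: finite_induct)
    case (insert A I)
    have "A \<inter> B = {}" if "B \<in> I" for B
      using that insert.hyps(2) insert.prems by (intro disjointD[OF partition_onD2[OF P(1)]]) auto
    then have "A \<inter> \<Union>I = {}" by blast
    moreover have "\<Union>I \<in> \<AA>"
      using fb[of I] insert.hyps(1) insert.prems by (intro finitely_bounded_measurable) simp
    ultimately show ?case using insert P(2)[of A] E_disjoint_Un[of A "\<Union>I"]
      by (simp add: blinfun.add_left)
  qed (simp add: E_empty)
  define G where "G = filtermap (\<lambda>I. C0 \<union> \<Union>I) (finite_subsets_at_top P)"
  have ev: "\<forall>\<^sub>F I in finite_subsets_at_top P. C0 \<union> \<Union>I \<in> finitely_bounded"
    using fb finitely_bounded_Un[OF C0] by (intro eventually_finite_subsets_at_top_weakI) blast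
  show ?thesis
  proof (intro exI[of _ G] conjI allI)
    show "G \<noteq> bot" by (simp add: G_def filtermap_bot_iff)
    show "\<forall>\<^sub>F C in G. C \<in> finitely_bounded \<and> C0 \<subseteq> C"
      unfolding G_def eventually_filtermap using ev by eventually_elim auto
    fix v
    have lim: "((\<lambda>I. (\<Sum>A\<in>I. E A v) - v) \<longlongrightarrow> 0) (finite_subsets_at_top P)"
      using sum[of v] unfolding has_sum_def by (simp add: LIM_zero)
    \<comment> \<open>The contraction \<open>id_blinfun - E (C0 \<union> \<Union>I)\<close> kills
      the partial sum over \<open>I\<close>, so the larger projection is at least as close to
      \<open>v\<close> as that sum.\<close>
    have bound: "\<forall>\<^sub>F I in finite_subsets_at_top P. norm (E (C0 \<union> \<Union>I) v - v) \<le> norm ((\<Sum>A\<in>I. E A v) - v)"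
    proof (rule eventually_finite_subsets_at_top_weakI)
      fix I assume I: "finite I" "I \<subseteq> P"
      have m: "\<Union>I \<in> \<AA>" "C0 \<union> \<Union>I \<in> \<AA>"
        using fb[OF I] C0 finitely_bounded_measurable by auto
      have "(id_blinfun - E (C0 \<union> \<Union>I)) ((\<Sum>A\<in>I. E A v) - v) = E (C0 \<union> \<Union>I) v - v"
        using m by (simp add: E_sum[OF I, symmetric] blinfun.diff_left blinfun.diff_right E_apply_Int Int_absorb1)
      then show "norm (E (C0 \<union> \<Union>I) v - v) \<le> norm ((\<Sum>A\<in>I. E A v) - v)"
        using projection_norm_apply_le[OF projection_compl[OF E_projection[OF m(2)]]] by metis
    qed
    have "((\<lambda>I. E (C0 \<union> \<Union>I) v - v) \<longlongrightarrow> 0) (finite_subsets_at_top P)"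
      by (rule Lim_null_comparison[OF bound tendsto_norm_zero[OF lim]])
    then show "((\<lambda>C. E C v) \<longlongrightarrow> v) G"
      unfolding G_def filterlim_filtermap by (simp add: LIM_zero_iff)
  qed
qed

definition controlled :: "real \<Rightarrow> ('h \<Rightarrow>\<^sub>L 'h) set" where
  "controlled r = {t \<in> bounded_operators. propagation_le d \<AA> E t r \<and> norm t \<le> 1}"

lemma controlled_cut:
  "\<lbrakk>t \<in> controlled r; C \<in> \<AA>; D \<in> \<AA>\<rbrakk> \<Longrightarrow> E C o\<^sub>L t o\<^sub>L E D \<in> controlled r"
  unfolding controlled_def using projection_norm_le[OF E_projection]
  by (simp add: bounded_operators_compose E_bounded propagation_le_cut norm_compose_le_one)

lemma controlled_finite_propagation: "\<lbrakk>t \<in> controlled r; r \<ge> 0\<rbrakk> \<Longrightarrow> t \<in> finite_propagation"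
  by (auto simp: controlled_def finite_propagation_def)

end


section \<open>Approximability of controlled operators\<close>

context strongly_continuous_homomorphism
begin

text \<open>\<open>R\<close> may depend on the block but not on \<open>t\<close>. All errors are
  quantified inside, so blocks can be added by halving \<open>\<epsilon>\<close>.\<close>

definition block_approximable :: "real \<Rightarrow> 'x set \<Rightarrow> 'x set \<Rightarrow> bool" where
  "block_approximable r C D \<longleftrightarrow>
     (\<forall>\<epsilon>>0. \<exists>R\<ge>0. \<forall>t\<in>dom.controlled r. cod.approximable (\<phi> (E C o\<^sub>L t o\<^sub>L E D)) \<epsilon> R)"

lemma block_approximable_add:
  assumes 1: "block_approximable r C D" and 2: "block_approximable r C' D'"
    and split: "\<And>t. E C'' o\<^sub>L t o\<^sub>L E D'' = (E C o\<^sub>L t o\<^sub>L E D) + (E C' o\<^sub>L t o\<^sub>L E D')"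
    and meas: "C \<in> \<AA>" "D \<in> \<AA>" "C' \<in> \<AA>" "D' \<in> \<AA>" and r: "r \<ge> 0"
  shows "block_approximable r C'' D''"
  unfolding block_approximable_def
proof (intro allI impI)
  fix \<epsilon> :: real assume "\<epsilon> > 0"
  then have "\<epsilon> / 2 > 0" by simp
  obtain R where R: "R \<ge> 0" "\<And>t. t \<in> dom.controlled r \<Longrightarrow> cod.approximable (\<phi> (E C o\<^sub>L t o\<^sub>L E D)) (\<epsilon>/2) R"
    using 1 \<open>\<epsilon>/2 > 0\<close> unfolding block_approximable_def by blast
  obtain R' where R': "R' \<ge> 0" "\<And>t. t \<in> dom.controlled r \<Longrightarrow> cod.approximable (\<phi> (E C' o\<^sub>L t o\<^sub>L E D')) (\<epsilon>/2) R'"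
    using 2 \<open>\<epsilon>/2 > 0\<close> unfolding block_approximable_def by blast
  show "\<exists>R\<ge>0. \<forall>t\<in>dom.controlled r. cod.approximable (\<phi> (E C'' o\<^sub>L t o\<^sub>L E D'')) \<epsilon> R"
  proof (intro exI[of _ "max R R'"] conjI ballI)
    fix t assume t: "t \<in> dom.controlled r"
    have "\<phi> (E C'' o\<^sub>L t o\<^sub>L E D'') = \<phi> (E C o\<^sub>L t o\<^sub>L E D) + \<phi> (E C' o\<^sub>L t o\<^sub>L E D')"
      unfolding split using dom.controlled_cut[OF t] dom.controlled_finite_propagation[OF _ r] meas
      by (intro phi_add) blast+
    then show "cod.approximable (\<phi> (E C'' o\<^sub>L t o\<^sub>L E D'')) \<epsilon> (max R R')"
      using cod.approximable_add[OF R(2)[OF t] R'(2)[OF t]] by simp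
  qed (use R in simp)
qed

lemma block_approximable_zero:
  assumes "\<And>t. t \<in> dom.controlled r \<Longrightarrow> E C o\<^sub>L t o\<^sub>L E D = 0"
  shows "block_approximable r C D"
  unfolding block_approximable_def
  using assms by (auto simp: phi_zero intro!: exI[of _ 0] cod.approximable_zero)

text \<open>Either \<open>A\<close> and \<open>B\<close> are farther apart than \<open>r\<close> and
  the block vanishes, or they are within finite distance and \<open>A \<union> B\<close> is bounded.
  In that case ampleness supplies a bounded set of infinite rank near a point of \<open>A\<close>;
  adjoining it gives one bounded \<open>W\<close> of infinite rank carrying the whole block.\<close>

lemma block_approximable_bounded:
  assumes A: "A \<in> \<AA>" "diameter_le dX A D" "D \<ge> 0" and B: "B \<in> \<AA>" "diameter_le dX B D'" "D' \<ge> 0"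
    and ample: "ample_module X dX \<AA> E" and disc: "discrete_module Y dY \<BB> F" and r: "r \<ge> 0"
  shows "block_approximable r A B"
proof (cases "\<forall>b\<in>B. \<forall>a\<in>A. dX a b > ennreal r")
  case True
  then show ?thesis
    using A B by (intro block_approximable_zero) (auto simp: dom.controlled_def propagation_le_def)
next
  case False
  then obtain a b where ab: "a \<in> A" "b \<in> B" "dX a b \<le> ennreal r" by (meson not_le)
  obtain r1 R1 where r1: "r1 \<ge> 0" "R1 \<ge> 0" and dense:
    "\<forall>x\<in>X. \<exists>y\<in>\<Union>{A\<in>\<AA>. diameter_le dX A r1 \<and> infinite_rank (E A)}. dX x y \<le> ennreal R1"
    using ample unfolding ample_module_def coarsely_dense_def by blast
  have sub: "A \<subseteq> X" "B \<subseteq> X" using A B dom.sets_into_space by auto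
  obtain y A0 where A0: "A0 \<in> \<AA>" "diameter_le dX A0 r1" "infinite_rank (E A0)" "y \<in> A0" "dX a y \<le> ennreal R1"
    using dense ab(1) sub by blast
  define W where "W = (A \<union> B) \<union> A0"
  have W: "W \<in> \<AA>" using A B A0 by (auto simp: W_def)
  have AB: "diameter_le dX (A \<union> B) (D + r + D')"
    by (rule dom.diameter_le_Un[OF sub(1) A(2,3) sub(2) B(2,3) ab r])
  have diam: "diameter_le dX W ((D + r + D') + R1 + r1)"
    unfolding W_def by (rule dom.diameter_le_Un[where a = a and b = y])
      (use AB A B A0 ab r1 r sub dom.sets_into_space[OF A0(1)] in auto)
  have AW: "A \<subseteq> W" and BW: "B \<subseteq> W" by (auto simp: W_def)
  have cutW: "E W (E C v) = E C v" "E C (E W v) = E C v" if "C \<in> \<AA>" "C \<subseteq> W" for C v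
    using that W by (simp_all add: dom.E_apply_Int Int_absorb1 Int_absorb2)
  have "infinite_rank (E W)"
  proof -
    have "range (E A0) \<subseteq> range (E W)"
      using cutW(1)[OF A0(1)] by (metis W_def image_subsetI rangeI Un_upper2)
    then show ?thesis using A0(3) unfolding infinite_rank_def by (meson order_trans)
  qed
  show ?thesis
    unfolding block_approximable_def
  proof (intro allI impI)
    fix \<epsilon> :: real assume "\<epsilon> > 0"
    obtain R where R: "R \<ge> 0" "\<And>t. \<lbrakk>t \<in> bounded_operators; E W o\<^sub>L t o\<^sub>L E W = t; norm t \<le> 1\<rbrakk>
        \<Longrightarrow> cod.approximable (\<phi> t) \<epsilon> R"
      using approximable_bounded_infinite_rank[OF W diam _ \<open>infinite_rank (E W)\<close> disc \<open>\<epsilon> > 0\<close>]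
        A(3) B(3) r r1 by force
    have "cod.approximable (\<phi> (E A o\<^sub>L t o\<^sub>L E B)) \<epsilon> R" if t: "t \<in> dom.controlled r" for t
    proof (rule R(2))
      show "E A o\<^sub>L t o\<^sub>L E B \<in> bounded_operators" "norm (E A o\<^sub>L t o\<^sub>L E B) \<le> 1"
        using dom.controlled_cut[OF t A(1) B(1)] by (auto simp: dom.controlled_def)
      show "E W o\<^sub>L (E A o\<^sub>L t o\<^sub>L E B) o\<^sub>L E W = E A o\<^sub>L t o\<^sub>L E B"
        by (rule blinfun_eqI) (use A B in \<open>simp add: cutW AW BW\<close>)
    qed
    then show "\<exists>R\<ge>0. \<forall>t\<in>dom.controlled r. cod.approximable (\<phi> (E A o\<^sub>L t o\<^sub>L E B)) \<epsilon> R"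
      using R(1) by blast
  qed
qed

lemma block_approximable_finitely_bounded:
  assumes C: "C \<in> dom.finitely_bounded" and D: "D \<in> dom.finitely_bounded"
    and ample: "ample_module X dX \<AA> E" and disc: "discrete_module Y dY \<BB> F" and r: "r \<ge> 0"
  shows "block_approximable r C D"
proof -
  let ?bdd = "\<lambda>A. A \<in> \<AA> \<and> (\<exists>D\<ge>0. diameter_le dX A D)"
  have diff: "?bdd (A - B)" if "?bdd A" "B \<in> \<AA>" for A B
    using that dom.diameter_le_subset[of A _ "A - B"] by auto
  have one: "block_approximable r A (\<Union>\<D>)" if A: "?bdd A" and "finite \<D>" "\<forall>B\<in>\<D>. ?bdd B" for A \<D>
    using that(2,3)
  proof (induction \<D> rule: finite_induct)
    case empty
    then show ?case by (intro block_approximable_zero) (simp add: dom.E_empty)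
  next
    case (insert B \<D>)
    have m: "\<Union>\<D> \<in> \<AA>" using insert by (intro dom.finite_Union) auto
    \<comment> \<open>\<open>E\<close> is additive only on disjoint unions, so the new piece enters
      without its overlap with the earlier ones.\<close>
    have bd: "?bdd (B - \<Union>\<D>)" using insert m by (intro diff) auto
    show ?case
    proof (rule block_approximable_add)
      show "block_approximable r A (\<Union>\<D>)" using insert by simp
      show "block_approximable r A (B - \<Union>\<D>)"
        using A bd block_approximable_bounded[OF _ _ _ _ _ _ ample disc r] by blast
      have "E (\<Union>(insert B \<D>)) = E (\<Union>\<D>) + E (B - \<Union>\<D>)"
        using dom.E_disjoint_Un[of "\<Union>\<D>" "B - \<Union>\<D>"] m bd by (simp add: Un_commute)
      then show "E A o\<^sub>L t o\<^sub>L E (\<Union>(insert B \<D>)) = (E A o\<^sub>L t o\<^sub>L E (\<Union>\<D>)) + (E A o\<^sub>L t o\<^sub>L E (B - \<Union>\<D>))" for t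
        by (intro blinfun_eqI) (simp add: blinfun.add_left blinfun.add_right)
    qed (use A m bd r in auto)
  qed
  obtain \<C> where \<C>: "C = \<Union>\<C>" "finite \<C>" "\<forall>A\<in>\<C>. ?bdd A"
    using C unfolding dom.finitely_bounded_def by blast
  obtain \<D> where \<D>: "D = \<Union>\<D>" "finite \<D>" "\<forall>A\<in>\<D>. ?bdd A"
    using D unfolding dom.finitely_bounded_def by blast
  have DD: "D \<in> \<AA>" using D by (rule dom.finitely_bounded_measurable)
  show ?thesis
    unfolding \<C>(1) using \<C>(2,3)
  proof (induction \<C> rule: finite_induct)
    case empty
    then show ?case by (intro block_approximable_zero) (simp add: dom.E_empty)
  next
    case (insert B \<C>)
    have m: "\<Union>\<C> \<in> \<AA>" using insert by (intro dom.finite_Union) auto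
    have bd: "?bdd (B - \<Union>\<C>)" using insert m by (intro diff) auto
    show ?case
    proof (rule block_approximable_add)
      show "block_approximable r (\<Union>\<C>) D" using insert by simp
      show "block_approximable r (B - \<Union>\<C>) D"
        unfolding \<D>(1) by (rule one[OF bd \<D>(2,3)])
      have "E (\<Union>(insert B \<C>)) = E (\<Union>\<C>) + E (B - \<Union>\<C>)"
        using dom.E_disjoint_Un[of "\<Union>\<C>" "B - \<Union>\<C>"] m bd by (simp add: Un_commute)
      then show "E (\<Union>(insert B \<C>)) o\<^sub>L t o\<^sub>L E D = (E (\<Union>\<C>) o\<^sub>L t o\<^sub>L E D) + (E (B - \<Union>\<C>) o\<^sub>L t o\<^sub>L E D)" for t
        by (intro blinfun_eqI) (simp add: blinfun.add_left blinfun.add_right)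
    qed (use DD m bd r in auto)
  qed
qed

text \<open>The corner argument for all operators of propagation at most \<open>r\<close>. The
  measurable \<open>r\<close>-neighbourhood of a finitely bounded set absorbs ranges, and the
  vanishing of far blocks passes to strong sums.\<close>

lemma approximable_outside_finitely_bounded:
  assumes disc: "discrete_module X dX \<AA> E" and r: "r \<ge> 0" and \<epsilon>: "\<epsilon> > 0"
  shows "\<exists>C\<in>dom.finitely_bounded. \<exists>D\<in>dom.finitely_bounded. \<exists>R\<ge>0. \<forall>t\<in>dom.controlled r.
    cod.approximable (\<phi> ((id_blinfun - E D) o\<^sub>L t o\<^sub>L (id_blinfun - E C))) \<epsilon> R"
proof -
  define \<T> where "\<T> = {t \<in> bounded_operators. propagation_le dX \<AA> E t r}"
  have meas: "C \<in> \<AA>" if "C \<in> dom.finitely_bounded" for C using that by (rule dom.finitely_bounded_measurable)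
  have nested: "E C o\<^sub>L E C' = E C" "E C' o\<^sub>L E C = E C" if "C \<in> \<AA>" "C' \<in> \<AA>" "C \<subseteq> C'" for C C'
    using that dom.E_Int[of C C'] dom.E_Int[of C' C] by (simp_all add: Int_absorb1 Int_absorb2)
  have cut: "E C o\<^sub>L t \<in> \<T>" "t o\<^sub>L E C \<in> \<T>" if "t \<in> \<T>" "C \<in> \<AA>" for t C
  proof -
    \<comment> \<open>One-sided cuts are two-sided cuts whose other factor is \<open>E X\<close>,
      the identity.\<close>
    have eq: "E C o\<^sub>L t o\<^sub>L E X = E C o\<^sub>L t" "E X o\<^sub>L t o\<^sub>L E C = t o\<^sub>L E C"
      by (rule blinfun_eqI, simp add: dom.E_space)+
    have "propagation_le dX \<AA> E (E C o\<^sub>L t) r" "propagation_le dX \<AA> E (t o\<^sub>L E C) r"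
      using that dom.propagation_le_cut[of t r C X] dom.propagation_le_cut[of t r X C] dom.top
      unfolding eq by (auto simp: \<T>_def)
    then show "E C o\<^sub>L t \<in> \<T>" "t o\<^sub>L E C \<in> \<T>"
      using that unfolding \<T>_def by (auto intro!: bounded_operators_compose dom.E_bounded)
  qed
  have "\<exists>p\<in>E ` dom.finitely_bounded. \<exists>q\<in>E ` dom.finitely_bounded. \<exists>R\<ge>0. \<forall>t\<in>\<T>. norm t \<le> 1 \<longrightarrow>
    cod.approximable (\<phi> ((id_blinfun - q) o\<^sub>L t o\<^sub>L (id_blinfun - p))) \<epsilon> R"
  proof (rule approximable_corner)
    show "is_projection p" if "p \<in> E ` dom.finitely_bounded" for p
      using that meas dom.E_projection by blast
    have "{} \<in> dom.finitely_bounded"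
      by (rule dom.finitely_bounded_singleton[of _ 0]) (auto simp: diameter_le_def)
    then show "E ` dom.finitely_bounded \<noteq> {}" by blast
  next
    fix p0 assume "p0 \<in> E ` dom.finitely_bounded"
    then obtain C0 where C0: "C0 \<in> dom.finitely_bounded" "p0 = E C0" by blast
    obtain G where G: "G \<noteq> bot" "\<forall>\<^sub>F C in G. C \<in> dom.finitely_bounded \<and> C0 \<subseteq> C"
      "\<And>v. ((\<lambda>C. E C v) \<longlongrightarrow> v) G"
      using dom.finitely_bounded_exhaustion[OF disc C0(1)] by blast
    show "\<exists>G. G \<noteq> bot \<and> (\<forall>\<^sub>F p in G. p \<in> E ` dom.finitely_bounded \<and> p0 o\<^sub>L p = p0 \<and> p o\<^sub>L p0 = p0) \<and>
        (\<forall>t\<in>\<T>. \<forall>v. ((\<lambda>p. blinfun_apply t (blinfun_apply p v)) \<longlongrightarrow> blinfun_apply t v) G)"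
    proof (intro exI[of _ "filtermap E G"] conjI ballI allI)
      show "filtermap E G \<noteq> bot" using G(1) by (simp add: filtermap_bot_iff)
      show "\<forall>\<^sub>F p in filtermap E G. p \<in> E ` dom.finitely_bounded \<and> p0 o\<^sub>L p = p0 \<and> p o\<^sub>L p0 = p0"
        unfolding eventually_filtermap using G(2)
        by eventually_elim (use nested meas C0 in auto)
      show "((\<lambda>p. blinfun_apply t (blinfun_apply p v)) \<longlongrightarrow> blinfun_apply t v) (filtermap E G)" for t v
        unfolding filterlim_filtermap by (intro bounded_linear.tendsto[OF blinfun.bounded_linear_right] G(3))
    qed
  next
    fix t p q0 assume t: "t \<in> \<T>" and "p \<in> E ` dom.finitely_bounded" "q0 \<in> E ` dom.finitely_bounded"
    then obtain C D where C: "C \<in> dom.finitely_bounded" "p = E C" and D: "D \<in> dom.finitely_bounded" "q0 = E D"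
      by blast
    obtain N where N: "N \<in> dom.finitely_bounded" "\<forall>a\<in>C. \<forall>x\<in>X. dX a x \<le> ennreal r \<longrightarrow> x \<in> N"
      using dom.finitely_bounded_neighbourhood[OF disc C(1) r] by blast
    have DN: "D \<union> N \<in> dom.finitely_bounded" using D N by (intro dom.finitely_bounded_Un)
    have "E (D \<union> N) o\<^sub>L t o\<^sub>L E C = t o\<^sub>L E C"
      by (rule dom.propagation_le_neighbourhood(1)[of t r])
         (use t N meas[OF C(1)] meas[OF DN] in \<open>auto simp: \<T>_def\<close>)
    then show "\<exists>q\<in>E ` dom.finitely_bounded. q0 o\<^sub>L q = q0 \<and> q o\<^sub>L q0 = q0 \<and> q o\<^sub>L t o\<^sub>L p = t o\<^sub>L p"
      using nested[OF meas[OF D(1)] meas[OF DN]] DN unfolding C(2) D(2)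
      by (intro bexI[of _ "E (D \<union> N)"]) auto
  next
    show "\<T> \<subseteq> dom.finite_propagation" using r by (auto simp: \<T>_def dom.finite_propagation_def)
    show "s - t \<in> \<T>" if "s \<in> \<T>" "t \<in> \<T>" for s t
      using that dom.propagation_le_diff[of s r t r] by (auto simp: \<T>_def bounded_operators_diff)
    show "t o\<^sub>L p \<in> \<T>" "p o\<^sub>L t \<in> \<T>" if "t \<in> \<T>" "p \<in> E ` dom.finitely_bounded" for t p
      using that cut meas by blast+
  next
    fix a :: "nat \<Rightarrow> 'h \<Rightarrow>\<^sub>L 'h" and T :: "'h \<Rightarrow>\<^sub>L 'h"
    assume a: "\<And>n. a n \<in> \<T>" and T: "T \<in> bounded_operators"
      and sums: "\<And>v. (\<lambda>n. a n v) sums T v"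
    have "propagation_le dX \<AA> E T r"
    proof (rule dom.propagation_leI)
      fix A A' v assume A: "A \<in> \<AA>" "A' \<in> \<AA>" "\<And>x x'. \<lbrakk>x \<in> A; x' \<in> A'\<rbrakk> \<Longrightarrow> ennreal r < dX x' x"
      have "(\<lambda>n. E A' (a n (E A v))) sums E A' (T (E A v))"
        by (rule bounded_linear.sums[OF blinfun.bounded_linear_right sums])
      moreover have "E A' (a n (E A v)) = 0" for n
        using a[of n] A by (intro dom.propagation_leD[of _ r]) (auto simp: \<T>_def)
      ultimately show "E A' (T (E A v)) = 0" using sums_unique2[OF sums_zero] by simp
    qed
    then show "T \<in> dom.finite_propagation" using T r by (intro dom.finite_propagationI)
  qed (rule \<epsilon>)
  then show ?thesis unfolding dom.controlled_def \<T>_def by blast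
qed

theorem approximable_controlled:
  assumes discX: "discrete_module X dX \<AA> E" and ample: "ample_module X dX \<AA> E"
    and discY: "discrete_module Y dY \<BB> F" and r: "r \<ge> 0" and \<epsilon>: "\<epsilon> > 0"
  shows "\<exists>R\<ge>0. \<forall>t\<in>dom.controlled r. cod.approximable (\<phi> t) \<epsilon> R"
proof -
  have \<epsilon>3: "\<epsilon> / 3 > 0" using \<epsilon> by simp
  obtain C D R where C: "C \<in> dom.finitely_bounded" and D: "D \<in> dom.finitely_bounded" and R: "R \<ge> 0"
    "\<And>t. t \<in> dom.controlled r \<Longrightarrow>
      cod.approximable (\<phi> ((id_blinfun - E D) o\<^sub>L t o\<^sub>L (id_blinfun - E C))) (\<epsilon>/3) R"
    using approximable_outside_finitely_bounded[OF discX r \<epsilon>3] by blast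
  obtain N where N: "N \<in> dom.finitely_bounded" "\<forall>a\<in>C. \<forall>x\<in>X. dX a x \<le> ennreal r \<longrightarrow> x \<in> N"
    using dom.finitely_bounded_neighbourhood[OF discX C r] by blast
  obtain N' where N': "N' \<in> dom.finitely_bounded" "\<forall>a\<in>D. \<forall>x\<in>X. dX a x \<le> ennreal r \<longrightarrow> x \<in> N'"
    using dom.finitely_bounded_neighbourhood[OF discX D r] by blast
  have meas: "C \<in> \<AA>" "D \<in> \<AA>" "N \<in> \<AA>" "N' \<in> \<AA>"
    using C D N N' by (simp_all add: dom.finitely_bounded_measurable)
  have NC: "N' - C \<in> dom.finitely_bounded" by (rule dom.finitely_bounded_Diff[OF N'(1) meas(1)])
  obtain R1 where R1: "R1 \<ge> 0" "\<And>t. t \<in> dom.controlled r \<Longrightarrow> cod.approximable (\<phi> (E D o\<^sub>L t o\<^sub>L E (N' - C))) (\<epsilon>/3) R1"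
    using block_approximable_finitely_bounded[OF D NC ample discY r] \<epsilon>3 unfolding block_approximable_def by blast
  obtain R2 where R2: "R2 \<ge> 0" "\<And>t. t \<in> dom.controlled r \<Longrightarrow> cod.approximable (\<phi> (E N o\<^sub>L t o\<^sub>L E C)) (\<epsilon>/3) R2"
    using block_approximable_finitely_bounded[OF N(1) C ample discY r] \<epsilon>3 unfolding block_approximable_def by blast
  show ?thesis
  proof (intro exI[of _ "max (max R R1) R2"] conjI ballI)
    fix t assume t: "t \<in> dom.controlled r"
    have controlled_t: "propagation_le dX \<AA> E t r" using t by (simp add: dom.controlled_def)
    have 1: "E N (t (E C v)) = t (E C v)" for v
      using dom.propagation_le_neighbourhood(1)[OF controlled_t meas(1,3) N(2)] by (metis blinfun_apply_blinfun_compose)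
    have 2: "E D (t (E N' v)) = E D (t v)" for v
      using dom.propagation_le_neighbourhood(2)[OF controlled_t meas(2,4) N'(2)] by (metis blinfun_apply_blinfun_compose)
    have 3: "E (N' - C) v = E N' (v - E C v)" for v
    proof -
      have "N' - C = N' \<inter> (X - C)" using dom.sets_into_space[OF meas(4)] by blast
      then have "E (N' - C) v = E N' (E (X - C) v)"
        using meas dom.compl_sets by (simp add: dom.E_apply_Int)
      then show ?thesis using meas by (simp add: dom.E_compl blinfun.diff_left)
    qed
    let ?u = "(id_blinfun - E D) o\<^sub>L t o\<^sub>L (id_blinfun - E C)"
    let ?b = "E D o\<^sub>L t o\<^sub>L E (N' - C)" and ?c = "E N o\<^sub>L t o\<^sub>L E C"
    \<comment> \<open>The part outside the corner is \<open>E D t (1 - E C) + t E C\<close>. Bounded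
      propagation confines the first summand to columns in \<open>N' - C\<close> and the second to
      rows in \<open>N\<close>, so both are finitely bounded blocks.\<close>
    have eq: "t = ?u + ?b + ?c"
      by (rule blinfun_eqI) (simp add: blinfun.add_left blinfun.diff_left blinfun.diff_right 1 2 3)
    have fp: "t \<in> dom.finite_propagation" "?b \<in> dom.finite_propagation" "?c \<in> dom.finite_propagation"
      using t meas dom.finitely_bounded_measurable[OF NC] r
      by (auto intro!: dom.controlled_finite_propagation dom.controlled_cut)
    have "?u = t - ?b - ?c" using eq by (simp add: algebra_simps)
    then have u: "?u \<in> dom.finite_propagation" using fp by (simp add: dom.finite_propagation_diff)
    have "\<phi> t = \<phi> ?u + \<phi> ?b + \<phi> ?c"
      using arg_cong[OF eq, of \<phi>] u fp by (simp add: phi_add dom.finite_propagation_add)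
    moreover have "cod.approximable (\<phi> ?u + \<phi> ?b + \<phi> ?c) (\<epsilon>/3 + \<epsilon>/3 + \<epsilon>/3) (max (max R R1) R2)"
      by (intro cod.approximable_add R(2) R1(2) R2(2) t)
    ultimately show "cod.approximable (\<phi> t) \<epsilon> (max (max R R1) R2)" by simp
  qed (use R in simp)
qed

end

section \<open>From the unit ball to relative errors\<close>

theorem theoremC:
  fixes X :: "'x set" and dX :: "'x \<Rightarrow> 'x \<Rightarrow> ennreal" and \<AA> :: "'x set set"
    and E :: "'x set \<Rightarrow> ('h::complex_hilbert \<Rightarrow>\<^sub>L 'h)"
    and Y :: "'y set" and dY :: "'y \<Rightarrow> 'y \<Rightarrow> ennreal" and \<BB> :: "'y set set"
    and F :: "'y set \<Rightarrow> ('k::complex_hilbert \<Rightarrow>\<^sub>L 'k)"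
    and \<phi> :: "('h \<Rightarrow>\<^sub>L 'h) \<Rightarrow> ('k \<Rightarrow>\<^sub>L 'k)"
  assumes "proper_extended_metric_space X dX"
    and "proper_extended_metric_space Y dY"
    and "geometric_module X dX \<AA> E"
    and "discrete_module X dX \<AA> E"
    and "ample_module X dX \<AA> E"
    and "geometric_module Y dY \<BB> F"
    and "discrete_module Y dY \<BB> F"
    and "ample_module Y dY \<BB> F"
    and "star_homomorphism (Cstar_cp dX \<AA> E) (Cstar_cp dY \<BB> F) \<phi>"
    and "strongly_continuous (Cstar_cp dX \<AA> E) (Cstar_cp dY \<BB> F) \<phi>"
  shows "approximately_controlled dX \<AA> E dY \<BB> F \<phi>"
proof -
  interpret strongly_continuous_homomorphism X dX \<AA> E Y dY \<BB> F \<phi>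
    using assms by (simp add: strongly_continuous_homomorphism_def strongly_continuous_homomorphism_axioms_def)
  show ?thesis
    unfolding approximately_controlled_def
  proof (intro allI impI)
    fix r \<epsilon> :: real assume r: "0 \<le> r" and \<epsilon>: "0 < \<epsilon>"
    obtain R where R: "R \<ge> 0" "\<And>t. t \<in> dom.controlled r \<Longrightarrow> cod.approximable (\<phi> t) \<epsilon> R"
      using approximable_controlled[OF assms(4,5,7) r \<epsilon>] by blast
    have "\<exists>s\<in>bounded_operators. propagation_le dY \<BB> F s R \<and> norm (\<phi> t - s) \<le> \<epsilon> * norm t"
      if t: "t \<in> Cstar_cp dX \<AA> E" "propagation_le dX \<AA> E t r" for t
    proof -
      have bd: "t \<in> bounded_operators" using t(1) dom.Cstar_cp_bounded by blast
      have fp: "t \<in> dom.finite_propagation" by (rule dom.finite_propagationI[OF bd r t(2)])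
      have "cod.approximable (\<phi> t) (norm t * \<epsilon>) R"
      proof (cases "t = 0")
        case True
        then show ?thesis by (simp add: phi_zero cod.approximable_zero)
      next
        case False
        \<comment> \<open>The bound \<open>R\<close> was obtained for norm at most one; scaling back
          by \<open>norm t\<close> leaves the propagation unchanged and makes the error
          relative.\<close>
        define u where "u = (1 / norm t) *\<^sub>R t"
        have u: "u \<in> dom.controlled r"
          using False bd t(2) by (simp add: u_def dom.controlled_def bounded_operators_scaleR dom.propagation_le_scaleR)
        have "\<phi> t = norm t *\<^sub>R \<phi> u" unfolding u_def phi_scaleR[OF fp] using False by simp
        then show ?thesis using cod.approximable_scaleR[OF R(2)[OF u], of "norm t"] by simp
      qed
      then show ?thesis by (simp add: cod.approximable_def mult.commute)
    qed
    then show "\<exists>R\<ge>0. \<forall>t\<in>Cstar_cp dX \<AA> E. propagation_le dX \<AA> E t r \<longrightarrow>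
        (\<exists>s\<in>bounded_operators. propagation_le dY \<BB> F s R \<and> norm (\<phi> t - s) \<le> \<epsilon> * norm t)"
      using R(1) by blast
  qed
qed

end
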